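(* Let $U\subseteq F^d$ be open, $\mathbf x_0\in U$, and $f:U\to F^n$ satisfy (II), (III), (IV). Then there exist a sufficiently small ball $B_0\subseteq U$ centred at $\mathbf x_0$ and constants $C,\alpha_1>0$ such that for every ball $B\subseteq B_0$ and every $0<\delta<1$, $$|\Phi^f(t,\delta)\cap B|\le C\delta^{\alpha_1}|B|$$ for all sufficiently large $t\in\mathbb N$, where $\Phi^f(t,\delta)=\{\mathbf x\in U:\ \exists\,\mathbf a\in\Lambda^n\setminus\{0\},\ a_0\in\Lambda\text{ with }|f(\mathbf x)\cdot\mathbf a+a_0|<\delta q^{-nt}\text{ and }\|\mathbf a\|=q^t\}$. In particular $f$ is nice at every point of $U$.
   Context: $\Lambda=\mathbb F_q[X]$, $F=\mathbb F_q((X^{-1}))$ with $|a|=q^{\deg a}$; sup norm on $F^k$; $|\cdot|$ is normalized Haar measure on $F^d$. (II) $f$ analytic, extends analytically to the boundary of $U$, $f_1(\mathbf x)=x_1$. (III) $1,f_1,\dots,f_n$ restricted to any open subset of $U$ are linearly independent over $F$. (IV) $\|f\|\le1$, $\|\nabla f\|\le1$, all extended second-order difference quotients of $f$ have norm $\le1$ on $U$. $f$ is called nice at $\mathbf x_0\in U$ if there exist a neighbourhood $U_0\subseteq U$ of $\mathbf x_0$ and constants $0<\delta,w<1$ such that for every sufficiently small ball $B\subseteq U_0$, $\limsup_{t\to\infty}|\Phi^f(t,\delta)\cap B|\le w|B|$. *)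

theory Defs
  imports "HOL-Analysis.Analysis" "HOL-Computational_Algebra.Formal_Laurent_Series"
begin

text \<open>
  The base field F_q is an arbitrary finite field, modelled by a type 'k of classes finite and
  field, with q = CARD('k).  The field F = F_q((X^{-1})) is modelled as 'k fls, formal Laurent
  series in the variable T = X^{-1} (finitely many negative powers of T = finitely many positive
  powers of X).  The coefficient of X^{-i} of a is  fls_nth a i.
  Absolute value: |a| = q^{deg_X a} = q^{- subdegree_T a}, and |0| = 0.
\<close>

definition absF :: "'k::{finite,field} fls \<Rightarrow> real" where
  "absF a = (if a = 0 then 0 else real CARD('k) powr (- real_of_int (fls_subdegree a)))"

text \<open>Lambda = F_q[X]: no negative powers of X, i.e. no positive powers of T.\<close>
definition LambdaF :: "'k::{finite,field} fls set" where
  "LambdaF = {a. \<forall>i>0. fls_nth a i = 0}"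

definition vecF :: "nat \<Rightarrow> (nat \<Rightarrow> 'k::{finite,field} fls) set" where
  "vecF d = {x. \<forall>i\<ge>d. x i = 0}"

definition vnormF :: "nat \<Rightarrow> (nat \<Rightarrow> 'k::{finite,field} fls) \<Rightarrow> real" where
  "vnormF d x = Max (insert 0 ((\<lambda>i. absF (x i)) ` {..<d}))"

text \<open>(Closed) balls in F^d; by ultrametricity every open ball is also such a ball.\<close>
definition cballF :: "nat \<Rightarrow> (nat \<Rightarrow> 'k::{finite,field} fls) \<Rightarrow> real \<Rightarrow> (nat \<Rightarrow> 'k fls) set" where
  "cballF d c r = {x \<in> vecF d. vnormF d (\<lambda>i. x i - c i) \<le> r}"

definition is_ballF :: "nat \<Rightarrow> (nat \<Rightarrow> 'k::{finite,field} fls) set \<Rightarrow> bool" where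
  "is_ballF d B \<longleftrightarrow> (\<exists>c\<in>vecF d. \<exists>r>0. B = cballF d c r)"

definition openF :: "nat \<Rightarrow> (nat \<Rightarrow> 'k::{finite,field} fls) set \<Rightarrow> bool" where
  "openF d U \<longleftrightarrow> U \<subseteq> vecF d \<and> (\<forall>x\<in>U. \<exists>r>0. cballF d x r \<subseteq> U)"

definition closureF :: "nat \<Rightarrow> (nat \<Rightarrow> 'k::{finite,field} fls) set \<Rightarrow> (nat \<Rightarrow> 'k fls) set" where
  "closureF d U = {x \<in> vecF d. \<forall>e>0. \<exists>y\<in>U. vnormF d (\<lambda>i. x i - y i) < e}"

text \<open>Normalized Haar (outer) measure on F^d: the closed unit ball has measure 1, a ball of
  radius q^k has measure q^{kd}; outer measure via countable covers by balls.\<close>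
definition haarF :: "nat \<Rightarrow> (nat \<Rightarrow> 'k::{finite,field} fls) set \<Rightarrow> ennreal" where
  "haarF d S = (INF ck \<in> {(c :: nat \<Rightarrow> nat \<Rightarrow> 'k fls, k :: nat \<Rightarrow> int).
        (\<forall>j. c j \<in> vecF d) \<and> S \<subseteq> (\<Union>j. cballF d (c j) (real CARD('k) powr real_of_int (k j)))}.
      (\<Sum>j. ennreal (real CARD('k) powr (real d * real_of_int (snd ck j)))))"

definition has_sumF :: "('i \<Rightarrow> 'k::{finite,field} fls) \<Rightarrow> 'i set \<Rightarrow> 'k fls \<Rightarrow> bool" where
  "has_sumF g A s \<longleftrightarrow> (\<forall>e>0. \<exists>S0. finite S0 \<and> S0 \<subseteq> A \<and>
      (\<forall>S1. finite S1 \<and> S0 \<subseteq> S1 \<and> S1 \<subseteq> A \<longrightarrow> absF (sum g S1 - s) < e))"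

definition mindices :: "nat \<Rightarrow> (nat \<Rightarrow> nat) set" where
  "mindices d = {\<beta>. \<forall>i\<ge>d. \<beta> i = 0}"

definition analyticF_on :: "nat \<Rightarrow> (nat \<Rightarrow> 'k::{finite,field} fls) set \<Rightarrow> ((nat \<Rightarrow> 'k fls) \<Rightarrow> 'k fls) \<Rightarrow> bool" where
  "analyticF_on d V g \<longleftrightarrow> (\<forall>p\<in>V. \<exists>r>0. \<exists>coef :: (nat \<Rightarrow> nat) \<Rightarrow> 'k fls.
      \<forall>x\<in>cballF d p r. x \<in> V \<and>
        has_sumF (\<lambda>\<beta>. coef \<beta> * (\<Prod>i<d. (x i - p i) ^ \<beta> i)) (mindices d) (g x))"

definition has_partialF :: "(nat \<Rightarrow> 'k::{finite,field} fls) set \<Rightarrow> ((nat \<Rightarrow> 'k fls) \<Rightarrow> 'k fls) \<Rightarrow> nat \<Rightarrow> (nat \<Rightarrow> 'k fls) \<Rightarrow> 'k fls \<Rightarrow> bool" where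
  "has_partialF U g i p L \<longleftrightarrow> (\<forall>e>0. \<exists>\<eta>>0. \<forall>h. h \<noteq> 0 \<and> absF h < \<eta> \<and> p(i := p i + h) \<in> U \<longrightarrow>
      absF ((g (p(i := p i + h)) - g p) / h - L) < e)"

text \<open>All second-order difference quotients (pure and mixed) of g on U have absolute value <= 1.
  This is checked off the diagonals; the bound then passes to the continuous extension.\<close>
definition dq2_bounded :: "nat \<Rightarrow> (nat \<Rightarrow> 'k::{finite,field} fls) set \<Rightarrow> ((nat \<Rightarrow> 'k fls) \<Rightarrow> 'k fls) \<Rightarrow> bool" where
  "dq2_bounded d U g \<longleftrightarrow>
    (\<forall>x\<in>vecF d. \<forall>i<d. \<forall>s1 s2 s3. s1 \<noteq> s2 \<and> s1 \<noteq> s3 \<and> s2 \<noteq> s3 \<and>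
        x(i := s1) \<in> U \<and> x(i := s2) \<in> U \<and> x(i := s3) \<in> U \<longrightarrow>
        absF (((g (x(i := s1)) - g (x(i := s3))) / (s1 - s3)
              - (g (x(i := s2)) - g (x(i := s3))) / (s2 - s3)) / (s1 - s2)) \<le> 1) \<and>
    (\<forall>x\<in>vecF d. \<forall>i<d. \<forall>j<d. \<forall>s1 s2 u1 u2. i \<noteq> j \<and> s1 \<noteq> s2 \<and> u1 \<noteq> u2 \<and>
        x(i := s1, j := u1) \<in> U \<and> x(i := s2, j := u1) \<in> U \<and>
        x(i := s1, j := u2) \<in> U \<and> x(i := s2, j := u2) \<in> U \<longrightarrow>
        absF ((g (x(i := s1, j := u1)) - g (x(i := s2, j := u1))
               - g (x(i := s1, j := u2)) + g (x(i := s2, j := u2))) / ((s1 - s2) * (u1 - u2))) \<le> 1)"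

text \<open>Maps f : U -> F^n are functions (nat => F) => nat => F; component k (0-based) is f x k,
  for k < n.  Coordinates are 0-based, so the paper's f_1 and x_1 are f x 0 and x 0.\<close>

definition condII :: "nat \<Rightarrow> nat \<Rightarrow> (nat \<Rightarrow> 'k::{finite,field} fls) set \<Rightarrow> ((nat \<Rightarrow> 'k fls) \<Rightarrow> nat \<Rightarrow> 'k fls) \<Rightarrow> bool" where
  "condII d n U f \<longleftrightarrow>
    (\<forall>k<n. analyticF_on d U (\<lambda>x. f x k)) \<and>
    (\<exists>V g. openF d V \<and> closureF d U \<subseteq> V \<and> (\<forall>k<n. analyticF_on d V (\<lambda>x. g x k)) \<and>
       (\<forall>x\<in>U. \<forall>k<n. g x k = f x k)) \<and>
    (\<forall>x\<in>U. f x 0 = x 0)"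

definition condIII :: "nat \<Rightarrow> nat \<Rightarrow> (nat \<Rightarrow> 'k::{finite,field} fls) set \<Rightarrow> ((nat \<Rightarrow> 'k fls) \<Rightarrow> nat \<Rightarrow> 'k fls) \<Rightarrow> bool" where
  "condIII d n U f \<longleftrightarrow>
    (\<forall>W. openF d W \<and> W \<noteq> {} \<and> W \<subseteq> U \<longrightarrow>
       (\<forall>c0 (c :: nat \<Rightarrow> 'k fls). (\<forall>x\<in>W. c0 + (\<Sum>k<n. c k * f x k) = 0) \<longrightarrow>
          c0 = 0 \<and> (\<forall>k<n. c k = 0)))"

definition condIV :: "nat \<Rightarrow> nat \<Rightarrow> (nat \<Rightarrow> 'k::{finite,field} fls) set \<Rightarrow> ((nat \<Rightarrow> 'k fls) \<Rightarrow> nat \<Rightarrow> 'k fls) \<Rightarrow> bool" where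
  "condIV d n U f \<longleftrightarrow>
    (\<forall>x\<in>U. \<forall>k<n. absF (f x k) \<le> 1) \<and>
    (\<forall>x\<in>U. \<forall>k<n. \<forall>i<d. \<exists>L. has_partialF U (\<lambda>y. f y k) i x L \<and> absF L \<le> 1) \<and>
    (\<forall>k<n. dq2_bounded d U (\<lambda>y. f y k))"

definition PhiF :: "nat \<Rightarrow> nat \<Rightarrow> (nat \<Rightarrow> 'k::{finite,field} fls) set \<Rightarrow> ((nat \<Rightarrow> 'k fls) \<Rightarrow> nat \<Rightarrow> 'k fls)
    \<Rightarrow> nat \<Rightarrow> real \<Rightarrow> (nat \<Rightarrow> 'k fls) set" where
  "PhiF d n U f t \<delta> = {x \<in> U. \<exists>(a :: nat \<Rightarrow> 'k fls) a0.
      a \<in> vecF n \<and> (\<forall>k<n. a k \<in> LambdaF) \<and> (\<exists>k<n. a k \<noteq> 0) \<and> a0 \<in> LambdaF \<and>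
      absF ((\<Sum>k<n. f x k * a k) + a0) < \<delta> * real CARD('k) powr (- (real n * real t)) \<and>
      vnormF n a = real CARD('k) ^ t}"

definition niceF :: "nat \<Rightarrow> nat \<Rightarrow> (nat \<Rightarrow> 'k::{finite,field} fls) set \<Rightarrow> ((nat \<Rightarrow> 'k fls) \<Rightarrow> nat \<Rightarrow> 'k fls)
    \<Rightarrow> (nat \<Rightarrow> 'k fls) \<Rightarrow> bool" where
  "niceF d n U f x0 \<longleftrightarrow> (\<exists>U0 \<subseteq> U. (\<exists>W. openF d W \<and> x0 \<in> W \<and> W \<subseteq> U0) \<and>
     (\<exists>\<delta> w. 0 < \<delta> \<and> \<delta> < 1 \<and> 0 < w \<and> w < 1 \<and>
        (\<exists>\<rho>>0. \<forall>c r. c \<in> vecF d \<and> 0 < r \<and> r < \<rho> \<and> cballF d c r \<subseteq> U0 \<longrightarrow>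
           limsup (\<lambda>t. haarF d (PhiF d n U f t \<delta> \<inter> cballF d c r))
             \<le> ennreal w * haarF d (cballF d c r))))"

end

theory Submission
  imports Defs "Jordan_Normal_Form.Determinant"
begin

text \<open>
  Condition \<open>PhiF\<close> says that the lattice obtained from \<open>\<Lambda>\<^sup>n\<^sup>+\<^sup>1\<close> by the unipotent matrix of \<open>f x\<close> and
  the diagonal weights \<open>A, \<beta>, \<dots>, \<beta>\<close> with \<open>A * \<beta> ^ n = 1\<close> has a nonzero vector of norm at most
  \<open>\<epsilon> = \<delta> powr (1 / (n + 1))\<close>; putting \<open>\<delta>\<close> into the weights makes a separate treatment of large and
  small gradients unnecessary.  Quantitative nondivergence in the style of Kleinbock and Margulis bounds the
  measure of such \<open>x\<close> by a power of \<open>\<epsilon>\<close>, provided that (i) the covolumes of sublattices, which are maxima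
  of linear combinations of \<open>1, f\<^sub>1, \<dots>, f\<^sub>n\<close>, are good functions, and (ii) none of them is below \<open>1\<close> on all
  of \<open>B\<close>.  For (ii), linear independence on \<open>B\<close> bounds the linear combination below by a constant depending on
  \<open>B\<close>, and the weights contribute a factor of at least \<open>q ^ t\<close>.  For (i), near \<open>x\<^sub>0\<close> all combinations have
  Weierstrass degree at most a common \<open>N\<close>; this persists on smaller balls and gives goodness by divided differences.
  Measures are counts of cells of a ball at a fixed depth, so only finite sums occur.
\<close>

subsection \<open>The absolute value\<close>

text \<open>Cell counts touch \<open>haarF\<close> in two places only: a finite cover bounds it from
  above, and a ball has at least its expected mass, which is a compactness argument. The depth of
  the cells is fixed after \<delta> and \<open>t\<close>, so deep that \<open>f\<close> varies on a
  cell by less than the tolerance in \<open>PhiF\<close>; a cell that meets \<open>PhiF\<close>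
  therefore carries one lattice vector that is short at all its points. This is why smallness of
  covolumes is required throughout a cell and never at single points. Since balls are nested or
  disjoint, the covering argument of nondivergence becomes an induction over the tree of cells.

  The order of the quantifiers shapes the rest: \<open>C\<close> and the exponent may depend on the
  ball around the centre, but not on \<open>B\<close>, \<delta> or \<open>t\<close>. Goodness must
  therefore be uniform over all coefficient vectors and all smaller balls, which is what the common
  degree bound \<open>N\<close> provides. The lower bound for linear combinations does deteriorate
  with \<open>B\<close>, but it only has to beat a factor that grows with \<open>t\<close>, so it
  moves nothing but the threshold for \<open>t\<close>.\<close>

lemma two_le_CARD: "2 \<le> CARD('k::{finite,field})"
proof -
  have "card {0, 1 :: 'k} \<le> CARD('k)" by (rule card_mono) auto
  then show ?thesis by simp
qed

lemma CARD_gt1 [simp]: "1 < real CARD('k::{finite,field})"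
  using two_le_CARD[where 'k='k] by linarith

lemma absF_powi:
  "absF (a :: 'k::{finite,field} fls) = (if a = 0 then 0 else real CARD('k) powi (- fls_subdegree a))"
  unfolding absF_def by (auto simp flip: powr_real_of_int')

lemma absF_0 [simp]: "absF 0 = 0" by (simp add: absF_def)
lemma absF_1 [simp]: "absF 1 = 1" by (simp add: absF_def)
lemma absF_nonneg [simp]: "0 \<le> absF a" by (simp add: absF_def)
lemma absF_eq_0_iff [simp]: "absF a = 0 \<longleftrightarrow> a = 0" by (simp add: absF_def)
lemma absF_pos_iff [simp]: "0 < absF a \<longleftrightarrow> a \<noteq> 0"
  using absF_nonneg[of a] absF_eq_0_iff[of a] by linarith
lemma absF_uminus [simp]: "absF (- a) = absF a" by (simp add: absF_def)
lemma absF_minus_commute: "absF (a - b) = absF (b - a)"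
  using absF_uminus[of "a - b"] by simp

lemma absF_mult: "absF (a * b) = absF a * absF b"
  by (auto simp: absF_powi power_int_diff power_int_minus divide_inverse)

lemma absF_power: "absF (a ^ m) = absF a ^ m"
  by (induction m) (auto simp: absF_mult)

lemma absF_prod: "absF (prod g A) = (\<Prod>i\<in>A. absF (g i))"
  by (induction A rule: infinite_finite_induct) (auto simp: absF_mult)

text \<open>Translates between absolute values and digits; in digits the ultrametric inequality and
  the nesting of balls are immediate.\<close>

lemma absF_le_powi_iff:
  "absF (a :: 'k::{finite,field} fls) \<le> real CARD('k) powi (- k) \<longleftrightarrow> (\<forall>j<k. fls_nth a j = 0)"
proof (cases "a = 0")
  case False
  have "absF a \<le> real CARD('k) powi (- k) \<longleftrightarrow> k \<le> fls_subdegree a"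
    using False power_int_increasing[of k "fls_subdegree a" "real CARD('k)"]
      power_int_strict_increasing[OF _ CARD_gt1[where 'k='k], of "fls_subdegree a" k]
    by (cases "k \<le> fls_subdegree a") (auto simp: absF_powi power_int_minus not_le)
  also have "\<dots> \<longleftrightarrow> (\<forall>j<k. fls_nth a j = 0)"
    using False fls_subdegree_geI by (metis fls_eq0_below_subdegree dual_order.strict_trans1)
  finally show ?thesis .
qed auto

lemma absF_le_1_iff: "absF a \<le> 1 \<longleftrightarrow> (\<forall>j<0. fls_nth a j = 0)"
  using absF_le_powi_iff[of a 0] by simp

lemma absF_cases:
  obtains "a = 0" | k where "absF (a :: 'k::{finite,field} fls) = real CARD('k) powi k"
  by (cases "a = 0") (auto simp: absF_powi)

lemma absF_add_le: "absF (a + b) \<le> max (absF a) (absF (b :: 'k::{finite,field} fls))"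
proof -
  have *: "absF (a + b) \<le> absF b" if le: "absF a \<le> absF b" for a b :: "'k fls"
  proof (cases "b = 0")
    case True
    then show ?thesis using le by (auto simp: antisym)
  next
    case False
    define k where "k = fls_subdegree b"
    have b: "absF b = real CARD('k) powi (- k)" using False by (simp add: absF_powi k_def)
    have "\<forall>j<k. fls_nth a j = 0" "\<forall>j<k. fls_nth b j = 0"
      using le unfolding b absF_le_powi_iff k_def by auto
    then show ?thesis unfolding b absF_le_powi_iff by simp
  qed
  show ?thesis
    using *[of a b] *[of b a] by (cases "absF a \<le> absF b") (auto simp: add.commute max_def)
qed

lemma absF_add_leI: "absF a \<le> c \<Longrightarrow> absF b \<le> c \<Longrightarrow> absF (a + b) \<le> c"
  using absF_add_le[of a b] by linarith
lemma absF_add_lessI: "absF a < c \<Longrightarrow> absF b < c \<Longrightarrow> absF (a + b) < c"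
  using absF_add_le[of a b] by linarith
lemma absF_diff_leI: "absF a \<le> c \<Longrightarrow> absF b \<le> c \<Longrightarrow> absF (a - b) \<le> c"
  using absF_add_leI[of a c "- b"] by simp
lemma absF_diff_lessI: "absF a < c \<Longrightarrow> absF b < c \<Longrightarrow> absF (a - b) < c"
  using absF_add_lessI[of a c "- b"] by simp

lemma absF_add_eq: "absF b < absF a \<Longrightarrow> absF (a + b) = absF a"
proof -
  assume *: "absF b < absF a"
  have "absF (a + b) \<le> absF a" using * by (intro absF_add_leI) auto
  moreover have "\<not> absF (a + b) < absF a"
    using absF_diff_lessI[of "a + b" "absF a" b] * by auto
  ultimately show ?thesis by linarith
qed

lemma absF_sum_le: "(\<And>i. i \<in> A \<Longrightarrow> absF (g i) \<le> c) \<Longrightarrow> 0 \<le> c \<Longrightarrow> absF (sum g A) \<le> c"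
  by (induction A rule: infinite_finite_induct) (auto intro: absF_add_leI)

lemma absF_sum_less: "(\<And>i. i \<in> A \<Longrightarrow> absF (g i) < c) \<Longrightarrow> 0 < c \<Longrightarrow> absF (sum g A) < c"
  by (induction A rule: infinite_finite_induct) (auto intro: absF_add_lessI)

lemma absF_of_nat_le: "absF (of_nat m) \<le> 1"
  by (induction m) (auto intro: absF_add_leI)

lemma absF_shift_one [simp]: "absF (fls_shift k 1 :: 'k::{finite,field} fls) = real CARD('k) powi k"
  using fls_X_intpow_nonzero[of "- k", where 'a='k] fls_subdegree_fls_X_intpow[of "- k", where 'a='k]
  by (simp add: absF_powi)

lemma LambdaF_0 [simp]: "0 \<in> LambdaF" and LambdaF_1 [simp]: "1 \<in> LambdaF"
  by (auto simp: LambdaF_def)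
lemma LambdaF_add: "a \<in> LambdaF \<Longrightarrow> b \<in> LambdaF \<Longrightarrow> a + b \<in> LambdaF"
  by (auto simp: LambdaF_def)
lemma LambdaF_uminus: "a \<in> LambdaF \<Longrightarrow> - a \<in> LambdaF"
  by (auto simp: LambdaF_def)
lemma LambdaF_mult: "a \<in> LambdaF \<Longrightarrow> b \<in> LambdaF \<Longrightarrow> a * b \<in> LambdaF"
  unfolding LambdaF_def mem_Collect_eq
proof (intro allI impI)
  fix i :: int
  assume a: "\<forall>i>0. fls_nth a i = 0" and b: "\<forall>i>0. fls_nth b i = 0" and i: "0 < i"
  show "fls_nth (a * b) i = 0"
    unfolding fls_times_nth(1)
  proof (rule sum.neutral, intro ballI)
    fix j assume "j \<in> {fls_subdegree a + fls_subdegree b..i}"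
    \<comment> \<open>The two indices add up to \<open>i\<close>, so one of them is
      positive.\<close>
    show "fls_nth a (j - fls_subdegree b) * fls_nth b (fls_subdegree b + i - j) = 0"
      using a b i by (cases "0 < j - fls_subdegree b") auto
  qed
qed
lemma LambdaF_sum: "(\<And>i. i \<in> A \<Longrightarrow> g i \<in> LambdaF) \<Longrightarrow> sum g A \<in> LambdaF"
  by (induction A rule: infinite_finite_induct) (auto intro: LambdaF_add)

text \<open>Discreteness of the polynomial ring: the arithmetic input to the lower bounds for
  covolumes.\<close>

lemma LambdaF_absF_ge_1:
  assumes "a \<in> LambdaF" "a \<noteq> 0"
  shows "1 \<le> absF a"
proof -
  have "fls_subdegree a \<le> 0"
    using assms nth_fls_subdegree_nonzero[of a] unfolding LambdaF_def mem_Collect_eq by (meson not_le)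
  then show ?thesis using assms by (simp add: absF_powi)
qed

subsection \<open>Balls, cells and Haar measure\<close>

lemma vnormF_le_iff: "0 \<le> r \<Longrightarrow> vnormF d y \<le> r \<longleftrightarrow> (\<forall>i<d. absF (y i) \<le> r)"
  unfolding vnormF_def by (subst Max_le_iff) auto

text \<open>A ball of radius q^-k, written in digits and indexed by its integer depth
  \<open>k\<close>; only the digits of the centre below \<open>k\<close> matter.\<close>

definition bal :: "nat \<Rightarrow> (nat \<Rightarrow> 'k::{finite,field} fls) \<Rightarrow> int \<Rightarrow> (nat \<Rightarrow> 'k fls) set" where
  "bal d c k = {x \<in> vecF d. \<forall>i<d. \<forall>j<k. fls_nth (x i) j = fls_nth (c i) j}"

lemma cballF_eq_bal:
  "cballF d c (real CARD('k) powi (- k)) = bal d (c :: nat \<Rightarrow> 'k::{finite,field} fls) k"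
  unfolding cballF_def bal_def
  by (subst vnormF_le_iff) (auto simp: absF_le_powi_iff)

lemma bal_iff_absF:
  "x \<in> bal d (c :: nat \<Rightarrow> 'k::{finite,field} fls) k \<longleftrightarrow>
     x \<in> vecF d \<and> (\<forall>i<d. absF (x i - c i) \<le> real CARD('k) powi (- k))"
  by (auto simp: bal_def absF_le_powi_iff)

lemma bal_subset_vecF: "bal d c k \<subseteq> vecF d"
  by (auto simp: bal_def)

lemma center_in_bal [simp]: "c \<in> vecF d \<Longrightarrow> c \<in> bal d c k"
  by (auto simp: bal_def)

lemma bal_eq_if_mem: "c' \<in> bal d c k \<Longrightarrow> bal d c' k = bal d c k"
  by (auto simp: bal_def)

lemma bal_antimono: "k \<le> k' \<Longrightarrow> bal d c k' \<subseteq> bal d c k"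
  by (auto simp: bal_def)

lemma bal_subset_bal: "c' \<in> bal d c k \<Longrightarrow> k \<le> k' \<Longrightarrow> bal d c' k' \<subseteq> bal d c k"
  by (auto simp: bal_def)

section \<open>Division of a ball into cells and counting of cells\<close>

definition digs :: "nat \<Rightarrow> (nat \<Rightarrow> 'k::{finite,field}) set" where
  "digs d = {v. \<forall>i\<ge>d. v i = 0}"

lemma bij_betw_digs:
  "bij_betw (\<lambda>g i. if i < d then g i else 0) (PiE {..<d} (\<lambda>_. UNIV)) (digs d :: (nat \<Rightarrow> 'k::{finite,field}) set)"
proof (rule bij_betw_byWitness[where f' = "\<lambda>v. restrict v {..<d}"])
qed (auto simp: digs_def PiE_def extensional_def restrict_def fun_eq_iff)

lemma finite_digs [simp]: "finite (digs d)"
  using bij_betw_finite[OF bij_betw_digs] by (metis finite_PiE finite_lessThan finite_class.finite_UNIV)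

lemma card_digs: "card (digs d :: (nat \<Rightarrow> 'k::{finite,field}) set) = CARD('k) ^ d"
  using bij_betw_same_card[OF bij_betw_digs[where 'k='k, of d]] by (simp add: card_PiE)

definition child :: "(nat \<Rightarrow> 'k::{finite,field} fls) \<Rightarrow> int \<Rightarrow> (nat \<Rightarrow> 'k) \<Rightarrow> nat \<Rightarrow> 'k fls" where
  "child c k v = (\<lambda>i. c i + fls_const (v i) * fls_X_intpow k)"

lemma nth_child: "fls_nth (child c k v i) j = fls_nth (c i) j + (if j = k then v i else 0)"
  by (simp add: child_def)

lemma child_in_vecF [intro]: "c \<in> vecF d \<Longrightarrow> v \<in> digs d \<Longrightarrow> child c k v \<in> vecF d"
  by (auto simp: child_def vecF_def digs_def)

lemma bal_child_subset: "bal d (child c k v) (k + 1) \<subseteq> bal d c k"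
  by (auto simp: bal_def nth_child)

lemma bal_Union_child: "bal d c k = (\<Union>v\<in>digs d. bal d (child c k v) (k + 1))"
proof (rule antisym)
  show "bal d c k \<subseteq> (\<Union>v\<in>digs d. bal d (child c k v) (k + 1))"
  proof
    fix x assume x: "x \<in> bal d c k"
    define v where "v i = (if i < d then fls_nth (x i) k - fls_nth (c i) k else 0)" for i
    have "v \<in> digs d" by (auto simp: v_def digs_def)
    moreover have "x \<in> bal d (child c k v) (k + 1)"
      using x by (auto simp: bal_def nth_child v_def)
    ultimately show "x \<in> (\<Union>v\<in>digs d. bal d (child c k v) (k + 1))" by blast
  qed
qed (use bal_child_subset in blast)

text \<open>The sum of \<open>F\<close> over the q^(d * L) cells of depth \<open>k + L\<close> in a
  ball, organised along the tree of cells. For an indicator \<open>F\<close> it counts cells, which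
  takes the place of integration.\<close>

primrec sumcells :: "nat \<Rightarrow> nat \<Rightarrow> (nat \<Rightarrow> 'k::{finite,field} fls) \<Rightarrow> int \<Rightarrow>
    ((nat \<Rightarrow> 'k fls) set \<Rightarrow> real) \<Rightarrow> real" where
  "sumcells d 0 c k F = F (bal d c k)"
| "sumcells d (Suc L) c k F = (\<Sum>v\<in>digs d. sumcells d L (child c k v) (k + 1) F)"

lemma sumcells_mono:
  assumes "c \<in> vecF d"
    and "\<And>c'. c' \<in> bal d c k \<Longrightarrow> F (bal d c' (k + int L)) \<le> G (bal d c' (k + int L))"
  shows "sumcells d L c k F \<le> sumcells d L c k G"
  using assms
proof (induction L arbitrary: c k)
  case 0
  then show ?case using 0(2)[of c] by simp
next
  case (Suc L)
  show ?case unfolding sumcells.simps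
  proof (intro sum_mono Suc.IH)
    fix v c' assume v: "v \<in> digs d" and c': "c' \<in> bal d (child c k v) (k + 1)"
    have "c' \<in> bal d c k" using c' bal_child_subset by blast
    from Suc.prems(2)[OF this]
    show "F (bal d c' (k + 1 + int L)) \<le> G (bal d c' (k + 1 + int L))"
      by (simp add: algebra_simps)
  qed (use Suc.prems in auto)
qed

lemma sumcells_const: "sumcells d L (c :: nat \<Rightarrow> 'k::{finite,field} fls) k (\<lambda>_. z) = real CARD('k) ^ (d * L) * z"
  by (induction L arbitrary: c k) (auto simp: card_digs power_add power_mult)

lemma sumcells_sum: "sumcells d L c k (\<lambda>Q. \<Sum>s\<in>S. F s Q) = (\<Sum>s\<in>S. sumcells d L c k (F s))"
proof (induction L arbitrary: c k)
  case (Suc L)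
  then show ?case by (simp add: sum.swap[of _ S])
qed auto

lemma sumcells_add: "sumcells d L c k (\<lambda>Q. F Q + G Q) = sumcells d L c k F + sumcells d L c k G"
  by (induction L arbitrary: c k) (auto simp: sum.distrib)

lemma sumcells_nonneg: "(\<And>Q. 0 \<le> F Q) \<Longrightarrow> 0 \<le> sumcells d L c k F"
  by (induction L arbitrary: c k) (auto intro: sum_nonneg)

lemma sumcells_child_le:
  assumes "\<And>Q. 0 \<le> F Q" "v \<in> digs d"
  shows "sumcells d L (child c k v) (k + 1) F \<le> sumcells d (Suc L) c k F"
  unfolding sumcells.simps
  by (rule member_le_sum) (auto intro!: assms sumcells_nonneg)

text \<open>Another centre of the same ball only permutes the children at each level;
  \<open>t\<close> matches the labels of children with equal digit \<open>k\<close>.\<close>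

lemma sumcells_cong_center:
  assumes "\<forall>i<d. \<forall>j<k. fls_nth (c i) j = fls_nth (c' i) j"
  shows "sumcells d L c k F = sumcells d L c' k F"
  using assms
proof (induction L arbitrary: c c' k)
  case 0
  then show ?case by (auto simp: bal_def intro!: arg_cong[where f = F])
next
  case (Suc L)
  define t where "t = (\<lambda>v i. if i < d then v i + fls_nth (c i) k - fls_nth (c' i) k else 0)"
  define t' where "t' = (\<lambda>v i. if i < d then v i - fls_nth (c i) k + fls_nth (c' i) k else 0)"
  have bij: "bij_betw t (digs d) (digs d)"
    by (rule bij_betw_byWitness[where f' = t']) (auto simp: t_def t'_def digs_def fun_eq_iff)
  have "(\<Sum>v\<in>digs d. sumcells d L (child c k v) (k + 1) F) =
        (\<Sum>v\<in>digs d. sumcells d L (child c' k (t v)) (k + 1) F)"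
    by (intro sum.cong refl Suc.IH) (use Suc.prems in \<open>auto simp: nth_child t_def\<close>)
  also have "\<dots> = (\<Sum>v\<in>digs d. sumcells d L (child c' k v) (k + 1) F)"
    by (rule sum.reindex_bij_betw[OF bij])
  finally show ?case by simp
qed

lemma bal_shift:
  assumes "y \<in> vecF d"
  shows "bal d (\<lambda>i. c i + y i) k = (\<lambda>x i. x i + y i) ` bal d c k"
proof (intro antisym subsetI)
  fix x assume "x \<in> bal d (\<lambda>i. c i + y i) k"
  then have "(\<lambda>i. x i - y i) \<in> bal d c k"
    using assms by (auto simp: bal_def vecF_def)
  then show "x \<in> (\<lambda>x i. x i + y i) ` bal d c k"
    by (rule rev_image_eqI) auto
qed (use assms in \<open>auto simp: bal_def vecF_def\<close>)

lemma sumcells_shift: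
  assumes "y \<in> vecF d"
  shows "sumcells d L (\<lambda>i. c i + y i) k F = sumcells d L c k (\<lambda>Q. F ((\<lambda>x i. x i + y i) ` Q))"
proof (induction L arbitrary: c k)
  case (Suc L)
  have "child (\<lambda>i. c i + y i) k v = (\<lambda>i. child c k v i + y i)" for v
    by (auto simp: child_def)
  then show ?case using Suc by simp
qed (use bal_shift[OF assms] in auto)

text \<open>A translation by a vector of norm at most q^-k maps a ball of depth \<open>k\<close> to
  itself and permutes its cells: the finite form of invariance of Haar measure.\<close>

lemma sumcells_translate:
  assumes "y \<in> vecF d" "\<forall>i<d. \<forall>j<k. fls_nth (y i) j = 0"
  shows "sumcells d L c k (\<lambda>Q. F ((\<lambda>x i. x i + y i) ` Q)) = sumcells d L c k F"
  unfolding sumcells_shift[OF assms(1), symmetric]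
  by (rule sumcells_cong_center) (use assms in auto)

text \<open>Double counting in place of Fubini. All translates of the count have the same value, and
  for a fixed cell its centre \<open>u\<close> is a sample point: a translated cell that satisfies
  \<open>P\<close> throughout satisfies it at the translate of \<open>u\<close>.\<close>

lemma sumcells_average:
  fixes c :: "nat \<Rightarrow> 'k::{finite,field} fls"
  assumes "finite S" and c: "c \<in> vecF d"
    and y: "\<And>s. s \<in> S \<Longrightarrow> y s \<in> vecF d" "\<And>s. s \<in> S \<Longrightarrow> \<forall>i<d. \<forall>j<k. fls_nth (y s i) j = 0"
    and bd: "\<And>u. u \<in> bal d c k \<Longrightarrow> real (card {s \<in> S. P (\<lambda>i. u i + y s i)}) \<le> M"
  shows "real (card S) * sumcells d L c k (\<lambda>Q. of_bool (\<forall>x\<in>Q. P x)) \<le> M * real CARD('k) ^ (d * L)"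
proof -
  let ?F = "\<lambda>Q. of_bool (\<forall>x\<in>Q. P x) :: real"
  have "real (card S) * sumcells d L c k ?F = (\<Sum>s\<in>S. sumcells d L c k (\<lambda>Q. ?F ((\<lambda>x i. x i + y s i) ` Q)))"
    using y by (simp add: sumcells_translate[where F = ?F] del: ball_simps image_iff)
  also have "\<dots> = sumcells d L c k (\<lambda>Q. \<Sum>s\<in>S. ?F ((\<lambda>x i. x i + y s i) ` Q))"
    by (rule sumcells_sum[symmetric])
  also have "\<dots> \<le> sumcells d L c k (\<lambda>_. M)"
  proof (rule sumcells_mono[OF c])
    fix u assume u: "u \<in> bal d c k"
    then have uv: "u \<in> bal d u (k + int L)" by (auto simp: bal_def)
    have "(\<Sum>s\<in>S. ?F ((\<lambda>x i. x i + y s i) ` bal d u (k + int L))) \<le> (\<Sum>s\<in>S. of_bool (P (\<lambda>i. u i + y s i)))"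
      by (intro sum_mono) (use uv in auto)
    also have "\<dots> = real (card {s \<in> S. P (\<lambda>i. u i + y s i)})"
      using \<open>finite S\<close> by (simp add: of_bool_def sum.If_cases Int_def)
    also have "\<dots> \<le> M" by (rule bd[OF u])
    finally show "(\<Sum>s\<in>S. ?F ((\<lambda>x i. x i + y s i) ` bal d u (k + int L))) \<le> M" .
  qed
  finally show ?thesis by (simp add: sumcells_const mult.commute)
qed

text \<open>The centres form a list so that the lengths add up along the recursion without any
  argument about distinct centres.\<close>

lemma cells_cover_list:
  assumes "S \<subseteq> bal d c k" "c \<in> vecF d"
  shows "\<exists>cs. set cs \<subseteq> vecF d \<and> real (length cs) = sumcells d L c k (\<lambda>Q. of_bool (S \<inter> Q \<noteq> {}))
      \<and> S \<subseteq> (\<Union>c'\<in>set cs. bal d c' (k + int L))"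
  using assms
proof (induction L arbitrary: S c k)
  case 0
  show ?case
  proof (cases "S = {}")
    case True
    then show ?thesis by (intro exI[of _ "[]"]) auto
  next
    case False
    then show ?thesis using 0 by (intro exI[of _ "[c]"]) auto
  qed
next
  case (Suc L)
  have "\<exists>cs. set cs \<subseteq> vecF d \<and>
      real (length cs) = sumcells d L (child c k v) (k + 1) (\<lambda>Q. of_bool (S \<inter> Q \<noteq> {})) \<and>
      S \<inter> bal d (child c k v) (k + 1) \<subseteq> (\<Union>c'\<in>set cs. bal d c' (k + 1 + int L))"
    if v: "v \<in> digs d" for v
  proof -
    let ?S = "S \<inter> bal d (child c k v) (k + 1)"
    have ch: "child c k v \<in> vecF d" using v Suc.prems by auto
    obtain cs where cs: "set cs \<subseteq> vecF d"
      "real (length cs) = sumcells d L (child c k v) (k + 1) (\<lambda>Q. of_bool (?S \<inter> Q \<noteq> {}))"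
      "?S \<subseteq> (\<Union>c'\<in>set cs. bal d c' (k + 1 + int L))"
      using Suc.IH[OF _ ch, of ?S] by blast
    have eq: "of_bool (?S \<inter> bal d c' (k + 1 + int L) \<noteq> {}) = (of_bool (S \<inter> bal d c' (k + 1 + int L) \<noteq> {}) :: real)"
      if "c' \<in> bal d (child c k v) (k + 1)" for c'
      using bal_subset_bal[OF that, of "k + 1 + int L"] by (auto simp: of_bool_def)
    have "sumcells d L (child c k v) (k + 1) (\<lambda>Q. of_bool (?S \<inter> Q \<noteq> {})) =
        sumcells d L (child c k v) (k + 1) (\<lambda>Q. of_bool (S \<inter> Q \<noteq> {}))"
      by (intro antisym sumcells_mono[OF ch]; subst eq) auto
    then show ?thesis using cs by metis
  qed
  then obtain cs where cs: "\<And>v. v \<in> digs d \<Longrightarrow> set (cs v) \<subseteq> vecF d"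
      "\<And>v. v \<in> digs d \<Longrightarrow> real (length (cs v)) = sumcells d L (child c k v) (k + 1) (\<lambda>Q. of_bool (S \<inter> Q \<noteq> {}))"
      "\<And>v. v \<in> digs d \<Longrightarrow> S \<inter> bal d (child c k v) (k + 1) \<subseteq> (\<Union>c'\<in>set (cs v). bal d c' (k + 1 + int L))"
    by metis
  obtain vs where vs: "set vs = (digs d :: (nat \<Rightarrow> 'a) set)" "distinct vs"
    using finite_distinct_list[OF finite_digs] by blast
  let ?cs = "concat (map cs vs)"
  have len: "real (length ?cs) = (\<Sum>v\<in>digs d. real (length (cs v)))"
    using vs by (simp add: length_concat sum_list_distinct_conv_sum_set comp_def flip: of_nat_sum)
  show ?case
  proof (intro exI[of _ ?cs] conjI)
    show "set ?cs \<subseteq> vecF d" using cs(1) vs by auto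
    show "real (length ?cs) = sumcells d (Suc L) c k (\<lambda>Q. of_bool (S \<inter> Q \<noteq> {}))"
      unfolding len sumcells.simps by (intro sum.cong refl cs(2))
    show "S \<subseteq> (\<Union>c'\<in>set ?cs. bal d c' (k + int (Suc L)))"
    proof
      fix x assume x: "x \<in> S"
      then obtain v where v: "v \<in> digs d" "x \<in> bal d (child c k v) (k + 1)"
        using Suc.prems(1) bal_Union_child by blast
      then obtain c' where "c' \<in> set (cs v)" "x \<in> bal d c' (k + 1 + int L)"
        using cs(3)[OF v(1)] x by blast
      then show "x \<in> (\<Union>c'\<in>set ?cs. bal d c' (k + int (Suc L)))"
        using v(1) vs by (auto simp: algebra_simps)
    qed
  qed
qed

section \<open>Haar measure of finite covers and of balls\<close>

lemma powr_int_mult_nat: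
  "real CARD('k::{finite,field}) powr (real d * real_of_int k) = real CARD('k) powi (int d * k)"
  by (simp flip: powr_real_of_int')

text \<open>Covers in \<open>haarF\<close> are infinite sequences of balls of positive volume. The
  list is therefore padded with balls around 0 whose volumes \<open>r ^ (p + j)\<close> form a
  geometric series of total less than \<open>e\<close>.\<close>

lemma haarF_le_list:
  fixes cs :: "(nat \<Rightarrow> 'k::{finite,field} fls) list"
  assumes d: "0 < d" and cs: "set cs \<subseteq> vecF d" and S: "S \<subseteq> (\<Union>c\<in>set cs. bal d c K)"
  shows "haarF d S \<le> ennreal (real (length cs) * real CARD('k) powi (- (int d * K)))"
proof (rule ennreal_le_epsilon)
  fix e :: real assume e: "0 < e"
  let ?q = "real CARD('k)"
  define r where "r = 1 / ?q ^ d"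
  have "1 < ?q ^ d" using d by (intro one_less_power CARD_gt1)
  then have r: "0 < r" "r < 1" by (simp_all only: r_def) (auto simp: field_simps)
  obtain p where p: "r ^ p < e * (1 - r)"
    using real_arch_pow_inv[of "e * (1 - r)" r] e r by auto
  define c where "c j = (if j < length cs then cs ! j else (\<lambda>_. 0))" for j
  define kk where "kk j = (if j < length cs then - K else - int (p + j))" for j
  define a where "a = ?q powi (- (int d * K))"
  have a0: "0 \<le> a" by (simp add: a_def)
  have vol: "?q powr (real d * real_of_int (kk j)) = (if j < length cs then a else r ^ (p + j))" for j
  proof (cases "j < length cs")
    case False
    have "?q powr (real d * real_of_int (kk j)) = ?q powi (- int (d * (p + j)))"
      using False unfolding powr_int_mult_nat by (simp add: kk_def algebra_simps)
    also have "\<dots> = inverse (?q ^ (d * (p + j)))"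
      unfolding power_int_minus power_int_of_nat ..
    also have "\<dots> = r ^ (p + j)"
      by (simp add: r_def power_one_over power_mult divide_inverse power_inverse)
    finally show ?thesis using False by simp
  qed (use powr_int_mult_nat[where 'k='k, of d "- K"] in \<open>simp add: kk_def a_def\<close>)
  have "haarF d S \<le> (\<Sum>j. ennreal (?q powr (real d * real_of_int (snd (c, kk) j))))"
    unfolding haarF_def
  proof (rule INF_lower, clarsimp, intro conjI allI subsetI)
    show "c j \<in> vecF d" for j using cs by (auto simp: c_def vecF_def dest!: nth_mem)
    fix x assume "x \<in> S"
    then obtain c' where "c' \<in> set cs" "x \<in> bal d c' K" using S by blast
    then obtain j where j: "j < length cs" "x \<in> bal d (c j) K"
      by (auto simp: in_set_conv_nth c_def)
    then have "x \<in> cballF d (c j) (?q powr real_of_int (kk j))"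
      using powr_real_of_int'[of ?q "- K"] by (simp add: kk_def cballF_eq_bal)
    then show "x \<in> (\<Union>j. cballF d (c j) (?q powr real_of_int (kk j)))" by blast
  qed
  also have "\<dots> \<le> (\<Sum>j. ennreal ((if j \<in> {..<length cs} then a else 0) + r ^ p * r ^ j))"
    using r a0 by (intro suminf_le summableI ennreal_leI) (auto simp: vol power_add)
  also have "\<dots> = ennreal (real (length cs) * a + r ^ p * (1 / (1 - r)))"
  proof (rule suminf_ennreal_eq)
    have "(\<lambda>j. if j \<in> {..<length cs} then a else 0) sums (\<Sum>j\<in>{..<length cs}. a)"
      by (rule sums_If_finite_set) auto
    moreover have "(\<lambda>j. r ^ p * r ^ j) sums (r ^ p * (1 / (1 - r)))"
      using r by (intro sums_mult geometric_sums) auto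
    ultimately show "(\<lambda>j. (if j \<in> {..<length cs} then a else 0) + r ^ p * r ^ j) sums
       (real (length cs) * a + r ^ p * (1 / (1 - r)))"
      by (auto dest: sums_add)
  qed (use r a0 in auto)
  also have "\<dots> \<le> ennreal (real (length cs) * a + e)"
    using p r by (intro ennreal_leI) (auto simp: field_simps)
  also have "\<dots> = ennreal (real (length cs) * a) + ennreal e"
    using e a0 by (simp add: ennreal_plus)
  finally show "haarF d S \<le> ennreal (real (length cs) * ?q powi (- (int d * K))) + ennreal e"
    by (simp add: a_def)
qed

text \<open>The limit point of nested balls \<open>a 0, a 1, \<dots>\<close>, read off digit by digit.\<close>

lemma nested_balls_meet:
  fixes a :: "nat \<Rightarrow> nat \<Rightarrow> 'k::{finite,field} fls"
  assumes a: "\<And>i. a i \<in> vecF d" and nest: "\<And>i. a (Suc i) \<in> bal d (a i) (k + int i)"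
  obtains x where "\<And>i. x \<in> bal d (a i) (k + int i)"
proof -
  have agree: "fls_nth (a (i + p) l) j = fls_nth (a i l) j" if "l < d" "j < k + int i" for i p l j
    using that
  proof (induction p)
    case (Suc p)
    then show ?case using nest[of "i + p"] by (auto simp: bal_def)
  qed auto
  \<comment> \<open>Ball \<open>i\<close> fixes the digits below \<open>k + i\<close>, so digit
    \<open>j\<close> can be read off from ball \<open>nat (j - k) + 1\<close>.\<close>
  define x where "x l = (if l < d then Abs_fls (\<lambda>j. fls_nth (a (nat (j - k) + 1) l) j) else 0)" for l
  have nx: "fls_nth (x l) j = fls_nth (a (nat (j - k) + 1) l) j" if l: "l < d" for l j
  proof -
    have "\<forall>j<min k (fls_subdegree (a 0 l)). fls_nth (a (nat (j - k) + 1) l) j = 0"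
      using agree[OF l, of _ 0] by auto
    then have "fls_nth (Abs_fls (\<lambda>j. fls_nth (a (nat (j - k) + 1) l) j)) j = fls_nth (a (nat (j - k) + 1) l) j"
      by (intro nth_Abs_fls_lower_bound[of "min k (fls_subdegree (a 0 l))"]) auto
    then show ?thesis using l by (simp add: x_def)
  qed
  have "x \<in> bal d (a i) (k + int i)" for i
  proof -
    have "fls_nth (x l) j = fls_nth (a i l) j" if l: "l < d" and j: "j < k + int i" for l j
    proof -
      define m where "m = nat (j - k) + 1"
      have jm: "j < k + int m" by (simp add: m_def)
      have "fls_nth (a m l) j = fls_nth (a i l) j"
        using agree[OF l j, of "m - i"] agree[OF l jm, of "i - m"] by (cases "i \<le> m") auto
      then show ?thesis using nx[OF l] by (simp add: m_def)
    qed
    then show ?thesis by (auto simp: bal_def vecF_def x_def)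
  qed
  then show ?thesis by (rule that)
qed

text \<open>Compactness by subdivision. If a cover had total volume below that of the ball, then
  some child would be covered with total volume below its own, and so on down the tree. The limit of
  these nested cells lies in some covering ball, which contains a whole cell once the depth is large
  enough: a contradiction.\<close>

lemma haarF_bal_ge:
  fixes c :: "nat \<Rightarrow> 'k::{finite,field} fls"
  assumes d: "0 < d" and c: "c \<in> vecF d"
  shows "ennreal (real CARD('k) powi (- (int d * k))) \<le> haarF d (bal d c k)"
  unfolding haarF_def
proof (rule INF_greatest, clarsimp)
  fix cc :: "nat \<Rightarrow> nat \<Rightarrow> 'k fls" and kk :: "nat \<Rightarrow> int"
  assume cc: "\<forall>j. cc j \<in> vecF d"
    and cov: "bal d c k \<subseteq> (\<Union>j. cballF d (cc j) (real CARD('k) powr real_of_int (kk j)))"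
  let ?q = "real CARD('k)"
  define K where "K j = - kk j" for j
  have ball: "cballF d (cc j) (?q powr real_of_int (kk j)) = bal d (cc j) (K j)" for j
    using cballF_eq_bal[of d "cc j" "K j"] by (simp add: K_def powr_real_of_int')
  define vol where "vol l = ?q powi (- (int d * l))" for l :: int
  have vol0: "0 < vol l" for l by (simp add: vol_def)
  have vol_mono: "vol l' \<le> vol l" if "l \<le> l'" for l l'
    unfolding vol_def using that by (intro power_int_increasing) (auto intro: mult_left_mono)
  have vol_step: "?q ^ d * vol (l + 1) = vol l" for l
  proof -
    have "?q ^ d * vol (l + 1) = ?q powi (int d + - (int d * (l + 1)))"
      unfolding vol_def by (subst power_int_add) auto
    then show ?thesis by (simp add: vol_def algebra_simps)
  qed
  have volK: "?q powr (real d * real_of_int (kk j)) = vol (K j)" for j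
    by (simp add: powr_int_mult_nat vol_def K_def)
  show "ennreal (?q powi (- (int d * k))) \<le> (\<Sum>j. ennreal (?q powr (real d * real_of_int (kk j))))"
  proof (rule ccontr)
    assume "\<not> ?thesis"
    then have less: "(\<Sum>j. ennreal (vol (K j))) < ennreal (vol k)"
      by (simp add: volK vol_def not_le)
    have sm: "summable (\<lambda>j. vol (K j))"
      using less vol0 by (intro summable_suminf_not_top) (auto intro: less_imp_le)
    have suml: "(\<Sum>j. vol (K j)) < vol k"
      using less sm vol0 by (simp add: suminf_ennreal2 less_imp_le ennreal_less_iff suminf_nonneg)
    \<comment> \<open>The volume of the intersection of the covering ball \<open>j\<close> with the
      cell: balls that meet are nested, so it is the smaller of the two volumes.\<close>
    define T where "T a l j = of_bool (bal d (cc j) (K j) \<inter> bal d a l \<noteq> {}) * min (vol (K j)) (vol l)"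
      for a l j
    have T0: "0 \<le> T a l j" for a l j using vol0 by (auto simp: T_def less_imp_le)
    have Tle: "T a l j \<le> vol (K j)" for a l j using vol0[of "K j"] by (auto simp: T_def)
    have smT: "summable (T a l)" for a l
      by (rule summable_comparison_test'[OF sm, of 0]) (use T0 Tle in auto)
    \<comment> \<open>Additivity of the intersection volume over the children, of which one
      inequality is enough.\<close>
    have Tsplit: "(\<Sum>v\<in>digs d. T (child a l v) (l + 1) j) \<le> T a l j" for a l j
    proof (cases "bal d (cc j) (K j) \<inter> bal d a l = {}")
      case True
      then have "T (child a l v) (l + 1) j = 0" for v
        using bal_child_subset[of d a l v] by (auto simp: T_def)
      then show ?thesis using T0 by simp
    next
      case meet: False
      show ?thesis
      proof (cases "K j \<le> l")
        case True
        have "(\<Sum>v\<in>(digs d :: (nat \<Rightarrow> 'k) set). T (child a l v) (l + 1) j) \<le>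
            (\<Sum>v\<in>(digs d :: (nat \<Rightarrow> 'k) set). vol (l + 1))"
          by (intro sum_mono) (auto simp: T_def vol0 less_imp_le)
        also have "\<dots> = vol l" by (simp add: card_digs vol_step)
        also have "\<dots> = T a l j" using meet vol_mono[OF True] by (simp add: T_def)
        finally show ?thesis .
      next
        case False
        \<comment> \<open>The covering ball is deeper than the cell, so it can meet only one child,
          the one that has the digits of its centre.\<close>
        define v where "v i = (if i < d then fls_nth (cc j i) l - fls_nth (a i) l else 0)" for i
        have "T (child a l v') (l + 1) j = 0" if v': "v' \<in> digs d" "v' \<noteq> v" for v'
        proof -
          obtain i where i: "v' i \<noteq> v i" using v' by blast
          then have "i < d" using v' by (auto simp: digs_def v_def)
          then have "bal d (cc j) (K j) \<inter> bal d (child a l v') (l + 1) = {}"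
            using i False by (auto simp: bal_def nth_child v_def)
          then show ?thesis by (simp add: T_def)
        qed
        then have "(\<Sum>v'\<in>digs d. T (child a l v') (l + 1) j) \<le> (\<Sum>v'\<in>digs d. if v' = v then vol (K j) else 0)"
          using Tle by (intro sum_mono) auto
        also have "\<dots> \<le> vol (K j)" using vol0[of "K j"] by (simp add: less_imp_le)
        also have "\<dots> = T a l j" using meet False vol_mono[of l "K j"] by (simp add: T_def)
        finally show ?thesis .
      qed
    qed
    define Q where "Q i a \<longleftrightarrow> a \<in> vecF d \<and> suminf (T a (k + int i)) < vol (k + int i)" for i a
    have step: "\<exists>b. Q (Suc i) b \<and> b \<in> bal d a (k + int i)" if Qa: "Q i a" for i a
    proof (rule ccontr)
      assume no: "\<not> ?thesis"
      let ?l = "k + int i"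
      have "vol (?l + 1) \<le> suminf (T (child a ?l v) (?l + 1))" if v: "v \<in> digs d" for v
      proof -
        have ch: "child a ?l v \<in> vecF d" using Qa v by (auto simp: Q_def)
        have "child a ?l v \<in> bal d a ?l"
          using center_in_bal[OF ch] bal_child_subset by blast
        then have "\<not> Q (Suc i) (child a ?l v)" using no by blast
        then show ?thesis using ch by (simp add: Q_def algebra_simps)
      qed
      then have "(\<Sum>v\<in>(digs d :: (nat \<Rightarrow> 'k) set). vol (?l + 1)) \<le> (\<Sum>v\<in>digs d. suminf (T (child a ?l v) (?l + 1)))"
        by (rule sum_mono)
      also have "\<dots> = (\<Sum>j. \<Sum>v\<in>digs d. T (child a ?l v) (?l + 1) j)"
        by (rule suminf_sum[symmetric]) (rule smT)
      also have "\<dots> \<le> suminf (T a ?l)"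
        by (intro suminf_le Tsplit smT summable_sum)
      finally show False using Qa by (simp add: card_digs vol_step Q_def)
    qed
    have Q0: "Q 0 c"
      using suminf_le[OF Tle smT sm, of c k] suml c by (simp add: Q_def)
    obtain a where a: "\<And>i. Q i (a i)" "\<And>i. a (Suc i) \<in> bal d (a i) (k + int i)" "a 0 = c"
      using dependent_nat_choice[of "\<lambda>i x. Q i x \<and> (i = 0 \<longrightarrow> x = c)" "\<lambda>i x y. y \<in> bal d x (k + int i)"]
        Q0 step by (metis nat.distinct(1))
    obtain x where x: "\<And>i. x \<in> bal d (a i) (k + int i)"
      using nested_balls_meet[of a d k] a by (auto simp: Q_def)
    have "x \<in> bal d c k" using x[of 0] a by simp
    then obtain j where j: "x \<in> bal d (cc j) (K j)" using cov ball by blast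
    \<comment> \<open>At this depth the cell around \<open>x\<close> is no larger than the covering
      ball \<open>j\<close>, hence lies inside it.\<close>
    define i where "i = nat (K j - k)"
    have "T (a i) (k + int i) j = vol (k + int i)"
      using j x[of i] vol_mono[of "K j" "k + int i"] by (auto simp: T_def i_def)
    then have "vol (k + int i) \<le> suminf (T (a i) (k + int i))"
      using sum_le_suminf[OF smT, of "{j}" "a i" "k + int i"] T0 by simp
    then show False using a(1)[of i] by (simp add: Q_def)
  qed
qed

subsection \<open>Good polynomials\<close>

lemma ex_maximizer:
  fixes g :: "'a \<Rightarrow> 'b::linorder"
  assumes "finite A" "A \<noteq> {}"
  obtains a where "a \<in> A" "\<And>b. b \<in> A \<Longrightarrow> g b \<le> g a"
proof -
  have "Max (g ` A) \<in> g ` A" using assms by (intro Max_in) auto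
  then obtain a where "a \<in> A" "g a = Max (g ` A)" by (metis imageE)
  then show ?thesis using assms by (intro that[of a]) auto
qed

text \<open>The \<open>M\<close>-th divided difference has absolute value \<open>G\<close>; it is formed by iterated synthetic division.\<close>

lemma dominant_coeff_bound:
  fixes h :: "'k::{finite,field} fls poly"
  assumes "absF (coeff h M) = G" "\<And>m. M < m \<Longrightarrow> absF (coeff h m) < G" "0 < G"
    and "\<And>i. i \<le> M \<Longrightarrow> absF (s i) \<le> 1" "\<And>i. i \<le> M \<Longrightarrow> absF (poly h (s i)) \<le> \<epsilon>"
    and "\<And>i j. i < j \<Longrightarrow> j \<le> M \<Longrightarrow> r \<le> absF (s i - s j)" "0 < r"
  shows "G * r ^ M \<le> \<epsilon>"
  using assms
proof (induction M arbitrary: h s \<epsilon>)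
  case 0
  have "poly h (s 0) - coeff h 0 = (\<Sum>m\<in>{0<..degree h}. coeff h m * s 0 ^ m)"
    unfolding poly_altdef by (subst (1) sum.remove[of _ 0]) (auto intro: sum.cong)
  moreover have "absF (\<Sum>m\<in>{0<..degree h}. coeff h m * s 0 ^ m) < G"
  proof (rule absF_sum_less)
    fix m assume "m \<in> {0<..degree h}"
    then have "absF (coeff h m * s 0 ^ m) \<le> absF (coeff h m)"
      using 0 by (auto simp: absF_mult absF_power intro!: mult_left_le power_le_one)
    then show "absF (coeff h m * s 0 ^ m) < G" using 0(2)[of m] \<open>m \<in> _\<close> by simp
  qed (use 0 in simp)
  ultimately have "absF (poly h (s 0) - coeff h 0) < absF (coeff h 0)"
    using 0(1) by simp
  then have "absF (coeff h 0 + (poly h (s 0) - coeff h 0)) = G"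
    using absF_add_eq[of "poly h (s 0) - coeff h 0" "coeff h 0"] 0(1) by simp
  then have "absF (poly h (s 0)) = G" by simp
  then show ?case using 0 by auto
next
  case (Suc M)
  define h1 where "h1 = synthetic_div h (s 0)"
  have h: "[:- s 0, 1:] * h1 + [:poly h (s 0):] = h"
    unfolding h1_def by (rule synthetic_div_correct')
  have rec: "coeff h1 m = coeff h (Suc m) + s 0 * coeff h1 (Suc m)" for m
    using arg_cong[OF h, of "\<lambda>p. coeff p (Suc m)"] by (simp add: algebra_simps)
  have s0: "absF (s 0 * a) \<le> absF a" for a
    using Suc.prems(4)[of 0] by (simp add: absF_mult mult_left_le_one_le)
  have small: "absF (coeff h1 m) < G" if "M < m" for m
  proof -
    \<comment> \<open>Downward induction, started beyond the degree of \<open>h1\<close>.\<close>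
    have "m \<le> max m (Suc (degree h1))" by simp
    then show ?thesis
    proof (induction rule: inc_induct)
      case base
      then show ?case using \<open>0 < G\<close> by (simp add: coeff_eq_0 max_def)
    next
      case (step l)
      then show ?case unfolding rec[of l] using that s0[of "coeff h1 (Suc l)"]
        by (intro absF_add_lessI Suc.prems(2)) auto
    qed
  qed
  have top: "absF (coeff h1 M) = G"
    unfolding rec[of M] using Suc.prems(1) small[of "Suc M"] s0[of "coeff h1 (Suc M)"]
    by (subst absF_add_eq) auto
  have val: "absF (poly h1 (s (Suc i))) \<le> \<epsilon> / r" if i: "i \<le> M" for i
  proof -
    have "poly h (s (Suc i)) = (s (Suc i) - s 0) * poly h1 (s (Suc i)) + poly h (s 0)"
      by (subst h[symmetric]) (simp add: algebra_simps)
    then have "absF (s (Suc i) - s 0) * absF (poly h1 (s (Suc i))) = absF (poly h (s (Suc i)) - poly h (s 0))"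
      by (simp flip: absF_mult)
    also have "\<dots> \<le> \<epsilon>"
      using Suc.prems(5)[of 0] Suc.prems(5)[of "Suc i"] i by (intro absF_diff_leI) auto
    finally have "absF (s (Suc i) - s 0) * absF (poly h1 (s (Suc i))) \<le> \<epsilon>" .
    moreover have "r \<le> absF (s (Suc i) - s 0)"
      using Suc.prems(6)[of 0 "Suc i"] i by (simp add: absF_minus_commute)
    ultimately have "r * absF (poly h1 (s (Suc i))) \<le> \<epsilon>"
      by (meson absF_nonneg mult_right_mono order_trans)
    then show ?thesis using \<open>0 < r\<close> by (simp add: field_simps)
  qed
  have "G * r ^ M \<le> \<epsilon> / r"
    by (rule Suc.IH[OF top small \<open>0 < G\<close>, of "\<lambda>i. s (Suc i)"]) (use Suc.prems val in auto)
  then show ?case using \<open>0 < r\<close> by (simp add: field_simps)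
qed

text \<open>With \<open>M + 1\<close> such points the divided difference would give
  \<open>G * r ^ M \<le> \<epsilon>\<close>.\<close>

lemma card_small_values_le:
  fixes h :: "'k::{finite,field} fls poly"
  assumes "absF (coeff h M) = G" "\<And>m. M < m \<Longrightarrow> absF (coeff h m) < G" "0 < G"
    and R: "finite R" "\<And>s. s \<in> R \<Longrightarrow> absF s \<le> 1"
      "\<And>s s'. s \<in> R \<Longrightarrow> s' \<in> R \<Longrightarrow> s \<noteq> s' \<Longrightarrow> r \<le> absF (s - s')"
    and "0 < r" "\<epsilon> < G * r ^ M"
  shows "card {s \<in> R. absF (poly h s) \<le> \<epsilon>} \<le> M"
proof (rule ccontr)
  assume "\<not> ?thesis"
  then obtain T where T: "T \<subseteq> {s \<in> R. absF (poly h s) \<le> \<epsilon>}" "card T = Suc M" "finite T"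
    using obtain_subset_with_card_n[of "Suc M" "{s \<in> R. absF (poly h s) \<le> \<epsilon>}"] by auto
  then obtain s where s: "bij_betw s {0..<Suc M} T"
    using ex_bij_betw_nat_finite[of T] by auto
  have mem: "s i \<in> T" if "i \<le> M" for i using s that by (auto simp: bij_betw_def)
  have ne: "s i \<noteq> s j" if "i < j" "j \<le> M" for i j
    using inj_on_eq_iff[OF bij_betw_imp_inj_on[OF s], of i j] that by simp
  have "G * r ^ M \<le> \<epsilon>"
    by (rule dominant_coeff_bound[OF assms(1-3), of s]) (use mem ne T R \<open>0 < r\<close> in \<open>auto simp: subset_iff\<close>)
  then show False using \<open>\<epsilon> < G * r ^ M\<close> by simp
qed

section \<open>Separated sample points in the unit ball\<close>

definition expand_digs :: "nat \<Rightarrow> (nat \<Rightarrow> 'k::{finite,field}) \<Rightarrow> 'k fls" where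
  "expand_digs j v = (\<Sum>i<j. fls_const (v i) * fls_X_intpow (int i))"

lemma nth_expand_digs:
  "fls_nth (expand_digs j v) m = (if 0 \<le> m \<and> m < int j then v (nat m) else 0)"
proof -
  have "fls_nth (expand_digs j v) m = (\<Sum>i<j. if i = nat m then (if 0 \<le> m then v i else 0) else 0)"
    unfolding expand_digs_def fls_nth_sum by (intro sum.cong) auto
  then show ?thesis by auto
qed

text \<open>One representative from each ball of radius q^-j in the unit ball of the field. These
  are the parameters at which curves are sampled.\<close>

definition Rdig :: "nat \<Rightarrow> 'k::{finite,field} fls set" where
  "Rdig j = expand_digs j ` digs j"

lemma finite_Rdig [simp]: "finite (Rdig j)"
  by (simp add: Rdig_def)

lemma card_Rdig: "card (Rdig j :: 'k::{finite,field} fls set) = CARD('k) ^ j"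
proof -
  have "inj_on (expand_digs j) (digs j :: (nat \<Rightarrow> 'k) set)"
  proof (rule inj_onI)
    fix v v' :: "nat \<Rightarrow> 'k"
    assume v: "v \<in> digs j" "v' \<in> digs j" and eq: "expand_digs j v = expand_digs j v'"
    have "v i = v' i" for i
      using v arg_cong[OF eq, of "\<lambda>a. fls_nth a (int i)"]
      by (cases "i < j") (auto simp: nth_expand_digs digs_def)
    then show "v = v'" by auto
  qed
  then show ?thesis unfolding Rdig_def by (simp add: card_image card_digs)
qed

lemma absF_Rdig_le: "s \<in> Rdig j \<Longrightarrow> absF s \<le> 1"
  by (auto simp: absF_le_1_iff Rdig_def nth_expand_digs)

text \<open>Absolute values are powers of q, so a distance below q^-i is at most q^-(i+1), and this
  makes all \<open>i + 1\<close> digits agree.\<close>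

lemma Rdig_separated:
  fixes s s' :: "'k::{finite,field} fls"
  assumes "s \<in> Rdig (Suc i)" "s' \<in> Rdig (Suc i)" "s \<noteq> s'"
  shows "1 / real CARD('k) ^ i \<le> absF (s - s')"
proof (rule ccontr)
  assume "\<not> ?thesis"
  then have less: "absF (s - s') < real CARD('k) powi (- int i)"
    by (simp add: power_int_minus divide_inverse)
  have "absF (s - s') \<le> real CARD('k) powi (- (int i + 1))"
  proof (cases rule: absF_cases[of "s - s'"])
    case (2 k)
    have "k < - int i"
    proof (rule ccontr)
      assume "\<not> k < - int i"
      then have "real CARD('k) powi (- int i) \<le> real CARD('k) powi k"
        by (intro power_int_increasing) auto
      then show False using less 2 by simp
    qed
    then have "real CARD('k) powi k \<le> real CARD('k) powi (- (int i + 1))"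
      by (intro power_int_increasing) auto
    then show ?thesis using 2 by simp
  qed auto
  then have *: "fls_nth s m = fls_nth s' m" if "m < int (Suc i)" for m
    using that unfolding absF_le_powi_iff by (simp add: algebra_simps)
  have "s = s'"
  proof (rule fls_eqI)
    show "fls_nth s m = fls_nth s' m" for m
      using * assms(1,2) by (cases "m < int (Suc i)") (auto simp: Rdig_def nth_expand_digs)
  qed
  then show False using assms by simp
qed

section \<open>Polynomials in several variables and their Weierstrass degree\<close>

definition Box :: "nat \<Rightarrow> nat \<Rightarrow> (nat \<Rightarrow> nat) set" where
  "Box d K = {\<beta>. (\<forall>i<d. \<beta> i \<le> K) \<and> (\<forall>i\<ge>d. \<beta> i = 0)}"

definition mdeg :: "nat \<Rightarrow> (nat \<Rightarrow> nat) \<Rightarrow> nat" where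
  "mdeg d \<beta> = (\<Sum>i<d. \<beta> i)"

definition mpoly :: "nat \<Rightarrow> nat \<Rightarrow> ((nat \<Rightarrow> nat) \<Rightarrow> 'k::{finite,field} fls) \<Rightarrow> (nat \<Rightarrow> 'k fls) \<Rightarrow> 'k fls" where
  "mpoly d K c z = (\<Sum>\<beta>\<in>Box d K. c \<beta> * (\<Prod>i<d. z i ^ \<beta> i))"

text \<open>The analogue of having Weierstrass degree at most \<open>N\<close>.\<close>

definition dominated :: "nat \<Rightarrow> nat \<Rightarrow> nat \<Rightarrow> ((nat \<Rightarrow> nat) \<Rightarrow> 'k::{finite,field} fls) \<Rightarrow> bool" where
  "dominated d K N c \<longleftrightarrow> (\<exists>\<beta>0\<in>Box d K. mdeg d \<beta>0 \<le> N \<and> c \<beta>0 \<noteq> 0 \<and>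
     (\<forall>\<beta>\<in>Box d K. absF (c \<beta>) \<le> absF (c \<beta>0) \<and> (N < mdeg d \<beta> \<longrightarrow> absF (c \<beta>) < absF (c \<beta>0))))"

lemma bij_betw_Box:
  "bij_betw (\<lambda>g i. if i < d then g i else 0) (PiE {..<d} (\<lambda>_. {..K})) (Box d K)"
proof (rule bij_betw_byWitness[where f' = "\<lambda>v. restrict v {..<d}"])
qed (auto simp: Box_def PiE_def Pi_def extensional_def restrict_def fun_eq_iff)

lemma finite_Box [simp]: "finite (Box d K)"
  using bij_betw_finite[OF bij_betw_Box] by (metis finite_PiE finite_lessThan finite_atMost)

lemma mpoly_cong: "(\<And>i. i < d \<Longrightarrow> z i = z' i) \<Longrightarrow> mpoly d K c z = mpoly d K c z'"
  unfolding mpoly_def by (intro sum.cong refl arg_cong2[where f = "(*)"] prod.cong) auto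

text \<open>The binomial theorem in each variable. \<open>Box\<close> bounds every exponent
  separately, so the new monomials stay in the same box and a product of one-variable sums expands
  over exactly this box.\<close>

lemma mpoly_recentre:
  fixes c :: "(nat \<Rightarrow> nat) \<Rightarrow> 'k::{finite,field} fls" and d K :: nat
  defines "c' \<equiv> \<lambda>w b \<beta>. \<Sum>\<gamma>\<in>Box d K. c \<gamma> * (\<Prod>i<d. of_nat (\<gamma> i choose \<beta> i) * w i ^ (\<gamma> i - \<beta> i) * b ^ \<beta> i)"
  shows "mpoly d K c (\<lambda>i. w i + b * z i) = mpoly d K (c' w b) z"
proof -
  have one: "(w i + b * z i) ^ \<gamma> i = (\<Sum>l\<le>K. of_nat (\<gamma> i choose l) * w i ^ (\<gamma> i - l) * b ^ l * z i ^ l)"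
    if "\<gamma> \<in> Box d K" "i < d" for \<gamma> i
  proof -
    have "(w i + b * z i) ^ \<gamma> i = (\<Sum>l\<le>\<gamma> i. of_nat (\<gamma> i choose l) * (b * z i) ^ l * w i ^ (\<gamma> i - l))"
      unfolding add.commute[of "w i"] by (rule binomial_ring)
    also have "\<dots> = (\<Sum>l\<le>K. of_nat (\<gamma> i choose l) * (b * z i) ^ l * w i ^ (\<gamma> i - l))"
      using that by (intro sum.mono_neutral_left) (auto simp: Box_def binomial_eq_0)
    finally show ?thesis by (simp add: power_mult_distrib algebra_simps)
  qed
  have "mpoly d K c (\<lambda>i. w i + b * z i) =
      (\<Sum>\<gamma>\<in>Box d K. c \<gamma> * (\<Prod>i<d. \<Sum>l\<le>K. of_nat (\<gamma> i choose l) * w i ^ (\<gamma> i - l) * b ^ l * z i ^ l))"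
    unfolding mpoly_def by (intro sum.cong refl arg_cong2[where f = "(*)"] prod.cong one) auto
  also have "\<dots> = (\<Sum>\<gamma>\<in>Box d K. c \<gamma> *
      (\<Sum>\<beta>\<in>Box d K. (\<Prod>i<d. of_nat (\<gamma> i choose \<beta> i) * w i ^ (\<gamma> i - \<beta> i) * b ^ \<beta> i * z i ^ \<beta> i)))"
    by (subst prod_sum_PiE)
       (auto simp: sum.reindex_bij_betw[OF bij_betw_Box, symmetric] intro!: sum.cong prod.cong)
  also have "\<dots> = mpoly d K (c' w b) z"
    unfolding mpoly_def c'_def sum_distrib_left sum_distrib_right
    by (subst sum.swap) (simp add: prod.distrib mult.assoc)
  finally show ?thesis .
qed

text \<open>The Weierstrass degree does not grow on a smaller ball. Let \<open>G\<close> be the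
  largest size of a coefficient and \<open>N0\<close> the highest total degree at which it occurs. A
  new coefficient at \<open>\<beta>\<close> receives contributions only from indices above
  \<open>\<beta>\<close> and carries the factor \<open>absF b ^ mdeg d \<beta>\<close>. In degree
  greater than \<open>N0\<close> this stays below \<open>G * absF b ^ N0\<close>, a value attained
  at \<open>\<beta>s\<close>, where all other contributions come from higher degree and are
  smaller.\<close>

lemma dominated_recentre:
  fixes c :: "(nat \<Rightarrow> nat) \<Rightarrow> 'k::{finite,field} fls"
  assumes dom: "dominated d K N c" and w: "\<And>i. i < d \<Longrightarrow> absF (w i) \<le> 1"
    and b: "absF b \<le> 1" "b \<noteq> 0"
  shows "\<exists>c'. dominated d K N c' \<and> (\<forall>z. mpoly d K c (\<lambda>i. w i + b * z i) = mpoly d K c' z)"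
proof -
  define t where "t \<gamma> \<beta> = c \<gamma> * (\<Prod>i<d. of_nat (\<gamma> i choose \<beta> i) * w i ^ (\<gamma> i - \<beta> i) * b ^ \<beta> i)" for \<gamma> \<beta>
  define c' where "c' \<beta> = (\<Sum>\<gamma>\<in>Box d K. t \<gamma> \<beta>)" for \<beta>
  obtain \<beta>0 where \<beta>0: "\<beta>0 \<in> Box d K" "mdeg d \<beta>0 \<le> N" "c \<beta>0 \<noteq> 0"
    "\<And>\<beta>. \<beta> \<in> Box d K \<Longrightarrow> absF (c \<beta>) \<le> absF (c \<beta>0)"
    "\<And>\<beta>. \<beta> \<in> Box d K \<Longrightarrow> N < mdeg d \<beta> \<Longrightarrow> absF (c \<beta>) < absF (c \<beta>0)"
    using dom unfolding dominated_def by blast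
  define G where "G = absF (c \<beta>0)"
  have G: "0 < G" using \<beta>0 by (simp add: G_def)
  define A where "A = {\<beta> \<in> Box d K. absF (c \<beta>) = G}"
  have "finite A" "\<beta>0 \<in> A" using \<beta>0 by (auto simp: A_def G_def)
  then obtain \<beta>s where \<beta>s: "\<beta>s \<in> A" "\<And>\<beta>. \<beta> \<in> A \<Longrightarrow> mdeg d \<beta> \<le> mdeg d \<beta>s"
    using ex_maximizer[of A "mdeg d"] by blast
  define N0 where "N0 = mdeg d \<beta>s"
  have less: "absF (c \<gamma>) < G" if "\<gamma> \<in> Box d K" "N0 < mdeg d \<gamma>" for \<gamma>
    using that \<beta>s(2)[of \<gamma>] \<beta>0(4)[of \<gamma>] by (auto simp: A_def G_def N0_def not_le order_less_le)
  have N0: "N0 \<le> N" using \<beta>s(1) \<beta>0(5)[of \<beta>s] by (force simp: A_def G_def N0_def)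
  have t0: "t \<gamma> \<beta> = 0" if "\<not> (\<forall>i<d. \<beta> i \<le> \<gamma> i)" for \<gamma> \<beta>
    using that by (auto simp: t_def not_le binomial_eq_0 intro!: bexI)
  have tle: "absF (t \<gamma> \<beta>) \<le> absF (c \<gamma>) * absF b ^ mdeg d \<beta>" for \<gamma> \<beta>
  proof -
    have "(\<Prod>i<d. absF (of_nat (\<gamma> i choose \<beta> i) * w i ^ (\<gamma> i - \<beta> i) * b ^ \<beta> i)) \<le> (\<Prod>i<d. absF b ^ \<beta> i)"
    proof (intro prod_mono conjI)
      fix i assume "i \<in> {..<d}"
      then have "absF (of_nat (\<gamma> i choose \<beta> i) :: 'k fls) * absF (w i) ^ (\<gamma> i - \<beta> i) \<le> 1 * 1"
        using w by (intro mult_mono absF_of_nat_le power_le_one) auto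
      then show "absF (of_nat (\<gamma> i choose \<beta> i) * w i ^ (\<gamma> i - \<beta> i) * b ^ \<beta> i) \<le> absF b ^ \<beta> i"
        by (simp add: absF_mult absF_power mult_left_le_one_le)
    qed auto
    then show ?thesis
      by (simp add: t_def absF_mult[of "c \<gamma>"] absF_prod mdeg_def power_sum mult_left_mono)
  qed
  have bpos: "0 < absF b" using b by simp
  have small: "absF (c' \<beta>) < G * absF b ^ N0" if \<beta>: "\<beta> \<in> Box d K" "N0 < mdeg d \<beta>" for \<beta>
    unfolding c'_def
  proof (rule absF_sum_less)
    fix \<gamma> assume \<gamma>: "\<gamma> \<in> Box d K"
    show "absF (t \<gamma> \<beta>) < G * absF b ^ N0"
    proof (cases "\<forall>i<d. \<beta> i \<le> \<gamma> i")
      case True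
      then have "mdeg d \<beta> \<le> mdeg d \<gamma>" unfolding mdeg_def by (intro sum_mono) auto
      then have "absF (c \<gamma>) < G" using less[OF \<gamma>] \<beta> by simp
      then have "absF (c \<gamma>) * absF b ^ mdeg d \<beta> < G * absF b ^ mdeg d \<beta>"
        using bpos by (intro mult_strict_right_mono) auto
      also have "\<dots> \<le> G * absF b ^ N0"
        using \<beta> b G by (intro mult_left_mono power_decreasing) auto
      finally show ?thesis using tle[of \<gamma> \<beta>] by simp
    qed (use t0 G bpos in auto)
  qed (use G bpos in auto)
  have top: "absF (c' \<beta>s) = G * absF b ^ N0"
  proof -
    have mem: "\<beta>s \<in> Box d K" using \<beta>s by (simp add: A_def)
    have "absF (t \<beta>s \<beta>s) = G * absF b ^ N0"
      using \<beta>s(1) by (simp add: t_def A_def absF_mult absF_prod absF_power N0_def mdeg_def power_sum)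
    moreover have "absF (\<Sum>\<gamma>\<in>Box d K - {\<beta>s}. t \<gamma> \<beta>s) < G * absF b ^ N0"
    proof (rule absF_sum_less)
      fix \<gamma> assume \<gamma>: "\<gamma> \<in> Box d K - {\<beta>s}"
      show "absF (t \<gamma> \<beta>s) < G * absF b ^ N0"
      proof (cases "\<forall>i<d. \<beta>s i \<le> \<gamma> i")
        case True
        obtain i where "\<gamma> i \<noteq> \<beta>s i" using \<gamma> by (metis Diff_iff ext singletonI)
        then have "i < d" using \<gamma> mem by (force simp: Box_def)
        then have "mdeg d \<beta>s < mdeg d \<gamma>" unfolding mdeg_def using True \<open>\<gamma> i \<noteq> \<beta>s i\<close>
          by (intro sum_strict_mono_ex1) (auto intro!: bexI[of _ i] simp: order_less_le)
        then have "absF (c \<gamma>) < G" using less[of \<gamma>] \<gamma> by (simp add: N0_def)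
        then have "absF (c \<gamma>) * absF b ^ mdeg d \<beta>s < G * absF b ^ N0"
          using bpos unfolding N0_def by (intro mult_strict_right_mono) auto
        then show ?thesis using tle[of \<gamma> \<beta>s] by simp
      qed (use t0 G bpos in auto)
    qed (use G bpos in auto)
    ultimately show ?thesis
      unfolding c'_def using mem by (subst sum.remove[OF _ mem]) (auto simp: absF_add_eq)
  qed
  \<comment> \<open>Shrinking can move the largest coefficient to a degree below \<open>N0\<close>,
    so the leading index is chosen afresh.\<close>
  have "finite (Box d K)" "Box d K \<noteq> {}" using \<beta>0 by auto
  then obtain \<beta>1 where \<beta>1: "\<beta>1 \<in> Box d K" "\<And>\<beta>. \<beta> \<in> Box d K \<Longrightarrow> absF (c' \<beta>) \<le> absF (c' \<beta>1)"
    using ex_maximizer[of "Box d K" "\<lambda>\<beta>. absF (c' \<beta>)"] by blast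
  have big: "G * absF b ^ N0 \<le> absF (c' \<beta>1)" using \<beta>1(2)[of \<beta>s] top \<beta>s(1) by (simp add: A_def)
  have "dominated d K N c'"
    unfolding dominated_def
  proof (intro bexI[of _ \<beta>1] conjI ballI impI)
    show "mdeg d \<beta>1 \<le> N"
    proof (rule ccontr)
      assume "\<not> mdeg d \<beta>1 \<le> N"
      then show False using small[of \<beta>1] big N0 \<beta>1(1) by simp
    qed
    have "0 < G * absF b ^ N0" using G bpos by simp
    then show "c' \<beta>1 \<noteq> 0" using big by (metis absF_0 not_le)
    show "absF (c' \<beta>) < absF (c' \<beta>1)" if "\<beta> \<in> Box d K" "N < mdeg d \<beta>" for \<beta>
      using small[of \<beta>] that N0 big by simp
  qed (use \<beta>1 in auto)
  moreover have "mpoly d K c (\<lambda>i. w i + b * z i) = mpoly d K c' z" for z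
    unfolding mpoly_recentre c'_def t_def ..
  ultimately show ?thesis by blast
qed

lemma base_digits_inj:
  fixes \<beta> \<beta>' :: "nat \<Rightarrow> nat"
  assumes "\<forall>i<d. \<beta> i < b" "\<forall>i<d. \<beta>' i < b" "(\<Sum>i<d. \<beta> i * b ^ i) = (\<Sum>i<d. \<beta>' i * b ^ i)"
  shows "\<forall>i<d. \<beta> i = \<beta>' i"
  using assms
proof (induction d arbitrary: \<beta> \<beta>')
  case (Suc d)
  have split: "(\<Sum>i<Suc d. g i * b ^ i) = g 0 + b * (\<Sum>i<d. g (Suc i) * b ^ i)" for g
    by (simp add: sum.lessThan_Suc_shift sum_distrib_left mult_ac del: sum.lessThan_Suc)
  have lt: "\<beta> 0 < b" "\<beta>' 0 < b" using Suc.prems by auto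
  have eq: "\<beta> 0 + b * (\<Sum>i<d. \<beta> (Suc i) * b ^ i) = \<beta>' 0 + b * (\<Sum>i<d. \<beta>' (Suc i) * b ^ i)"
    using Suc.prems(3) unfolding split .
  have 0: "\<beta> 0 = \<beta>' 0" using arg_cong[OF eq, of "\<lambda>x. x mod b"] lt by simp
  have "\<forall>i<d. \<beta> (Suc i) = \<beta>' (Suc i)"
    using Suc.IH[of "\<lambda>i. \<beta> (Suc i)" "\<lambda>i. \<beta>' (Suc i)"] Suc.prems eq 0 lt by auto
  then show ?case using 0 by (auto simp: less_Suc_eq_0_disj)
qed auto

text \<open>Over a finite residue field a form can vanish in every direction defined over it, so lines do not
  suffice; the curve \<open>s \<mapsto> (s ^ (N + 1) ^ i)\<^sub>i\<close> separates all monomials of degree at most \<open>N\<close>.\<close>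

lemma dominated_along_curve:
  fixes c :: "(nat \<Rightarrow> nat) \<Rightarrow> 'k::{finite,field} fls"
  assumes dom: "dominated d K N c"
  shows "\<exists>h M G. M \<le> N * Suc N ^ d \<and> 0 < G \<and> absF (coeff h M) = G \<and> (\<forall>m>M. absF (coeff h m) < G)
    \<and> (\<forall>s. poly h s = mpoly d K c (\<lambda>i. s ^ (Suc N ^ i)))
    \<and> (\<forall>z. (\<forall>i<d. absF (z i) \<le> 1) \<longrightarrow> absF (mpoly d K c z) \<le> G)"
proof -
  define wt where "wt \<beta> = (\<Sum>i<d. \<beta> i * Suc N ^ i)" for \<beta> :: "nat \<Rightarrow> nat"
  define h where "h = (\<Sum>\<beta>\<in>Box d K. Polynomial.monom (c \<beta>) (wt \<beta>))"
  obtain \<beta>0 where \<beta>0: "\<beta>0 \<in> Box d K" "mdeg d \<beta>0 \<le> N" "c \<beta>0 \<noteq> 0"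
    "\<And>\<beta>. \<beta> \<in> Box d K \<Longrightarrow> absF (c \<beta>) \<le> absF (c \<beta>0)"
    "\<And>\<beta>. \<beta> \<in> Box d K \<Longrightarrow> N < mdeg d \<beta> \<Longrightarrow> absF (c \<beta>) < absF (c \<beta>0)"
    using dom unfolding dominated_def by blast
  define G where "G = absF (c \<beta>0)"
  have G: "0 < G" using \<beta>0 by (simp add: G_def)
  define A where "A = {\<beta> \<in> Box d K. absF (c \<beta>) = G}"
  have A: "finite A" "\<beta>0 \<in> A" using \<beta>0 by (auto simp: A_def G_def)
  \<comment> \<open>Of all coefficients of size \<open>G\<close>, the one of largest weight gives
    the dominant coefficient of \<open>h\<close>: no other of that size has the same weight, and
    larger weights collect only smaller coefficients.\<close>
  then obtain \<beta>s where \<beta>s: "\<beta>s \<in> A" "\<And>\<beta>. \<beta> \<in> A \<Longrightarrow> wt \<beta> \<le> wt \<beta>s"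
    using ex_maximizer[of A wt] by blast
  have degA: "mdeg d \<beta> \<le> N" if "\<beta> \<in> A" for \<beta>
    using \<beta>0(5)[of \<beta>] that by (force simp: A_def G_def)
  have digit: "\<beta> i \<le> mdeg d \<beta>" if "i < d" for \<beta> i
    unfolding mdeg_def using that by (intro member_le_sum) auto
  have coeff_h: "coeff h m = (\<Sum>\<beta>\<in>{\<beta> \<in> Box d K. wt \<beta> = m}. c \<beta>)" for m
    by (simp add: h_def coeff_sum sum.If_cases Int_def)
  have notA: "absF (c \<beta>) < G" if "\<beta> \<in> Box d K" "\<beta> \<notin> A" for \<beta>
    using that \<beta>0(4)[of \<beta>] by (auto simp: A_def G_def order_less_le)
  have uniq: "\<beta> = \<beta>s" if "\<beta> \<in> A" "wt \<beta> = wt \<beta>s" for \<beta>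
  proof
    fix i
    have "\<forall>i<d. \<beta> i = \<beta>s i"
      by (rule base_digits_inj[where b = "Suc N"])
         (use that \<beta>s(1) digit degA in \<open>auto simp: wt_def less_Suc_eq_le intro: order_trans\<close>)
    then show "\<beta> i = \<beta>s i" using that \<beta>s(1) by (cases "i < d") (auto simp: A_def Box_def)
  qed
  have 1: "wt \<beta>s \<le> N * Suc N ^ d"
  proof -
    have "wt \<beta>s \<le> (\<Sum>i<d. \<beta>s i * Suc N ^ d)"
      unfolding wt_def by (intro sum_mono mult_left_mono power_increasing) auto
    also have "\<dots> = mdeg d \<beta>s * Suc N ^ d" by (simp add: mdeg_def sum_distrib_right)
    also have "\<dots> \<le> N * Suc N ^ d" using degA[OF \<beta>s(1)] by (rule mult_right_mono) simp
    finally show ?thesis .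
  qed
  have 2: "absF (coeff h (wt \<beta>s)) = G"
  proof -
    let ?B = "{\<beta> \<in> Box d K. wt \<beta> = wt \<beta>s}"
    have mem: "\<beta>s \<in> ?B" using \<beta>s by (simp add: A_def)
    have "absF (\<Sum>\<beta>\<in>?B - {\<beta>s}. c \<beta>) < G"
      using uniq notA G by (intro absF_sum_less) auto
    moreover have "absF (c \<beta>s) = G" using \<beta>s(1) by (simp add: A_def)
    ultimately show ?thesis
      unfolding coeff_h by (subst sum.remove[OF _ mem]) (auto simp: absF_add_eq)
  qed
  have 3: "absF (coeff h m) < G" if "wt \<beta>s < m" for m
    unfolding coeff_h using that \<beta>s(2) notA G by (intro absF_sum_less) force+
  have 4: "poly h s = mpoly d K c (\<lambda>i. s ^ (Suc N ^ i))" for s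
    by (simp add: h_def poly_sum poly_monom mpoly_def wt_def power_sum mult.commute flip: power_mult)
  have 5: "absF (mpoly d K c z) \<le> G" if "\<forall>i<d. absF (z i) \<le> 1" for z
    unfolding mpoly_def
  proof (rule absF_sum_le)
    fix \<beta> assume "\<beta> \<in> Box d K"
    then have "absF (c \<beta>) * (\<Prod>i<d. absF (z i) ^ \<beta> i) \<le> G * 1"
      using that \<beta>0(4) G by (intro mult_mono prod_le_1) (auto simp: G_def power_le_one prod_nonneg)
    then show "absF (c \<beta> * (\<Prod>i<d. z i ^ \<beta> i)) \<le> G"
      by (simp add: absF_mult absF_prod absF_power)
  qed (use G in simp)
  show ?thesis using 1 2 3 4 5 G by (intro exI[of _ h] exI[of _ "wt \<beta>s"] exI[of _ G]) auto
qed

text \<open>Average over the translates of the curve by all cells of the ball: on each translate at most \<open>m\<close>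
  of the \<open>q ^ (i + 1)\<close> digit expansions give a small value.\<close>

lemma poly_good:
  fixes c :: "(nat \<Rightarrow> nat) \<Rightarrow> 'k::{finite,field} fls" and x0 w :: "nat \<Rightarrow> 'k fls"
  assumes dom: "dominated d K N c"
    and w: "w \<in> bal d x0 \<kappa>" and k: "\<kappa> \<le> k"
    and e: "0 < \<epsilon>" and rho: "0 < \<rho>"
    and x: "x \<in> bal d w k" "\<rho> \<le> absF (mpoly d K c (\<lambda>i. (x i - x0 i) * fls_X_intpow (- \<kappa>)))"
  defines "m \<equiv> Suc (N * Suc N ^ d)"
  shows "sumcells d L w k (\<lambda>Q. of_bool (\<forall>x\<in>Q. absF (mpoly d K c (\<lambda>i. (x i - x0 i) * fls_X_intpow (- \<kappa>))) \<le> \<epsilon>))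
     \<le> real m * (\<epsilon> / \<rho>) powr (1 / real m) * real CARD('k) ^ (d * L)"
proof -
  let ?q = "real CARD('k)"
  define g where "g x = mpoly d K c (\<lambda>i. (x i - x0 i) * fls_X_intpow (- \<kappa>))" for x :: "nat \<Rightarrow> 'k fls"
  let ?F = "\<lambda>Q. of_bool (\<forall>x\<in>Q. absF (g x) \<le> \<epsilon>) :: real"
  have wv: "w \<in> vecF d" using w bal_subset_vecF by blast
  have m1: "1 \<le> real m" by (simp add: m_def)
  have "sumcells d L w k ?F \<le> real m * (\<epsilon> / \<rho>) powr (1 / real m) * ?q ^ (d * L)"
  proof (cases "\<rho> \<le> \<epsilon>")
    case True
    have "sumcells d L w k ?F \<le> sumcells d L w k (\<lambda>_. 1)"
      by (intro sumcells_mono wv) auto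
    also have "\<dots> = 1 * 1 * ?q ^ (d * L)" by (simp add: sumcells_const)
    also have "\<dots> \<le> real m * (\<epsilon> / \<rho>) powr (1 / real m) * ?q ^ (d * L)"
      using True rho m1 by (intro mult_mono ge_one_powr_ge_zero) (auto simp: field_simps)
    finally show ?thesis .
  next
    case False
    have q1: "1 < ?q ^ m" by (intro one_less_power CARD_gt1) (simp add: m_def)
    \<comment> \<open>The search yields the last \<open>i\<close> with
      \<open>\<epsilon> * q ^ (m * i) < \<rho>\<close>. The sample points are then still far enough
      apart for the counting bound, while their number, q^(i+1), is at least the \<open>m\<close>-th
      root of \<open>\<rho> / \<epsilon>\<close>.\<close>
    obtain p where "\<rho> / \<epsilon> < (?q ^ m) ^ p" using real_arch_pow[OF q1] by blast
    then have "\<rho> < \<epsilon> * (?q ^ m) ^ p" using e by (simp only: pos_divide_less_eq mult.commute)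
    then have "\<rho> \<le> \<epsilon> * (?q ^ m) ^ p" by simp
    moreover have "\<not> \<rho> \<le> \<epsilon> * (?q ^ m) ^ 0" using False by simp
    ultimately have "\<exists>i<p. (\<forall>j\<le>i. \<not> \<rho> \<le> \<epsilon> * (?q ^ m) ^ j) \<and> \<rho> \<le> \<epsilon> * (?q ^ m) ^ Suc i"
      by (rule ex_least_nat_less)
    then obtain i where i: "\<not> \<rho> \<le> \<epsilon> * (?q ^ m) ^ i" "\<rho> \<le> \<epsilon> * (?q ^ m) ^ Suc i"
      by blast
    \<comment> \<open>The curve scaled to the radius of the ball \<open>bal d w k\<close>, so that
      translating by its points preserves the ball.\<close>
    define y where "y s l = (if l < d then fls_X_intpow k * s ^ (Suc N ^ l) else 0)" for s :: "'k fls" and l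
    have card: "real (card (Rdig (Suc i) :: 'k fls set)) * sumcells d L w k ?F \<le> real m * ?q ^ (d * L)"
    proof (rule sumcells_average)
      fix s :: "'k fls" assume s: "s \<in> Rdig (Suc i)"
      show "y s \<in> vecF d" by (simp add: y_def vecF_def)
      show "\<forall>l<d. \<forall>j<k. fls_nth (y s l) j = 0"
      proof (intro allI impI)
        fix l j assume "l < d" "j < k"
        have "absF (y s l) \<le> ?q powi (- k) * 1"
          unfolding y_def using \<open>l < d\<close> absF_Rdig_le[OF s]
          by (simp add: absF_mult absF_power mult_left_le power_le_one)
        then show "fls_nth (y s l) j = 0" using \<open>j < k\<close> by (simp add: absF_le_powi_iff)
      qed
    next
      fix u assume u: "u \<in> bal d w k"
      define w' where "w' l = (u l - x0 l) * fls_X_intpow (- \<kappa>)" for l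
      have ux0: "u \<in> bal d x0 \<kappa>" using u w k by (auto simp: bal_def)
      have w': "absF (w' l) \<le> 1" if "l < d" for l
      proof -
        have "absF (u l - x0 l) * ?q powi \<kappa> \<le> ?q powi (- \<kappa>) * ?q powi \<kappa>"
          using ux0 that by (intro mult_right_mono) (auto simp: bal_iff_absF)
        then show ?thesis by (simp add: w'_def absF_mult flip: power_int_add)
      qed
      have "?q powi (- (k - \<kappa>)) \<le> ?q powi 0" using k by (intro power_int_increasing) auto
      then have b: "absF (fls_X_intpow (k - \<kappa>) :: 'k fls) \<le> 1" by (simp only: absF_shift_one) simp
      obtain c' where c': "dominated d K N c'"
        "\<And>z. mpoly d K c (\<lambda>l. w' l + fls_X_intpow (k - \<kappa>) * z l) = mpoly d K c' z"
        using dominated_recentre[where w = w' and b = "fls_X_intpow (k - \<kappa>)", OF dom w' b fls_X_intpow_nonzero]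
        by blast
      have gu: "g (\<lambda>l. u l + (if l < d then fls_X_intpow k * z l else 0)) = mpoly d K c' z" for z
        unfolding c'(2)[symmetric] g_def
      proof (rule mpoly_cong)
        fix l assume "l < d"
        have "fls_X_intpow k * z l * fls_X_intpow (- \<kappa>) = (fls_X_intpow k * fls_X_intpow (- \<kappa>)) * z l"
          by (simp only: ac_simps)
        then show "(u l + (if l < d then fls_X_intpow k * z l else 0) - x0 l) * fls_X_intpow (- \<kappa>) =
            w' l + fls_X_intpow (k - \<kappa>) * z l"
          using \<open>l < d\<close> unfolding fls_X_intpow_times_fls_X_intpow
          by (simp add: w'_def algebra_simps)
      qed
      obtain h M G where h: "M \<le> N * Suc N ^ d" "0 < G" "absF (coeff h M) = G"
          "\<And>m. M < m \<Longrightarrow> absF (coeff h m) < G"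
          "\<And>s. poly h s = mpoly d K c' (\<lambda>i. s ^ (Suc N ^ i))"
          "\<And>z. (\<forall>i<d. absF (z i) \<le> 1) \<Longrightarrow> absF (mpoly d K c' z) \<le> G"
        using dominated_along_curve[OF c'(1)] by blast
      have gy: "g (\<lambda>l. u l + y s l) = poly h s" for s
        unfolding y_def gu h(5) ..
      \<comment> \<open>\<open>G\<close> bounds the recentred polynomial on the unit ball, hence the
        original one on the whole ball, and \<open>x\<close> belongs to that ball.\<close>
      have rG: "\<rho> \<le> G"
      proof -
        define z where "z l = fls_X_intpow (- k) * (x l - u l)" for l
        have xu: "x \<in> bal d u k" using x(1) bal_eq_if_mem[OF u] by simp
        have xz: "x = (\<lambda>l. u l + (if l < d then fls_X_intpow k * z l else 0))"
        proof
          fix l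
          have "fls_X_intpow k * z l = x l - u l"
            unfolding z_def mult.assoc[symmetric] fls_X_intpow_times_fls_X_intpow by simp
          moreover have "x l = u l" if "\<not> l < d"
            using xu u that by (simp add: bal_def vecF_def)
          ultimately show "x l = u l + (if l < d then fls_X_intpow k * z l else 0)"
            by simp
        qed
        have "absF (z l) \<le> 1" if "l < d" for l
        proof -
          have "?q powi k * absF (x l - u l) \<le> ?q powi k * ?q powi (- k)"
            using xu that by (intro mult_left_mono) (auto simp: bal_iff_absF)
          then show ?thesis by (simp add: z_def absF_mult flip: power_int_add)
        qed
        then have "absF (g x) \<le> G" using h(6)[of z] gu[of z] xz by simp
        then show ?thesis using x(2) by (simp add: g_def)
      qed
      have "card {s \<in> Rdig (Suc i). absF (poly h s) \<le> \<epsilon>} \<le> M"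
      proof (rule card_small_values_le[OF h(3,4,2)])
        have "\<epsilon> * (?q ^ i) ^ M \<le> \<epsilon> * (?q ^ i) ^ m"
          using e h(1) by (intro mult_left_mono power_increasing) (auto simp: m_def)
        also have "\<dots> < \<rho>" using i(1) by (simp add: not_le mult.commute flip: power_mult)
        finally have "\<epsilon> * (?q ^ i) ^ M < G" using rG by simp
        then show "\<epsilon> < G * (1 / ?q ^ i) ^ M" by (simp add: field_simps power_one_over)
      qed (auto intro: absF_Rdig_le Rdig_separated)
      then have "card {s \<in> Rdig (Suc i). absF (poly h s) \<le> \<epsilon>} \<le> m"
        using h(1) by (simp add: m_def)
      then show "real (card {s \<in> Rdig (Suc i). absF (g (\<lambda>l. u l + y s l)) \<le> \<epsilon>}) \<le> real m"
        unfolding gy by (rule of_nat_mono)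
    qed (use wv in auto)
    have pw: "1 / ?q ^ Suc i \<le> (\<epsilon> / \<rho>) powr (1 / real m)"
    proof -
      have "(1 / ?q ^ Suc i) ^ m \<le> \<epsilon> / \<rho>"
        using i(2) rho by (simp add: field_simps power_one_over flip: power_mult)
      then have "((1 / ?q ^ Suc i) ^ m) powr (1 / real m) \<le> (\<epsilon> / \<rho>) powr (1 / real m)"
        by (intro powr_mono2) auto
      moreover have "((1 / ?q ^ Suc i) ^ m) powr (1 / real m) = 1 / ?q ^ Suc i"
        using m1 by (subst powr_realpow[symmetric]) (auto simp: powr_powr)
      ultimately show ?thesis by simp
    qed
    have "sumcells d L w k ?F \<le> real m * ?q ^ (d * L) * (1 / ?q ^ Suc i)"
      using card by (simp add: card_Rdig field_simps)
    also have "\<dots> \<le> real m * ?q ^ (d * L) * (\<epsilon> / \<rho>) powr (1 / real m)"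
      by (intro mult_left_mono pw) auto
    finally show ?thesis by (simp add: mult_ac)
  qed
  then show ?thesis unfolding g_def .
qed

subsection \<open>Analytic functions\<close>

text \<open>Gaussian elimination: each step removes the last function after pivoting at a point where it
  does not vanish.\<close>

lemma lin_indep_lower_bound:
  fixes \<phi> :: "nat \<Rightarrow> 'i \<Rightarrow> 'k::{finite,field} fls"
  assumes "\<And>a. (\<And>\<beta>. \<beta> \<in> I \<Longrightarrow> (\<Sum>i<p. a i * \<phi> i \<beta>) = 0) \<Longrightarrow> \<forall>i<p. a i = 0"
  shows "\<exists>T \<eta>. finite T \<and> T \<subseteq> I \<and> 0 < \<eta> \<and>
    (\<forall>a i. i < p \<longrightarrow> (\<exists>\<beta>\<in>T. \<eta> * absF (a i) \<le> absF (\<Sum>i<p. a i * \<phi> i \<beta>)))"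
  using assms
proof (induction p arbitrary: \<phi>)
  case 0
  then show ?case by (intro exI[of _ "{}"] exI[of _ 1]) auto
next
  case (Suc p)
  have "\<not> (\<forall>\<beta>\<in>I. \<phi> p \<beta> = 0)"
  proof
    assume "\<forall>\<beta>\<in>I. \<phi> p \<beta> = 0"
    then have "\<forall>i<Suc p. (\<lambda>i. if i = p then 1 else 0 :: 'k fls) i = 0"
      by (intro Suc.prems) (auto simp: if_distrib cong: if_cong)
    then show False by auto
  qed
  then obtain \<beta>0 where \<beta>0: "\<beta>0 \<in> I" "\<phi> p \<beta>0 \<noteq> 0" by blast
  define r where "r i = \<phi> i \<beta>0 / \<phi> p \<beta>0" for i
  define \<psi> where "\<psi> i \<beta> = \<phi> i \<beta> - r i * \<phi> p \<beta>" for i \<beta>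
  have \<psi>0: "\<psi> i \<beta>0 = 0" for i using \<beta>0 by (simp add: \<psi>_def r_def)
  have split: "(\<Sum>i<Suc p. a i * \<phi> i \<beta>) = (\<Sum>i<p. a i * \<psi> i \<beta>) + (a p + (\<Sum>i<p. a i * r i)) * \<phi> p \<beta>" for a \<beta>
    by (simp add: \<psi>_def sum_subtractf sum_distrib_right distrib_right right_diff_distrib mult.assoc)
  have "\<forall>i<p. a i = 0" if z: "\<And>\<beta>. \<beta> \<in> I \<Longrightarrow> (\<Sum>i<p. a i * \<psi> i \<beta>) = 0" for a
  proof -
    define a' where "a' i = (if i = p then - (\<Sum>i<p. a i * r i) else a i)" for i
    have "(\<Sum>i<Suc p. a' i * \<phi> i \<beta>) = 0" if "\<beta> \<in> I" for \<beta>
      unfolding split using z[OF that] by (simp add: a'_def)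
    then have "\<forall>i<Suc p. a' i = 0" by (rule Suc.prems)
    then show ?thesis by (auto simp: a'_def less_Suc_eq split: if_splits)
  qed
  from Suc.IH[of \<psi>, OF this] obtain T \<eta> where T: "finite T" "T \<subseteq> I" "0 < \<eta>"
    "\<And>a i. i < p \<Longrightarrow> \<exists>\<beta>\<in>T. \<eta> * absF (a i) \<le> absF (\<Sum>i<p. a i * \<psi> i \<beta>)" by blast
  define A where "A = Max (insert 1 ((\<lambda>\<beta>. absF (\<phi> p \<beta>)) ` T \<union> (\<lambda>i. absF (r i)) ` {..<p}))"
  have A: "1 \<le> A" "\<And>\<beta>. \<beta> \<in> T \<Longrightarrow> absF (\<phi> p \<beta>) \<le> A" "\<And>i. i < p \<Longrightarrow> absF (r i) \<le> A"
    unfolding A_def using T by (auto intro!: Max_ge)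
  define \<delta> where "\<delta> = absF (\<phi> p \<beta>0)"
  have \<delta>: "0 < \<delta>" using \<beta>0 by (simp add: \<delta>_def)
  \<comment> \<open>\<open>\<eta>1\<close> serves the coefficients below \<open>p\<close>,
    \<open>\<eta>2\<close> the coefficient \<open>a p\<close> as well; the divisions by
    \<open>A\<close> pay for undoing the elimination.\<close>
  define \<eta>1 where "\<eta>1 = min \<eta> (\<delta> * \<eta> / A)"
  have \<eta>1: "0 < \<eta>1" "\<eta>1 \<le> \<eta>" "\<eta>1 * A \<le> \<delta> * \<eta>" using T \<delta> A(1) by (auto simp: \<eta>1_def min_def field_simps)
  define \<eta>2 where "\<eta>2 = min \<eta>1 (min \<delta> (\<eta>1 / A))"
  have \<eta>2: "0 < \<eta>2" "\<eta>2 \<le> \<eta>1" "\<eta>2 \<le> \<delta>" "\<eta>2 * A \<le> \<eta>1"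
  proof -
    show "0 < \<eta>2" "\<eta>2 \<le> \<eta>1" "\<eta>2 \<le> \<delta>" using \<eta>1 \<delta> A(1) by (auto simp: \<eta>2_def)
    have "\<eta>2 \<le> \<eta>1 / A" by (simp add: \<eta>2_def)
    then show "\<eta>2 * A \<le> \<eta>1" using A(1) by (simp add: pos_le_divide_eq)
  qed
  have main: "\<exists>\<beta>\<in>insert \<beta>0 T. \<eta>2 * absF (a i) \<le> absF (\<Sum>i<Suc p. a i * \<phi> i \<beta>)" if i: "i < Suc p" for a i
  proof (rule ccontr)
    assume neg: "\<not> ?thesis"
    \<comment> \<open>The coefficient of \<open>\<phi> p\<close> after elimination. At the pivot
      \<open>\<beta>0\<close> all \<open>\<psi> i\<close> vanish, so the value there bounds
      \<open>E\<close> alone.\<close>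
    define E where "E = a p + (\<Sum>i<p. a i * r i)"
    define S where "S = \<eta>2 * absF (a i)"
    have S: "absF (\<Sum>i<Suc p. a i * \<phi> i \<beta>) < S" if "\<beta> \<in> insert \<beta>0 T" for \<beta>
      using neg that by (auto simp: S_def not_le)
    have S0: "0 < S" using S[of \<beta>0] le_less_trans[OF absF_nonneg] by blast
    have "absF E * \<delta> < S" using S[of \<beta>0] unfolding split by (simp add: \<psi>0 E_def \<delta>_def absF_mult)
    then have E: "absF E < S / \<delta>" using \<delta> by (simp add: field_simps)
    have small: "\<eta> * absF (a l) < max S (S / \<delta> * A)" if l: "l < p" for l
    proof -
      obtain \<beta> where \<beta>: "\<beta> \<in> T" "\<eta> * absF (a l) \<le> absF (\<Sum>i<p. a i * \<psi> i \<beta>)"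
        using T(4)[OF l] by blast
      have "(\<Sum>i<p. a i * \<psi> i \<beta>) = (\<Sum>i<Suc p. a i * \<phi> i \<beta>) - E * \<phi> p \<beta>"
        unfolding split E_def by simp
      moreover have "absF (E * \<phi> p \<beta>) < S / \<delta> * A"
      proof -
        have "absF (E * \<phi> p \<beta>) \<le> absF E * A"
          using A(2)[OF \<beta>(1)] by (auto simp: absF_mult intro: mult_left_mono)
        also have "\<dots> < S / \<delta> * A" using E A(1) by (intro mult_strict_right_mono) auto
        finally show ?thesis .
      qed
      moreover have "absF (\<Sum>i<Suc p. a i * \<phi> i \<beta>) < S" using S[of \<beta>] \<beta>(1) by blast
      ultimately have "absF (\<Sum>i<p. a i * \<psi> i \<beta>) < max S (S / \<delta> * A)"
        using absF_diff_lessI[of "\<Sum>i<Suc p. a i * \<phi> i \<beta>" "max S (S / \<delta> * A)" "E * \<phi> p \<beta>"]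
        by (simp only: less_max_iff_disj) blast
      then show ?thesis using \<beta>(2) by simp
    qed
    have small': "\<eta>1 * absF (a l) < S" if l: "l < p" for l
    proof -
      have "\<eta> * absF (a l) < S \<or> \<eta> * absF (a l) < S / \<delta> * A" using small[OF l] by (auto simp: max_def split: if_splits)
      then show ?thesis
      proof
        assume "\<eta> * absF (a l) < S"
        then show ?thesis using mult_right_mono[OF \<eta>1(2) absF_nonneg[of "a l"]] by simp
      next
        assume *: "\<eta> * absF (a l) < S / \<delta> * A"
        have "\<eta>1 * A * absF (a l) \<le> \<delta> * \<eta> * absF (a l)"
          using \<eta>1(3) by (intro mult_right_mono) auto
        also have "\<dots> < S * A" using * \<delta> by (simp add: field_simps)
        finally show ?thesis using A(1) by (simp add: mult_ac)
      qed
    qed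
    show False
    proof (cases "i < p")
      case True
      then show ?thesis using small'[OF True] mult_right_mono[OF \<eta>2(2) absF_nonneg[of "a i"]]
        by (simp add: S_def)
    next
      case False
      then have ip: "i = p" using i by simp
      have "absF (\<Sum>i<p. a i * r i) < S * A / \<eta>1"
      proof (rule absF_sum_less)
        fix l assume l: "l \<in> {..<p}"
        have "absF (a l * r l) \<le> absF (a l) * A"
          using A(3)[of l] l by (auto simp: absF_mult intro: mult_left_mono)
        also have "\<dots> < S / \<eta>1 * A"
          using small'[of l] l \<eta>1(1) A(1) by (intro mult_strict_right_mono) (auto simp: field_simps)
        finally show "absF (a l * r l) < S * A / \<eta>1" by simp
      qed (use S0 \<eta>1 A in auto)
      moreover have "a p = E - (\<Sum>i<p. a i * r i)" by (simp add: E_def)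
      ultimately have "absF (a p) < max (S / \<delta>) (S * A / \<eta>1)"
        using E absF_diff_lessI[of E "max (S / \<delta>) (S * A / \<eta>1)" "\<Sum>i<p. a i * r i"]
        by (simp only: less_max_iff_disj) blast
      then have "absF (a p) < S / \<delta> \<or> absF (a p) < S * A / \<eta>1" by (auto simp: max_def split: if_splits)
      then show False
      proof
        assume "absF (a p) < S / \<delta>"
        then have "\<delta> * absF (a p) < S" using \<delta> by (simp add: field_simps)
        then show False using mult_right_mono[OF \<eta>2(3) absF_nonneg[of "a p"]] by (simp add: S_def ip)
      next
        assume "absF (a p) < S * A / \<eta>1"
        then have "\<eta>1 * absF (a p) < S * A" using \<eta>1 by (simp add: field_simps)
        also have "\<dots> = \<eta>2 * A * absF (a p)" by (simp add: S_def ip)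
        also have "\<dots> \<le> \<eta>1 * absF (a p)" using \<eta>2(4) by (intro mult_right_mono) auto
        finally show False by simp
      qed
    qed
  qed
  show ?case
    by (intro exI[of _ "insert \<beta>0 T"] exI[of _ \<eta>2]) (use main T \<beta>0 \<eta>2 in auto)
qed

text \<open>Monomials in coordinates that turn the ball of depth \<kappa> into the unit ball. They
  are bounded by 1 there, so sizes are governed by the coefficients.\<close>

definition monval :: "nat \<Rightarrow> (nat \<Rightarrow> 'k::{finite,field} fls) \<Rightarrow> int \<Rightarrow> (nat \<Rightarrow> nat) \<Rightarrow> (nat \<Rightarrow> 'k fls) \<Rightarrow> 'k fls" where
  "monval d x0 \<kappa> \<beta> x = (\<Prod>i<d. ((x i - x0 i) * fls_X_intpow (- \<kappa>)) ^ \<beta> i)"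

text \<open>Convergence in uniform form: the coefficients tend to 0, and every finite partial sum
  that contains all coefficients of size at least \<open>e\<close> is within \<open>e\<close> on the
  whole ball. The finite set may be enlarged at will, which allows one set to serve several
  functions.\<close>

definition expands :: "nat \<Rightarrow> (nat \<Rightarrow> 'k::{finite,field} fls) \<Rightarrow> int \<Rightarrow> ((nat \<Rightarrow> nat) \<Rightarrow> 'k fls) \<Rightarrow> ((nat \<Rightarrow> 'k fls) \<Rightarrow> 'k fls) \<Rightarrow> bool" where
  "expands d x0 \<kappa> c g \<longleftrightarrow>
     (\<forall>e>0. finite {\<beta> \<in> mindices d. e \<le> absF (c \<beta>)}) \<and>
     (\<forall>e>0. \<forall>x\<in>bal d x0 \<kappa>. \<forall>S. finite S \<and> S \<subseteq> mindices d \<and> {\<beta> \<in> mindices d. e \<le> absF (c \<beta>)} \<subseteq> S \<longrightarrow>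
        absF (g x - (\<Sum>\<beta>\<in>S. c \<beta> * monval d x0 \<kappa> \<beta> x)) < e)"

lemma expandsD:
  assumes "expands d x0 \<kappa> c g" "0 < e"
  shows "finite {\<beta> \<in> mindices d. e \<le> absF (c \<beta>)}"
    and "x \<in> bal d x0 \<kappa> \<Longrightarrow> finite S \<Longrightarrow> S \<subseteq> mindices d \<Longrightarrow> {\<beta> \<in> mindices d. e \<le> absF (c \<beta>)} \<subseteq> S \<Longrightarrow>
      absF (g x - (\<Sum>\<beta>\<in>S. c \<beta> * monval d x0 \<kappa> \<beta> x)) < e"
  using assms unfolding expands_def by blast+

lemma absF_rescaled_le:
  fixes x0 :: "nat \<Rightarrow> 'k::{finite,field} fls"
  assumes "x \<in> bal d x0 l" "i < d"
  shows "absF ((x i - x0 i) * fls_X_intpow (- \<kappa>)) \<le> real CARD('k) powi (\<kappa> - l)"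
proof -
  have "absF (x i - x0 i) * real CARD('k) powi \<kappa> \<le> real CARD('k) powi (- l) * real CARD('k) powi \<kappa>"
    using assms by (intro mult_right_mono) (auto simp: bal_iff_absF)
  then show ?thesis by (simp add: absF_mult flip: power_int_add)
qed

lemma absF_monval_le: "x \<in> bal d x0 \<kappa> \<Longrightarrow> absF (monval d x0 \<kappa> \<beta> x) \<le> 1"
  unfolding monval_def absF_prod absF_power
  using absF_rescaled_le[of x d x0 \<kappa> _ \<kappa>] by (intro prod_le_1) (auto intro: power_le_one)

lemma expands_const: "expands d x0 \<kappa> (\<lambda>\<beta>. if \<beta> = (\<lambda>_. 0) then 1 else 0) (\<lambda>_. 1 :: 'k::{finite,field} fls)"
  unfolding expands_def
proof (intro conjI allI ballI impI, goal_cases)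
  case (1 e)
  then have "{\<beta> \<in> mindices d. e \<le> absF (if \<beta> = (\<lambda>_. 0) then 1 else 0 :: 'k fls)} \<subseteq> {\<lambda>_. 0}" by auto
  then show ?case using finite_subset by blast
next
  case (2 e x S)
  have "(\<Sum>\<beta>\<in>S. (if \<beta> = (\<lambda>_. 0) then 1 else 0) * monval d x0 \<kappa> \<beta> x)
      = (\<Sum>\<beta>\<in>S. if \<beta> = (\<lambda>_. 0) then 1 else 0)"
    by (intro sum.cong) (auto simp: monval_def)
  also have "\<dots> = (if (\<lambda>_. 0) \<in> S then 1 else 0)" using 2 by simp
  finally have eq: "(\<Sum>\<beta>\<in>S. (if \<beta> = (\<lambda>_. 0) then 1 else 0) * monval d x0 \<kappa> \<beta> x) = (if (\<lambda>_. 0) \<in> S then 1 else 0)" .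
  have "(\<lambda>_. 0) \<in> mindices d" by (simp add: mindices_def)
  then have "(\<lambda>_. 0) \<in> S \<or> 1 < e" using 2(3) by force
  then show ?case unfolding eq using 2 by auto
qed

lemma has_sumF_obtain:
  assumes "has_sumF t A s" "0 < e"
  obtains S0 where "finite S0" "S0 \<subseteq> A"
    "\<And>S1. finite S1 \<Longrightarrow> S0 \<subseteq> S1 \<Longrightarrow> S1 \<subseteq> A \<Longrightarrow> absF (sum t S1 - s) < e"
proof -
  have "\<exists>S0. finite S0 \<and> S0 \<subseteq> A \<and> (\<forall>S1. finite S1 \<and> S0 \<subseteq> S1 \<and> S1 \<subseteq> A \<longrightarrow> absF (sum t S1 - s) < e)"
    using assms unfolding has_sumF_def by simp
  then show ?thesis using that by auto
qed

text \<open>Every sufficiently large \<kappa> is allowed, so that the finitely many components can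
  share one ball.\<close>

lemma analytic_expands:
  fixes g :: "(nat \<Rightarrow> 'k::{finite,field} fls) \<Rightarrow> 'k fls"
  assumes "analyticF_on d U g" "x0 \<in> U" "x0 \<in> vecF d"
  shows "\<exists>\<kappa>0. \<forall>\<kappa>\<ge>\<kappa>0. bal d x0 \<kappa> \<subseteq> U \<and> (\<exists>c. expands d x0 \<kappa> c g)"
proof -
  obtain r coef where r: "0 < r" and co: "\<And>x. x \<in> cballF d x0 r \<Longrightarrow> x \<in> U \<and>
      has_sumF (\<lambda>\<beta>. coef \<beta> * (\<Prod>i<d. (x i - x0 i) ^ \<beta> i)) (mindices d) (g x)"
    using assms(1)[unfolded analyticF_on_def, rule_format, OF assms(2)] by blast
  obtain p where p: "(1 / real CARD('k)) ^ p < r"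
    using real_arch_pow_inv[OF r, of "1 / real CARD('k)"] CARD_gt1[where 'k='k] by (auto simp: field_simps)
  show ?thesis
  proof (intro exI[of _ "int p"] allI impI)
    fix \<kappa> :: int assume \<kappa>: "int p \<le> \<kappa>"
    have "real CARD('k) powi (- \<kappa>) \<le> real CARD('k) powi (- int p)"
      using \<kappa> by (intro power_int_increasing) auto
    also have "\<dots> \<le> r" using p by (simp add: power_int_minus power_one_over divide_inverse power_inverse)
    finally have sub: "bal d x0 \<kappa> \<subseteq> cballF d x0 r"
      unfolding cballF_eq_bal[symmetric] by (auto simp: cballF_def)
    define c where "c \<beta> = coef \<beta> * fls_X_intpow \<kappa> ^ mdeg d \<beta>" for \<beta>
    have trm: "coef \<beta> * (\<Prod>i<d. (x i - x0 i) ^ \<beta> i) = c \<beta> * monval d x0 \<kappa> \<beta> x" for \<beta> x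
    proof -
      have resc: "x i - x0 i = fls_X_intpow \<kappa> * ((x i - x0 i) * fls_X_intpow (- \<kappa>))" for i
      proof -
        have "fls_X_intpow \<kappa> * ((x i - x0 i) * fls_X_intpow (- \<kappa>)) = (x i - x0 i) * (fls_X_intpow \<kappa> * fls_X_intpow (- \<kappa>))"
          by (simp only: ac_simps)
        then show ?thesis unfolding fls_X_intpow_times_fls_X_intpow by simp
      qed
      have "(\<Prod>i<d. (x i - x0 i) ^ \<beta> i) = (\<Prod>i<d. fls_X_intpow \<kappa> ^ \<beta> i * ((x i - x0 i) * fls_X_intpow (- \<kappa>)) ^ \<beta> i)"
        unfolding power_mult_distrib[symmetric] by (intro prod.cong refl arg_cong2[where f = "(^)"] resc)
      then show ?thesis by (simp only: prod.distrib c_def monval_def mdeg_def power_sum mult.assoc)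
    qed
    have hs: "has_sumF (\<lambda>\<beta>. c \<beta> * monval d x0 \<kappa> \<beta> x) (mindices d) (g x)" if "x \<in> bal d x0 \<kappa>" for x
      using co[of x] that sub unfolding trm by blast
    have fin: "finite {\<beta> \<in> mindices d. e \<le> absF (c \<beta>)}" if e: "0 < e" for e
    proof -
      \<comment> \<open>At this point every rescaled monomial equals 1, so summability there forces
        the coefficients themselves to tend to 0.\<close>
      define x1 where "x1 i = (if i < d then x0 i + fls_X_intpow \<kappa> else 0)" for i
      have x1: "x1 \<in> bal d x0 \<kappa>" by (auto simp: bal_def vecF_def x1_def)
      have mv: "monval d x0 \<kappa> \<beta> x1 = 1" for \<beta>
        unfolding monval_def
      proof (rule prod.neutral, intro ballI)
        fix i assume "i \<in> {..<d}"
        have "fls_X_intpow \<kappa> * fls_X_intpow (- \<kappa>) = (1 :: 'k fls)"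
          unfolding fls_X_intpow_times_fls_X_intpow by simp
        then show "((x1 i - x0 i) * fls_X_intpow (- \<kappa>)) ^ \<beta> i = 1"
          using \<open>i \<in> {..<d}\<close> by (simp add: x1_def)
      qed
      obtain S0 where S0: "finite S0" "S0 \<subseteq> mindices d"
        "\<And>S1. finite S1 \<Longrightarrow> S0 \<subseteq> S1 \<Longrightarrow> S1 \<subseteq> mindices d \<Longrightarrow> absF (sum c S1 - g x1) < e"
        by (rule has_sumF_obtain[OF hs[OF x1, unfolded mv mult_1_right] e]) (rule that; assumption)
      have "absF (c \<beta>) < e" if "\<beta> \<in> mindices d" "\<beta> \<notin> S0" for \<beta>
      proof -
        have "absF ((sum c (insert \<beta> S0) - g x1) - (sum c S0 - g x1)) < e"
          using S0 that by (intro absF_diff_lessI S0(3)) auto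
        then show ?thesis using S0 that by simp
      qed
      then have "{\<beta> \<in> mindices d. e \<le> absF (c \<beta>)} \<subseteq> S0" by force
      then show ?thesis using S0(1) finite_subset by blast
    qed
    have "expands d x0 \<kappa> c g"
      unfolding expands_def
    proof (intro conjI allI ballI impI fin, assumption, elim conjE)
      fix e :: real and x S assume e: "0 < e" and x: "x \<in> bal d x0 \<kappa>"
        and S: "finite S" "S \<subseteq> mindices d" "{\<beta> \<in> mindices d. e \<le> absF (c \<beta>)} \<subseteq> S"
      let ?t = "\<lambda>\<beta>. c \<beta> * monval d x0 \<kappa> \<beta> x"
      obtain S0 where S0: "finite S0" "S0 \<subseteq> mindices d"
        "\<And>S1. finite S1 \<Longrightarrow> S0 \<subseteq> S1 \<Longrightarrow> S1 \<subseteq> mindices d \<Longrightarrow> absF (sum ?t S1 - g x) < e"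
        by (rule has_sumF_obtain[OF hs[OF x] e]) (rule that; assumption)
      have "absF (sum ?t (S0 - S)) < e"
      proof (rule absF_sum_less)
        fix \<beta> assume "\<beta> \<in> S0 - S"
        then have "absF (c \<beta>) < e" using S S0 by force
        moreover have "absF (c \<beta>) * absF (monval d x0 \<kappa> \<beta> x) \<le> absF (c \<beta>) * 1"
          using absF_monval_le[OF x] by (intro mult_left_mono) auto
        ultimately show "absF (?t \<beta>) < e" by (simp add: absF_mult)
      qed (use e in simp)
      moreover have "absF (sum ?t (S \<union> S0) - g x) < e" using S S0 by (intro S0(3)) auto
      moreover have "sum ?t (S \<union> S0) = sum ?t S + sum ?t (S0 - S)"
        using S S0 by (subst sum.union_disjoint[symmetric]) (auto intro: sum.cong)
      ultimately have "absF (sum ?t (S0 - S) - (sum ?t (S \<union> S0) - g x)) < e"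
        by (blast intro: absF_diff_lessI)
      then show "absF (g x - sum ?t S) < e"
        using \<open>sum ?t (S \<union> S0) = _\<close> by (simp add: algebra_simps)
    qed
    moreover have "bal d x0 \<kappa> \<subseteq> U" using sub co by blast
    ultimately show "bal d x0 \<kappa> \<subseteq> U \<and> (\<exists>c. expands d x0 \<kappa> c g)" by blast
  qed
qed

lemma absF_prod_diff_le:
  assumes "\<And>i. i \<in> A \<Longrightarrow> absF (a i) \<le> 1" "\<And>i. i \<in> A \<Longrightarrow> absF (b i) \<le> 1"
    and "\<And>i. i \<in> A \<Longrightarrow> absF (a i - b i) \<le> r" "0 \<le> r"
  shows "absF (prod a A - prod b A) \<le> r"
  using assms
proof (induction A rule: infinite_finite_induct)
  case (insert x A)
  have "prod a (insert x A) - prod b (insert x A) = a x * (prod a A - prod b A) + (a x - b x) * prod b A"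
    using insert by (simp add: algebra_simps)
  moreover have "absF (a x * (prod a A - prod b A)) \<le> 1 * r"
    unfolding absF_mult using insert by (intro mult_mono) auto
  moreover have "absF ((a x - b x) * prod b A) \<le> r * 1"
    unfolding absF_mult absF_prod using insert by (intro mult_mono prod_le_1 prod_nonneg) auto
  ultimately show ?case by (simp only: mult_1_left mult_1_right) (rule absF_add_leI)
qed auto

text \<open>Up to an error below \<open>e\<close> only finitely many monomials count, and these are
  Lipschitz on the ball. The lemma later determines how fine the cells have to be.\<close>

lemma expands_uniformly_continuous:
  fixes g :: "(nat \<Rightarrow> 'k::{finite,field} fls) \<Rightarrow> 'k fls"
  assumes ex: "expands d x0 \<kappa> c g" and e: "0 < e"
  shows "\<exists>l0. \<forall>l\<ge>l0. \<forall>x\<in>bal d x0 \<kappa>. \<forall>y\<in>bal d x l. absF (g y - g x) < e"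
proof -
  define S where "S = {\<beta> \<in> mindices d. e \<le> absF (c \<beta>)}"
  have S: "finite S" using expandsD(1)[OF ex e] by (simp add: S_def)
  define C where "C = Max (insert 1 ((\<lambda>\<beta>. absF (c \<beta>)) ` S))"
  have C: "1 \<le> C" "\<And>\<beta>. \<beta> \<in> S \<Longrightarrow> absF (c \<beta>) \<le> C" using S by (auto simp: C_def)
  obtain p where p: "(1 / real CARD('k)) ^ p < e / C"
    using real_arch_pow_inv[of "e / C" "1 / real CARD('k)"] e C CARD_gt1[where 'k='k] by (auto simp: field_simps)
  show ?thesis
  proof (intro exI[of _ "\<kappa> + int p"] allI ballI impI)
    fix l :: int and x y :: "nat \<Rightarrow> 'k fls"
    assume l: "\<kappa> + int p \<le> l" and x: "x \<in> bal d x0 \<kappa>" and y: "y \<in> bal d x l"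
    have y0: "y \<in> bal d x0 \<kappa>" using bal_subset_bal[OF x, of l] y l by auto
    define r where "r = real CARD('k) powi (\<kappa> - l)"
    have r0: "0 \<le> r" by (simp add: r_def)
    have "r \<le> real CARD('k) powi (- int p)" unfolding r_def using l by (intro power_int_increasing) auto
    also have "\<dots> < e / C" using p by (simp add: power_int_minus power_one_over divide_inverse power_inverse)
    finally have rC: "C * r < e" using C by (simp add: field_simps)
    let ?t = "\<lambda>z \<beta>. c \<beta> * monval d x0 \<kappa> \<beta> z"
    have "absF (sum (?t y) S - sum (?t x) S) \<le> C * r"
      unfolding sum_subtractf[symmetric] right_diff_distrib[symmetric]
    proof (rule absF_sum_le)
      fix \<beta> assume \<beta>: "\<beta> \<in> S"
      have "absF (monval d x0 \<kappa> \<beta> y - monval d x0 \<kappa> \<beta> x) \<le> r"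
        unfolding monval_def
      proof (rule absF_prod_diff_le)
        fix i assume i: "i \<in> {..<d}"
        let ?Y = "(y i - x0 i) * fls_X_intpow (- \<kappa>)" and ?X = "(x i - x0 i) * fls_X_intpow (- \<kappa>)"
        have X: "absF ?X \<le> 1" and Y: "absF ?Y \<le> 1"
          using absF_rescaled_le[OF x, of i \<kappa>] absF_rescaled_le[OF y0, of i \<kappa>] i by auto
        show "absF (?X ^ \<beta> i) \<le> 1" "absF (?Y ^ \<beta> i) \<le> 1"
          unfolding absF_power using X Y by (auto intro: power_le_one)
        have "absF (?Y - ?X) \<le> r"
          using absF_rescaled_le[OF y, of i \<kappa>] i by (simp add: r_def algebra_simps)
        then have "absF (prod (\<lambda>_. ?Y) {..<\<beta> i} - prod (\<lambda>_. ?X) {..<\<beta> i}) \<le> r"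
          using X Y r0 by (intro absF_prod_diff_le)
        then show "absF (?Y ^ \<beta> i - ?X ^ \<beta> i) \<le> r" by simp
      qed (fact r0)
      then show "absF (c \<beta> * (monval d x0 \<kappa> \<beta> y - monval d x0 \<kappa> \<beta> x)) \<le> C * r"
        unfolding absF_mult using C \<beta> by (intro mult_mono) auto
    qed (use C r0 in auto)
    then have 1: "absF (sum (?t y) S - sum (?t x) S) < e" using rC by simp
    have 2: "absF (g x - sum (?t x) S) < e" "absF (g y - sum (?t y) S) < e"
      using expandsD(2)[OF ex e _ S] x y0 by (auto simp: S_def)
    have "absF ((g y - sum (?t y) S) - (g x - sum (?t x) S) + (sum (?t y) S - sum (?t x) S)) < e"
      by (intro absF_add_lessI absF_diff_lessI 1 2)
    then show "absF (g y - g x) < e" by (simp add: algebra_simps)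
  qed
qed

lemma finite_mindices_subset_Box:
  assumes "finite S" "S \<subseteq> mindices d"
  obtains K where "S \<subseteq> Box d K"
proof -
  define K where "K = (\<Sum>\<beta>\<in>S. mdeg d \<beta>)"
  have "\<beta> i \<le> K" if "\<beta> \<in> S" "i < d" for \<beta> i
  proof -
    have "\<beta> i \<le> mdeg d \<beta>" unfolding mdeg_def using that by (intro member_le_sum) auto
    also have "\<dots> \<le> K" unfolding K_def using that assms by (intro member_le_sum) auto
    finally show ?thesis .
  qed
  then have "S \<subseteq> Box d K" using assms by (auto simp: Box_def mindices_def)
  then show ?thesis by (rule that)
qed

section \<open>Linear combinations of finitely many expandable functions\<close>

lemma Box_subset_mindices: "Box d K \<subseteq> mindices d"
  by (auto simp: Box_def mindices_def)

lemma mult_le_less: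
  fixes x :: real
  assumes "x \<le> y" "z < w" "0 \<le> z" "0 < y"
  shows "x * z < y * w"
proof -
  have "x * z \<le> y * z" using assms by (intro mult_right_mono) auto
  also have "\<dots> < y * w" using assms by (intro mult_strict_left_mono) auto
  finally show ?thesis .
qed

text \<open>Independence is assumed on every ball inside the given one, because lower bounds are
  needed on arbitrarily small balls.\<close>

locale expandable_family =
  fixes d p :: nat and x0 :: "nat \<Rightarrow> 'k::{finite,field} fls" and \<kappa> :: int
    and \<phi> :: "nat \<Rightarrow> (nat \<Rightarrow> 'k fls) \<Rightarrow> 'k fls" and cc :: "nat \<Rightarrow> (nat \<Rightarrow> nat) \<Rightarrow> 'k fls"
  assumes x0: "x0 \<in> vecF d"
    and expands: "\<And>i. i < p \<Longrightarrow> expands d x0 \<kappa> (cc i) (\<phi> i)"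
    and indep: "\<And>w k a. w \<in> bal d x0 \<kappa> \<Longrightarrow> \<kappa> \<le> k \<Longrightarrow>
      (\<And>x. x \<in> bal d w k \<Longrightarrow> (\<Sum>i<p. a i * \<phi> i x) = 0) \<Longrightarrow> \<forall>i<p. a i = 0"
begin

definition lc :: "(nat \<Rightarrow> 'k fls) \<Rightarrow> (nat \<Rightarrow> 'k fls) \<Rightarrow> 'k fls" where
  "lc a x = (\<Sum>i<p. a i * \<phi> i x)"

definition lcc :: "(nat \<Rightarrow> 'k fls) \<Rightarrow> (nat \<Rightarrow> nat) \<Rightarrow> 'k fls" where
  "lcc a \<beta> = (\<Sum>i<p. a i * cc i \<beta>)"

lemma lc_approx:
  assumes A: "\<And>i. i < p \<Longrightarrow> absF (a i) \<le> A" "0 < A" and e: "0 < e"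
    and x: "x \<in> bal d x0 \<kappa>" and S: "finite S" "S \<subseteq> mindices d"
      "\<And>i. i < p \<Longrightarrow> {\<beta> \<in> mindices d. e \<le> absF (cc i \<beta>)} \<subseteq> S"
  shows "absF (lc a x - (\<Sum>\<beta>\<in>S. lcc a \<beta> * monval d x0 \<kappa> \<beta> x)) < A * e"
proof -
  have "(\<Sum>\<beta>\<in>S. lcc a \<beta> * monval d x0 \<kappa> \<beta> x) = (\<Sum>i<p. a i * (\<Sum>\<beta>\<in>S. cc i \<beta> * monval d x0 \<kappa> \<beta> x))"
    unfolding lcc_def sum_distrib_right sum_distrib_left mult.assoc by (rule sum.swap)
  then have "lc a x - (\<Sum>\<beta>\<in>S. lcc a \<beta> * monval d x0 \<kappa> \<beta> x)
      = (\<Sum>i<p. a i * (\<phi> i x - (\<Sum>\<beta>\<in>S. cc i \<beta> * monval d x0 \<kappa> \<beta> x)))"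
    by (simp add: lc_def right_diff_distrib sum_subtractf)
  also have "absF \<dots> < A * e"
  proof (rule absF_sum_less)
    fix i assume i: "i \<in> {..<p}"
    have "absF (\<phi> i x - (\<Sum>\<beta>\<in>S. cc i \<beta> * monval d x0 \<kappa> \<beta> x)) < e"
      using i by (intro expandsD(2)[OF expands e x S(1,2)] S(3)) auto
    then have "absF (a i) * absF (\<phi> i x - (\<Sum>\<beta>\<in>S. cc i \<beta> * monval d x0 \<kappa> \<beta> x)) < A * e"
      using A i by (intro mult_le_less) auto
    then show "absF (a i * (\<phi> i x - (\<Sum>\<beta>\<in>S. cc i \<beta> * monval d x0 \<kappa> \<beta> x))) < A * e"
      by (simp add: absF_mult)
  qed (use A e in simp)
  finally show ?thesis .
qed

text \<open>Independence passes from the functions to their coefficient families: a combination all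
  of whose coefficients vanish is zero on the ball. Finitely many coefficients then control
  \<open>a\<close>, uniformly in \<open>a\<close>.\<close>

lemma coefficients_lower_bound:
  "\<exists>T \<eta>. finite T \<and> T \<subseteq> mindices d \<and> 0 < \<eta> \<and>
    (\<forall>a i. i < p \<longrightarrow> (\<exists>\<beta>\<in>T. \<eta> * absF (a i) \<le> absF (lcc a \<beta>)))"
  unfolding lcc_def
proof (rule lin_indep_lower_bound)
  fix a assume z: "\<And>\<beta>. \<beta> \<in> mindices d \<Longrightarrow> (\<Sum>i<p. a i * cc i \<beta>) = 0"
  define A where "A = Max (insert 1 ((\<lambda>i. absF (a i)) ` {..<p}))"
  have A: "1 \<le> A" "\<And>i. i < p \<Longrightarrow> absF (a i) \<le> A" by (auto simp: A_def)
  have "lc a x = 0" if x: "x \<in> bal d x0 \<kappa>" for x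
  proof (rule ccontr)
    assume "lc a x \<noteq> 0"
    then have e: "0 < absF (lc a x) / A" using A by simp
    define S where "S = (\<Union>i<p. {\<beta> \<in> mindices d. absF (lc a x) / A \<le> absF (cc i \<beta>)})"
    have "absF (lc a x - (\<Sum>\<beta>\<in>S. lcc a \<beta> * monval d x0 \<kappa> \<beta> x)) < A * (absF (lc a x) / A)"
    proof (rule lc_approx[OF _ _ e x])
      show "finite S" unfolding S_def using expandsD(1)[OF expands e] by auto
    qed (use A in \<open>auto simp: S_def\<close>)
    moreover have "(\<Sum>\<beta>\<in>S. lcc a \<beta> * monval d x0 \<kappa> \<beta> x) = 0"
      using z by (intro sum.neutral) (auto simp: lcc_def S_def)
    ultimately show False using A by simp
  qed
  then show "\<forall>i<p. a i = 0"
    using indep[of x0 \<kappa> a] x0 by (simp add: lc_def)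
qed

text \<open>Here \<eta> depends on the ball; this is the quantity that later determines how large
  \<open>t\<close> has to be.\<close>

lemma ball_lower_bound:
  assumes "w \<in> bal d x0 \<kappa>" "\<kappa> \<le> k"
  shows "\<exists>\<eta>>0. \<forall>a i. i < p \<longrightarrow> (\<exists>x\<in>bal d w k. \<eta> * absF (a i) \<le> absF (lc a x))"
proof -
  obtain T \<eta> where T: "T \<subseteq> bal d w k" "0 < \<eta>"
    "\<And>a i. i < p \<Longrightarrow> \<exists>\<beta>\<in>T. \<eta> * absF (a i) \<le> absF (lc a \<beta>)"
    using lin_indep_lower_bound[where I = "bal d w k" and p = p and \<phi> = \<phi>] indep[OF assms] unfolding lc_def by blast
  then show ?thesis by (intro exI[of _ \<eta>]) blast
qed

text \<open>The point is that \<open>N\<close> serves all \<open>a\<close>. Some coefficient with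
  index in \<open>T\<close> has size at least \<eta> times the largest \<open>a i\<close>. The set
  \<open>B\<close> of indices where some function has a coefficient of size \<eta> or more is
  finite, so beyond its degrees all coefficients of the combination fall short of this. The given
  set \<open>S\<close> leaves the order of truncation free.\<close>

lemma dominated_lcc:
  "\<exists>N. \<forall>a i0 S. i0 < p \<longrightarrow> a i0 \<noteq> 0 \<longrightarrow> finite S \<longrightarrow> S \<subseteq> mindices d \<longrightarrow>
     (\<exists>K. S \<subseteq> Box d K \<and> dominated d K N (lcc a))"
proof -
  obtain T \<eta> where T: "finite T" "T \<subseteq> mindices d" "0 < \<eta>"
    "\<And>a i. i < p \<Longrightarrow> \<exists>\<beta>\<in>T. \<eta> * absF (a i) \<le> absF (lcc a \<beta>)"
    using coefficients_lower_bound by blast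
  define B where "B = (\<Union>i<p. {\<beta> \<in> mindices d. \<eta> \<le> absF (cc i \<beta>)})"
  have B: "finite B" unfolding B_def using expandsD(1)[OF expands T(3)] by auto
  define N where "N = (\<Sum>\<beta>\<in>B. mdeg d \<beta>)"
  have N: "mdeg d \<beta> \<le> N" if "\<beta> \<in> B" for \<beta>
    unfolding N_def using that B by (intro member_le_sum) auto
  show ?thesis
  proof (rule exI[of _ N], intro allI impI)
    fix a :: "nat \<Rightarrow> 'k fls" and i0 S assume i0: "i0 < p" "a i0 \<noteq> 0" and S: "finite S" "S \<subseteq> mindices d"
    obtain K where K: "S \<union> T \<subseteq> Box d K"
      using finite_mindices_subset_Box[of "S \<union> T" d] S T by auto
    obtain l where l: "l \<in> {..<p}" "\<And>i. i \<in> {..<p} \<Longrightarrow> absF (a i) \<le> absF (a l)"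
      using ex_maximizer[of "{..<p}" "\<lambda>i. absF (a i)"] i0 by blast
    have "absF (a i0) \<le> absF (a l)" using l(2) i0(1) by simp
    moreover have "0 < absF (a i0)" using i0(2) by simp
    ultimately have A0: "0 < absF (a l)" by linarith
    obtain \<beta>0 where \<beta>0: "\<beta>0 \<in> Box d K" "\<And>\<beta>. \<beta> \<in> Box d K \<Longrightarrow> absF (lcc a \<beta>) \<le> absF (lcc a \<beta>0)"
    proof (rule ex_maximizer[of "Box d K" "\<lambda>\<beta>. absF (lcc a \<beta>)"])
      show "Box d K \<noteq> {}" using T(4)[OF i0(1), of a] K by blast
    qed auto
    have big: "\<eta> * absF (a l) \<le> absF (lcc a \<beta>0)"
      using T(4)[of l a] l(1) \<beta>0(2) K by force
    have small: "absF (lcc a \<beta>) < \<eta> * absF (a l)" if "\<beta> \<in> Box d K" "N < mdeg d \<beta>" for \<beta>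
      unfolding lcc_def
    proof (rule absF_sum_less)
      fix i assume i: "i \<in> {..<p}"
      have "\<beta> \<notin> B" using N[of \<beta>] that by auto
      then have "absF (cc i \<beta>) < \<eta>" using i that Box_subset_mindices by (force simp: B_def)
      then have "absF (a i) * absF (cc i \<beta>) < absF (a l) * \<eta>"
        using l(2)[OF i] A0 by (intro mult_le_less) auto
      then show "absF (a i * cc i \<beta>) < \<eta> * absF (a l)" by (simp add: absF_mult mult.commute)
    qed (use T A0 in simp)
    have "dominated d K N (lcc a)"
      unfolding dominated_def
    proof (intro bexI[of _ \<beta>0] conjI ballI impI)
      show "mdeg d \<beta>0 \<le> N" using small[of \<beta>0] \<beta>0(1) big by force
      have "0 < \<eta> * absF (a l)" using T A0 by simp
      then show "lcc a \<beta>0 \<noteq> 0" using big by (metis absF_0 not_le)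
      show "absF (lcc a \<beta>) < absF (lcc a \<beta>0)" if "\<beta> \<in> Box d K" "N < mdeg d \<beta>" for \<beta>
        using small[OF that] big by simp
    qed (use \<beta>0 in auto)
    then show "\<exists>K. S \<subseteq> Box d K \<and> dominated d K N (lcc a)" using K by blast
  qed
qed

text \<open>Truncate so far that the error is below both \<epsilon> and \<rho>. The polynomial
  \<open>P\<close> is then as large as the combination at \<open>x\<close>, and at most \<epsilon>
  wherever the combination is. The box size \<open>K\<close> varies with \<open>a\<close>,
  \<epsilon> and \<rho>, but the bound for polynomials depends only on \<open>N\<close> and
  \<open>d\<close>.\<close>

lemma lc_good:
  "\<exists>m\<ge>1. \<forall>a w k \<epsilon> \<rho> x L. w \<in> bal d x0 \<kappa> \<longrightarrow> \<kappa> \<le> k \<longrightarrow> 0 < \<epsilon> \<longrightarrow> 0 < \<rho> \<longrightarrow>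
     x \<in> bal d w k \<longrightarrow> \<rho> \<le> absF (lc a x) \<longrightarrow>
     sumcells d L w k (\<lambda>Q. of_bool (\<forall>x\<in>Q. absF (lc a x) \<le> \<epsilon>))
       \<le> real m * (\<epsilon> / \<rho>) powr (1 / real m) * real CARD('k) ^ (d * L)"
proof -
  obtain N where N: "\<And>a i0 S. i0 < p \<Longrightarrow> a i0 \<noteq> 0 \<Longrightarrow> finite S \<Longrightarrow> S \<subseteq> mindices d \<Longrightarrow>
     \<exists>K. S \<subseteq> Box d K \<and> dominated d K N (lcc a)"
    using dominated_lcc by blast
  define m where "m = Suc (N * Suc N ^ d)"
  show ?thesis
  proof (intro exI[of _ m] conjI allI impI)
    show "1 \<le> m" by (simp add: m_def)
    fix a w x :: "nat \<Rightarrow> 'k fls" and k L and \<epsilon> \<rho> :: real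
    assume w: "w \<in> bal d x0 \<kappa>" and k: "\<kappa> \<le> k" and e: "0 < \<epsilon>" and r: "0 < \<rho>"
      and x: "x \<in> bal d w k" "\<rho> \<le> absF (lc a x)"
    have sub: "bal d w k \<subseteq> bal d x0 \<kappa>" by (rule bal_subset_bal[OF w k])
    have wv: "w \<in> vecF d" using w bal_subset_vecF by blast
    have "\<exists>i0<p. a i0 \<noteq> 0"
    proof (rule ccontr)
      assume "\<not> ?thesis"
      then have "lc a x = 0" by (auto simp: lc_def)
      then show False using x r by simp
    qed
    then obtain i0 where i0: "i0 < p" "a i0 \<noteq> 0" by blast
    define A where "A = Max (insert 1 ((\<lambda>i. absF (a i)) ` {..<p}))"
    have A: "1 \<le> A" "\<And>i. i < p \<Longrightarrow> absF (a i) \<le> A" by (auto simp: A_def)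
    define e where "e = min \<epsilon> \<rho> / A"
    have e0: "0 < e" using A \<open>0 < \<epsilon>\<close> r by (simp add: e_def)
    define S where "S = (\<Union>i<p. {\<beta> \<in> mindices d. e \<le> absF (cc i \<beta>)})"
    have S: "finite S" "S \<subseteq> mindices d" unfolding S_def using expandsD(1)[OF expands e0] by auto
    obtain K where K: "S \<subseteq> Box d K" "dominated d K N (lcc a)" using N[of i0 a S] i0 S by blast
    define P where "P x = mpoly d K (lcc a) (\<lambda>i. (x i - x0 i) * fls_X_intpow (- \<kappa>))" for x
    have diff: "absF (lc a y - P y) < min \<epsilon> \<rho>" if y: "y \<in> bal d x0 \<kappa>" for y
    proof -
      have "absF (lc a y - (\<Sum>\<beta>\<in>Box d K. lcc a \<beta> * monval d x0 \<kappa> \<beta> y)) < A * e"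
        using K(1) A by (intro lc_approx e0 y Box_subset_mindices) (auto simp: S_def)
      then show ?thesis using A by (simp add: P_def mpoly_def monval_def e_def)
    qed
    have Px: "\<rho> \<le> absF (P x)"
    proof -
      have "absF (P x - lc a x) < absF (lc a x)"
        using diff[of x] x sub by (simp add: absF_minus_commute subset_iff)
      then have "absF (lc a x + (P x - lc a x)) = absF (lc a x)" by (rule absF_add_eq)
      then show ?thesis using x by simp
    qed
    have small: "absF (P y) \<le> \<epsilon>" if "y \<in> bal d w k" "absF (lc a y) \<le> \<epsilon>" for y
    proof -
      have "absF (lc a y - P y) \<le> \<epsilon>" using diff[of y] that(1) sub by force
      then have "absF (lc a y - (lc a y - P y)) \<le> \<epsilon>"
        by (rule absF_diff_leI[OF that(2)])
      then show ?thesis by simp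
    qed
    have "sumcells d L w k (\<lambda>Q. of_bool (\<forall>x\<in>Q. absF (lc a x) \<le> \<epsilon>))
        \<le> sumcells d L w k (\<lambda>Q. of_bool (\<forall>x\<in>Q. absF (P x) \<le> \<epsilon>))"
    proof (rule sumcells_mono[OF wv])
      fix c' assume c': "c' \<in> bal d w k"
      have "bal d c' (k + int L) \<subseteq> bal d w k" by (rule bal_subset_bal[OF c']) simp
      then show "(of_bool (\<forall>x\<in>bal d c' (k + int L). absF (lc a x) \<le> \<epsilon>) :: real)
          \<le> of_bool (\<forall>x\<in>bal d c' (k + int L). absF (P x) \<le> \<epsilon>)"
        using small by (auto simp: of_bool_def)
    qed
    also have "\<dots> \<le> real m * (\<epsilon> / \<rho>) powr (1 / real m) * real CARD('k) ^ (d * L)"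
      unfolding m_def P_def
      by (rule poly_good[OF K(2) w k \<open>0 < \<epsilon>\<close> r x(1)]) (use Px in \<open>simp add: P_def\<close>)
    finally show "sumcells d L w k (\<lambda>Q. of_bool (\<forall>x\<in>Q. absF (lc a x) \<le> \<epsilon>))
       \<le> real m * (\<epsilon> / \<rho>) powr (1 / real m) * real CARD('k) ^ (d * L)" .
  qed
qed

end

subsection \<open>Quantitative nondivergence\<close>

text \<open>For sublattices, \<open>low\<close> stands for ``covolume below
  \<open>1\<close>'' and \<open>tiny\<close> for ``covolume at most \<open>\<epsilon>\<close>'', both throughout a ball; \<open>cmp\<close> is strict
  comparability.\<close>

definition marked :: "('o \<Rightarrow> 'o \<Rightarrow> bool) \<Rightarrow> ('o \<Rightarrow> 's \<Rightarrow> bool) \<Rightarrow> ('o \<Rightarrow> 's \<Rightarrow> bool) \<Rightarrow> 'o set \<Rightarrow> 's \<Rightarrow> bool" where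
  "marked cmp low tiny S Q \<longleftrightarrow> (\<exists>T. finite T \<and> T \<subseteq> S \<and> (\<forall>x\<in>T. \<forall>y\<in>T. x \<noteq> y \<longrightarrow> cmp x y) \<and>
     (\<forall>x\<in>T. low x Q \<and> \<not> tiny x Q) \<and> (\<forall>x\<in>S. (\<forall>y\<in>T. cmp x y) \<longrightarrow> \<not> low x Q))"

text \<open>The flag found among the elements comparable with \<open>x\<close> is extended by
  \<open>x\<close>. An element comparable with every member of the new flag is in particular
  comparable with \<open>x\<close>, so the old maximality applies to it.\<close>

lemma marked_insert:
  assumes "marked cmp low tiny {y \<in> S. cmp x y} Q" "x \<in> S" "low x Q" "\<not> tiny x Q"
    and sym: "\<And>x y. cmp x y \<Longrightarrow> cmp y x"
  shows "marked cmp low tiny S Q"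
proof -
  obtain T where T: "finite T" "T \<subseteq> {y \<in> S. cmp x y}" "\<forall>x\<in>T. \<forall>y\<in>T. x \<noteq> y \<longrightarrow> cmp x y"
    "\<forall>x\<in>T. low x Q \<and> \<not> tiny x Q" "\<forall>z\<in>{y \<in> S. cmp x y}. (\<forall>y\<in>T. cmp z y) \<longrightarrow> \<not> low z Q"
    using assms(1) unfolding marked_def by (elim exE conjE) (rule that; assumption)
  show ?thesis
    unfolding marked_def
  proof (intro exI[of _ "insert x T"] conjI ballI impI)
    show "finite (insert x T)" "insert x T \<subseteq> S" using T assms by auto
    show "cmp u v" if "u \<in> insert x T" "v \<in> insert x T" "u \<noteq> v" for u v
      using that T(2,3) sym[of x u] by blast
    show "low u Q" "\<not> tiny u Q" if "u \<in> insert x T" for u using that T(4) assms by blast+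
    show "\<not> low z Q" if "z \<in> S" "\<forall>y\<in>insert x T. cmp z y" for z
      using that T(5) sym[of z x] by blast
  qed
qed

text \<open>Each rank adds one summand, for the cells where the current element is tiny; the factor
  \<open>D\<close>, taken to be q^d, is the cost of replacing a child by its parent.\<close>

fun nondiv_const :: "real \<Rightarrow> nat \<Rightarrow> real" where
  "nondiv_const D 0 = 0"
| "nondiv_const D (Suc r) = D * (nondiv_const D r + 1)"

lemma nondiv_const_nonneg: "0 \<le> D \<Longrightarrow> 0 \<le> nondiv_const D r"
  by (induction r) auto

text \<open>Induction on the number of ranks and, inside it, on the depth. A child on which nothing
  is low is left to the induction on depth. Otherwise some \<open>x\<close> is low on the child but
  not on the ball itself. Every cell of the child where \<open>x\<close> is not tiny is marked as
  soon as it is marked with respect to the elements comparable with \<open>x\<close>, and these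
  occupy one rank fewer.\<close>

lemma quantitative_nondivergence:
  fixes cmp :: "'o \<Rightarrow> 'o \<Rightarrow> bool" and low tiny :: "'o \<Rightarrow> (nat \<Rightarrow> 'k::{finite,field} fls) set \<Rightarrow> bool"
    and rk :: "'o \<Rightarrow> nat" and x0 :: "nat \<Rightarrow> 'k fls"
  assumes sym: "\<And>x y. cmp x y \<Longrightarrow> cmp y x" and rk: "\<And>x y. cmp x y \<Longrightarrow> rk x \<noteq> rk y"
    and low_mono: "\<And>x Q Q'. low x Q \<Longrightarrow> Q' \<subseteq> Q \<Longrightarrow> low x Q'"
    and good: "\<And>x c k L. x \<in> P \<Longrightarrow> c \<in> bal d x0 \<kappa> \<Longrightarrow> \<kappa> \<le> k \<Longrightarrow> \<not> low x (bal d c k) \<Longrightarrow>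
      sumcells d L c k (\<lambda>Q. of_bool (tiny x Q)) \<le> M * real CARD('k) ^ (d * L)"
    and M: "0 \<le> M"
    and S: "S \<subseteq> P" "finite (rk ` S)" "card (rk ` S) \<le> r"
    and c: "c \<in> bal d x0 \<kappa>" "\<kappa> \<le> k" and high: "\<And>x. x \<in> S \<Longrightarrow> \<not> low x (bal d c k)"
  shows "sumcells d L c k (\<lambda>Q. of_bool (\<not> marked cmp low tiny S Q))
    \<le> nondiv_const (real CARD('k) ^ d) r * M * real CARD('k) ^ (d * L)"
  using S c high
proof (induction r arbitrary: S c k L)
  case 0
  then have "S = {}" by auto
  then have "marked cmp low tiny S Q" for Q by (auto simp: marked_def)
  then show ?case by (simp add: sumcells_const)
next
  case (Suc r)
  let ?D = "real CARD('k) ^ d"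
  let ?C = "nondiv_const ?D"
  note outer_IH = Suc.IH
  show ?case using Suc.prems(4-)
  proof (induction L arbitrary: c k)
    case 0
    have "marked cmp low tiny S (bal d c k)"
      unfolding marked_def by (intro exI[of _ "{}"]) (use 0 in auto)
    moreover have "0 \<le> ?C (Suc r) * M" using M by (intro mult_nonneg_nonneg nondiv_const_nonneg) auto
    ultimately show ?case by simp
  next
    case (Suc L)
    note prems = \<open>S \<subseteq> P\<close> \<open>finite (rk ` S)\<close> \<open>card (rk ` S) \<le> Suc r\<close>
    have cv: "c \<in> vecF d" using Suc.prems(1) bal_subset_vecF by blast
    have "sumcells d L (child c k v) (k + 1) (\<lambda>Q. of_bool (\<not> marked cmp low tiny S Q))
        \<le> ?C (Suc r) * M * real CARD('k) ^ (d * L)" if v: "v \<in> digs d" for v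
    proof (cases "\<forall>x\<in>S. \<not> low x (bal d (child c k v) (k + 1))")
      case True
      have chv: "child c k v \<in> vecF d" using cv v by auto
      have "child c k v \<in> bal d c k" using center_in_bal[OF chv] bal_child_subset by blast
      then have "child c k v \<in> bal d x0 \<kappa>" using bal_subset_bal[OF Suc.prems(1,2)] by blast
      then show ?thesis using Suc.IH[of "child c k v" "k + 1"] Suc.prems(2) True by simp
    next
      case False
      then obtain x where x: "x \<in> S" "low x (bal d (child c k v) (k + 1))" by blast
      have chv: "child c k v \<in> vecF d" using cv v by auto
      let ?S = "{y \<in> S. cmp x y}"
      have "rk ` ?S \<subseteq> rk ` S - {rk x}" using rk by force
      then have "card (rk ` ?S) \<le> card (rk ` S - {rk x})" using prems(2) by (intro card_mono) auto
      then have cardS: "card (rk ` ?S) \<le> r" using prems x(1) by simp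
      let ?F = "\<lambda>Q. of_bool (\<not> marked cmp low tiny ?S Q) + of_bool (tiny x Q) :: real"
      have "sumcells d L (child c k v) (k + 1) (\<lambda>Q. of_bool (\<not> marked cmp low tiny S Q))
          \<le> sumcells d L (child c k v) (k + 1) ?F"
      proof (rule sumcells_mono[OF chv])
        fix c' assume c': "c' \<in> bal d (child c k v) (k + 1)"
        let ?Q = "bal d c' (k + 1 + int L)"
        have "low x ?Q" using low_mono[OF x(2) bal_subset_bal[OF c']] by simp
        then show "of_bool (\<not> marked cmp low tiny S ?Q) \<le> ?F ?Q"
          using marked_insert[of cmp low tiny S x ?Q] x(1) sym by (auto simp: of_bool_def)
      qed
      \<comment> \<open>On the parent ball no member of \<open>S\<close> is low, so both the
        goodness of \<open>x\<close> and the induction hypothesis on ranks apply there.\<close>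
      also have "\<dots> \<le> sumcells d (Suc L) c k ?F"
        by (rule sumcells_child_le[OF _ v]) auto
      also have "\<dots> \<le> ?C r * M * real CARD('k) ^ (d * Suc L) + M * real CARD('k) ^ (d * Suc L)"
        unfolding sumcells_add
      proof (rule add_mono)
        show "sumcells d (Suc L) c k (\<lambda>Q. of_bool (\<not> marked cmp low tiny ?S Q)) \<le> ?C r * M * real CARD('k) ^ (d * Suc L)"
        proof (rule outer_IH)
          show "finite (rk ` ?S)" by (rule finite_subset[OF _ prems(2)]) auto
        qed (use prems(1) cardS Suc.prems in auto)
        show "sumcells d (Suc L) c k (\<lambda>Q. of_bool (tiny x Q)) \<le> M * real CARD('k) ^ (d * Suc L)"
          using good[of x c k "Suc L"] prems(1) x(1) Suc.prems by blast
      qed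
      also have "\<dots> = ?C (Suc r) * M * real CARD('k) ^ (d * L)"
        by (simp add: power_add algebra_simps)
      finally show ?thesis .
    qed
    then have "sumcells d (Suc L) c k (\<lambda>Q. of_bool (\<not> marked cmp low tiny S Q))
        \<le> (\<Sum>v\<in>(digs d :: (nat \<Rightarrow> 'k) set). ?C (Suc r) * M * real CARD('k) ^ (d * L))"
      unfolding sumcells.simps by (rule sum_mono)
    also have "\<dots> = ?C (Suc r) * M * real CARD('k) ^ (d * Suc L)"
      by (simp add: card_digs power_add algebra_simps)
    finally show ?case .
  qed
qed

subsection \<open>Minors and spans\<close>

definition minor_mat :: "(nat \<Rightarrow> 'a) list \<Rightarrow> nat list \<Rightarrow> 'a mat" where
  "minor_mat vs I = Matrix.mat (length vs) (length vs) (\<lambda>(r, c). (vs ! r) (I ! c))"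

text \<open>The Pluecker coordinates of the tuple \<open>vs\<close>. Index lists are neither ordered
  nor free of repetitions, so a single index can be replaced without keeping track of signs.\<close>

definition minor :: "(nat \<Rightarrow> 'a::comm_ring_1) list \<Rightarrow> nat list \<Rightarrow> 'a" where
  "minor vs I = Determinant.det (minor_mat vs I)"

definition drop_nth :: "nat \<Rightarrow> 'b list \<Rightarrow> 'b list" where
  "drop_nth c I = take c I @ drop (Suc c) I"

lemma minor_mat_carrier [simp]: "minor_mat vs I \<in> carrier_mat (length vs) (length vs)"
  by (simp add: minor_mat_def)

lemma length_drop_nth: "c < length I \<Longrightarrow> length (drop_nth c I) = length I - 1"
  by (simp add: drop_nth_def)

lemma nth_drop_nth: "c < length I \<Longrightarrow> j < length I - 1 \<Longrightarrow> drop_nth c I ! j = I ! (if j < c then j else Suc j)"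
  by (auto simp: drop_nth_def nth_append)

lemma set_drop_nth_subset: "set (drop_nth c I) \<subseteq> set I"
  unfolding drop_nth_def using set_take_subset set_drop_subset by force

lemma set_drop_nth:
  assumes "distinct I" "c < length I"
  shows "distinct (drop_nth c I)" "set I = insert (I ! c) (set (drop_nth c I))" "I ! c \<notin> set (drop_nth c I)"
proof -
  have I: "I = take c I @ I ! c # drop (Suc c) I" using assms(2) by (rule id_take_nth_drop)
  have "distinct (take c I @ I ! c # drop (Suc c) I)" using assms(1) I by simp
  then show "distinct (drop_nth c I)" "I ! c \<notin> set (drop_nth c I)" by (auto simp: drop_nth_def)
  show "set I = insert (I ! c) (set (drop_nth c I))"
    by (subst I) (simp add: drop_nth_def)
qed

lemma minor_Nil [simp]: "minor [] I = 1"
  by (simp add: minor_def minor_mat_def det_dim_zero)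

lemma minor_Cons:
  assumes "length I = Suc (length vs)"
  shows "minor (v # vs) I = (\<Sum>c<Suc (length vs). v (I ! c) * ((-1) ^ c * minor vs (drop_nth c I)))"
proof -
  have "mat_delete (minor_mat (v # vs) I) 0 c = minor_mat vs (drop_nth c I)" if "c < Suc (length vs)" for c
    using that assms by (intro eq_matI) (auto simp: mat_delete_def minor_mat_def nth_drop_nth)
  then show ?thesis
    unfolding minor_def by (subst laplace_expansion_row[of _ "Suc (length vs)" 0]) (auto simp: minor_mat_def cofactor_def)
qed

text \<open>The cofactors of column \<open>p\<close> do not see that column, so they may be taken
  from any matrix that agrees elsewhere. This keeps them fixed while one index varies.\<close>

lemma minor_column:
  assumes p: "p < length vs" and len: "length vs' = length vs"
    and eq: "\<And>r c. r < length vs \<Longrightarrow> c < length vs \<Longrightarrow> c \<noteq> p \<Longrightarrow> (vs' ! r) (J ! c) = (vs ! r) (I ! c)"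
  shows "minor vs' J = (\<Sum>r<length vs. (vs' ! r) (J ! p) * cofactor (minor_mat vs I) r p)"
proof -
  have "mat_delete (minor_mat vs' J) r p = mat_delete (minor_mat vs I) r p" if "r < length vs" for r
    using that assms by (intro eq_matI) (auto simp: mat_delete_def minor_mat_def)
  then have "cofactor (minor_mat vs' J) r p = cofactor (minor_mat vs I) r p" if "r < length vs" for r
    using that by (simp add: cofactor_def)
  then show ?thesis
    unfolding minor_def using p len
    by (subst laplace_expansion_column[of _ "length vs" p]) (auto simp: minor_mat_def)
qed

lemma minor_not_distinct:
  assumes "\<not> distinct I" "length I = length vs"
  shows "minor vs I = 0"
proof -
  obtain i j where "i < length vs" "j < length vs" "i \<noteq> j" "I ! i = I ! j"
    using assms by (auto simp: distinct_conv_nth)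
  then show ?thesis
    unfolding minor_def
    by (intro det_identical_columns[OF minor_mat_carrier, of i j]) (auto simp: minor_mat_def intro!: eq_vecI)
qed

lemma minor_repeated_row:
  assumes "r < length vs"
  shows "minor ((vs ! r) # vs) I = 0"
  unfolding minor_def
  by (intro det_identical_rows[OF minor_mat_carrier, of 0 "Suc r"])
     (use assms in \<open>auto simp: minor_mat_def intro!: eq_vecI\<close>)

lemma minor_linear_combination:
  assumes b: "length b' = length b"
    and comb: "\<And>r i. r < length b \<Longrightarrow> i < m \<Longrightarrow> (b' ! r) i = (\<Sum>s<length b. l r s * (b ! s) i)"
  shows "\<exists>\<mu>. \<forall>I. length I = length b \<longrightarrow> set I \<subseteq> {..<m} \<longrightarrow> minor b' I = \<mu> * minor b I"
proof (intro exI allI impI)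
  fix I assume I: "length I = length b" "set I \<subseteq> {..<m}"
  let ?k = "length b"
  let ?C = "Matrix.mat ?k ?k (\<lambda>(r, s). l r s)"
  have "minor_mat b' I = ?C * minor_mat b I"
  proof (rule eq_matI)
    fix r c assume "r < dim_row (?C * minor_mat b I)" "c < dim_col (?C * minor_mat b I)"
    then have rc: "r < ?k" "c < ?k" by (auto simp: minor_mat_def)
    then have "I ! c < m" using I by (metis lessThan_iff nth_mem subset_iff)
    then show "index_mat (minor_mat b' I) (r, c) = index_mat (?C * minor_mat b I) (r, c)"
      using rc b comb[of r "I ! c"] by (simp add: minor_mat_def scalar_prod_def atLeast0LessThan)
  qed (use b in \<open>auto simp: minor_mat_def\<close>)
  then show "minor b' I = Determinant.det ?C * minor b I"
    unfolding minor_def by (subst det_mult[of _ ?k, symmetric]) auto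
qed

text \<open>Linear independence, expressed as a nonzero wedge product.\<close>

definition indep_minor :: "nat \<Rightarrow> (nat \<Rightarrow> 'a::comm_ring_1) list \<Rightarrow> bool" where
  "indep_minor m b \<longleftrightarrow> (\<exists>I. length I = length b \<and> set I \<subseteq> {..<m} \<and> minor b I \<noteq> 0)"

text \<open>The vectors \<open>v\<close> with \<open>v \<and> b\<^sub>1 \<and> \<dots> \<and> b\<^sub>k = 0\<close>: for independent \<open>b\<close>, its linear span.\<close>

definition wedge_span :: "nat \<Rightarrow> (nat \<Rightarrow> 'a::comm_ring_1) list \<Rightarrow> (nat \<Rightarrow> 'a) set" where
  "wedge_span m b = {v. \<forall>I. length I = Suc (length b) \<longrightarrow> set I \<subseteq> {..<m} \<longrightarrow> minor (v # b) I = 0}"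

lemma indep_minor_Nil: "indep_minor m []"
  by (simp add: indep_minor_def)

lemma indep_minor_ConsI: "v \<notin> wedge_span m b \<Longrightarrow> indep_minor m (v # b)"
  by (auto simp: wedge_span_def indep_minor_def)

lemma nth_mem_wedge_span: "r < length b \<Longrightarrow> b ! r \<in> wedge_span m b"
  by (simp add: wedge_span_def minor_repeated_row)

lemma wedge_span_combination:
  assumes v: "\<And>i. i < m \<Longrightarrow> v i = (\<Sum>r<N. l r * w r i)" and w: "\<And>r. r < N \<Longrightarrow> w r \<in> wedge_span m b"
  shows "v \<in> wedge_span m b"
  unfolding wedge_span_def mem_Collect_eq
proof (intro allI impI)
  fix I assume I: "length I = Suc (length b)" "set I \<subseteq> {..<m}"
  have "minor (v # b) I = (\<Sum>c<Suc (length b). \<Sum>r<N. l r * (w r (I ! c) * ((-1) ^ c * minor b (drop_nth c I))))"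
    unfolding minor_Cons[OF I(1)]
  proof (intro sum.cong refl)
    fix c assume "c \<in> {..<Suc (length b)}"
    then have "I ! c < m" using I by (metis lessThan_iff nth_mem subset_iff)
    then show "v (I ! c) * ((-1) ^ c * minor b (drop_nth c I)) =
        (\<Sum>r<N. l r * (w r (I ! c) * ((-1) ^ c * minor b (drop_nth c I))))"
      by (simp add: v sum_distrib_right mult.assoc)
  qed
  also have "\<dots> = (\<Sum>r<N. l r * minor (w r # b) I)"
    unfolding minor_Cons[OF I(1)] sum_distrib_left by (rule sum.swap)
  also have "\<dots> = 0" using w I by (intro sum.neutral) (auto simp: wedge_span_def)
  finally show "minor (v # b) I = 0" .
qed

text \<open>Cramer's rule. Fix a nonzero minor of \<open>b\<close> on \<open>I\<close>, let
  \<open>i\<close> vary, and expand the vanishing minor of \<open>v # b\<close> on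
  \<open>i # I\<close> along its first column: the cofactors do not depend on \<open>i\<close>, and
  that of \<open>v\<close> is the fixed minor.\<close>

lemma wedge_span_cramer:
  fixes b :: "(nat \<Rightarrow> 'a::field) list"
  assumes "indep_minor m b" "v \<in> wedge_span m b"
  obtains l where "\<And>i. i < m \<Longrightarrow> v i = (\<Sum>r<length b. l r * (b ! r) i)"
proof -
  obtain I where I: "length I = length b" "set I \<subseteq> {..<m}" "minor b I \<noteq> 0"
    using assms(1) by (auto simp: indep_minor_def)
  \<comment> \<open>The index 0 in front of \<open>I\<close> is a placeholder: cofactors of the
    first column ignore its entries.\<close>
  define C where "C r = cofactor (minor_mat (v # b) (0 # I)) r 0" for r
  have "mat_delete (minor_mat (v # b) (0 # I)) 0 0 = minor_mat b I"
    by (intro eq_matI) (auto simp: mat_delete_def minor_mat_def)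
  then have C0: "C 0 = minor b I" by (simp add: C_def cofactor_def minor_def)
  have *: "v i = (\<Sum>r<length b. (- C (Suc r) / C 0) * (b ! r) i)" if "i < m" for i
  proof -
    have "0 = minor (v # b) (i # I)"
      using assms(2) I that by (auto simp: wedge_span_def)
    also have "\<dots> = (\<Sum>r<length (v # b). ((v # b) ! r) i * C r)"
      unfolding C_def by (subst minor_column[of 0 "v # b" "v # b" "i # I" "0 # I"]) auto
    also have "\<dots> = v i * C 0 + (\<Sum>r<length b. (b ! r) i * C (Suc r))"
      by (simp add: sum.lessThan_Suc_shift del: sum.lessThan_Suc)
    finally have "v i * C 0 = - (\<Sum>r<length b. (b ! r) i * C (Suc r))"
      by (simp add: eq_neg_iff_add_eq_0)
    moreover have nz: "C 0 \<noteq> 0" using C0 I(3) by simp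
    ultimately have "v i = - (\<Sum>r<length b. (b ! r) i * C (Suc r)) / C 0"
      by (simp only: nonzero_eq_divide_eq[OF nz])
    then show ?thesis by (simp add: sum_divide_distrib sum_negf mult.commute)
  qed
  show ?thesis by (rule that[OF *])
qed

lemma wedge_span_Cons_subset:
  fixes b :: "(nat \<Rightarrow> 'a::field) list"
  assumes "indep_minor m b" "\<And>r. r < length b \<Longrightarrow> b ! r \<in> wedge_span m b'"
  shows "wedge_span m b \<subseteq> wedge_span m b'"
proof
  fix w assume "w \<in> wedge_span m b"
  then obtain l where "\<And>i. i < m \<Longrightarrow> w i = (\<Sum>r<length b. l r * (b ! r) i)"
    using wedge_span_cramer[OF assms(1)] by blast
  then show "w \<in> wedge_span m b'"
    using assms(2) by (rule wedge_span_combination)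
qed

lemma minor_proportional:
  fixes b :: "(nat \<Rightarrow> 'a::field) list"
  assumes b: "indep_minor m b" and len: "length b' = length b"
    and mem: "\<And>r. r < length b \<Longrightarrow> b' ! r \<in> wedge_span m b"
  shows "\<exists>\<mu>. \<forall>I. length I = length b \<longrightarrow> set I \<subseteq> {..<m} \<longrightarrow> minor b' I = \<mu> * minor b I"
proof -
  have "\<exists>l. \<forall>i<m. (b' ! r) i = (\<Sum>s<length b. l s * (b ! s) i)" if "r < length b" for r
    using wedge_span_cramer[OF b mem[OF that]] by metis
  then obtain l where "\<And>r i. r < length b \<Longrightarrow> i < m \<Longrightarrow> (b' ! r) i = (\<Sum>s<length b. l r s * (b ! s) i)"
    by metis
  then show ?thesis by (rule minor_linear_combination[OF len])
qed

lemma wedge_span_proportional: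
  fixes b :: "(nat \<Rightarrow> 'a::field) list"
  assumes len: "length b' = length b"
    and prp: "\<And>I. length I = length b \<Longrightarrow> set I \<subseteq> {..<m} \<Longrightarrow> minor b' I = \<mu> * minor b I"
  shows "wedge_span m b \<subseteq> wedge_span m b'"
proof
  fix v assume v: "v \<in> wedge_span m b"
  have "minor (v # b') I = 0" if I: "length I = Suc (length b)" "set I \<subseteq> {..<m}" for I
  proof -
    have "minor (v # b') I = (\<Sum>c<Suc (length b). \<mu> * (v (I ! c) * ((-1) ^ c * minor b (drop_nth c I))))"
      unfolding minor_Cons[of I b', unfolded len, OF I(1)]
    proof (intro sum.cong refl)
      fix c assume "c \<in> {..<Suc (length b)}"
      then have "minor b' (drop_nth c I) = \<mu> * minor b (drop_nth c I)"
        using I set_drop_nth_subset[of c I] by (intro prp) (auto simp: length_drop_nth)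
      then show "v (I ! c) * ((-1) ^ c * minor b' (drop_nth c I)) = \<mu> * (v (I ! c) * ((-1) ^ c * minor b (drop_nth c I)))"
        by simp
    qed
    also have "\<dots> = \<mu> * minor (v # b) I" unfolding minor_Cons[OF I(1)] sum_distrib_left ..
    also have "\<dots> = 0" using v I by (simp add: wedge_span_def)
    finally show ?thesis .
  qed
  then show "v \<in> wedge_span m b'" by (simp add: wedge_span_def len)
qed

text \<open>For \<phi> consisting of 1 and the components of \<open>f\<close>, and \<open>v\<close>
  of a constant term followed by a coefficient vector, entry 0 becomes the inhomogeneous linear form
  in \<open>PhiF\<close>, and the coefficient vector is kept. The diagonal weights are applied
  separately.\<close>

definition unip :: "nat \<Rightarrow> (nat \<Rightarrow> 'a::comm_ring_1) \<Rightarrow> (nat \<Rightarrow> 'a) \<Rightarrow> nat \<Rightarrow> 'a" where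
  "unip m \<phi> v = (\<lambda>i. if i = 0 then \<Sum>j<m. \<phi> j * v j else v i)"

text \<open>The map alters only column 0, which becomes the combination of all columns with
  coefficients \<phi>. Hence the minor is linear in \<phi>, with minors of \<open>b\<close> as
  coefficients.\<close>

lemma minor_unip_0:
  assumes I: "length I = length b" "distinct I" "p < length b" "I ! p = 0"
  shows "minor (map (unip m \<phi>) b) I = (\<Sum>j<m. \<phi> j * minor b (I[p := j]))"
proof -
  let ?C = "\<lambda>r. cofactor (minor_mat b I) r p"
  have nz: "c = p" if "I ! c = 0" "c < length b" for c
    using I that by (metis nth_eq_iff_index_eq)
  have "minor (map (unip m \<phi>) b) I = (\<Sum>r<length b. (\<Sum>j<m. \<phi> j * (b ! r) j) * ?C r)"
    by (subst minor_column[of p b _ I I]) (use I in \<open>auto simp: unip_def dest: nz\<close>)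
  also have "\<dots> = (\<Sum>j<m. \<phi> j * (\<Sum>r<length b. (b ! r) j * ?C r))"
    unfolding sum_distrib_right sum_distrib_left mult.assoc by (rule sum.swap)
  also have "\<dots> = (\<Sum>j<m. \<phi> j * minor b (I[p := j]))"
  proof (intro sum.cong refl arg_cong2[where f = "(*)"])
    fix j
    show "(\<Sum>r<length b. (b ! r) j * ?C r) = minor b (I[p := j])"
      using I by (subst minor_column[of p b b "I[p := j]" I]) auto
  qed
  finally show ?thesis .
qed

lemma minor_unip_not_0:
  assumes "length I = length b" "0 \<notin> set I"
  shows "minor (map (unip m \<phi>) b) I = minor b I"
proof -
  have nz: False if "I ! c = 0" "c < length b" for c using assms that by (metis nth_mem)
  have "minor_mat (map (unip m \<phi>) b) I = minor_mat b I"
    by (intro eq_matI) (auto simp: minor_mat_def unip_def dest: nz)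
  then show ?thesis by (simp add: minor_def)
qed

text \<open>Each transformed minor is a fixed linear expression in the original minors.\<close>

lemma minor_unip_proportional:
  assumes len: "length b' = length b" and I: "length I = length b" "distinct I" "set I \<subseteq> {..<m}"
    and prp: "\<And>I. length I = length b \<Longrightarrow> set I \<subseteq> {..<m} \<Longrightarrow> minor b' I = \<mu> * minor b I"
  shows "minor (map (unip m \<phi>) b') I = \<mu> * minor (map (unip m \<phi>) b) I"
proof (cases "0 \<in> set I")
  case True
  then obtain p where p: "p < length b" "I ! p = 0" using I by (metis in_set_conv_nth)
  have "minor b' (I[p := j]) = \<mu> * minor b (I[p := j])" if "j < m" for j
    using I that set_update_subset_insert[of I p j] by (intro prp) auto
  then show ?thesis
    using p I len by (simp add: minor_unip_0 sum_distrib_left mult.left_commute)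
next
  case False
  then show ?thesis using I len prp by (simp add: minor_unip_not_0)
qed

lemma minor_in_LambdaF:
  assumes "\<And>v i. v \<in> set b \<Longrightarrow> i < m \<Longrightarrow> v i \<in> LambdaF" "length I = length b" "set I \<subseteq> {..<m}"
  shows "minor b I \<in> LambdaF"
  using assms
proof (induction b arbitrary: I)
  case (Cons v b)
  show ?case
    unfolding minor_Cons[of I b v, OF Cons.prems(2)[simplified]]
  proof (intro LambdaF_sum LambdaF_mult)
    fix c assume c: "c \<in> {..<Suc (length b)}"
    then have "I ! c < m" using Cons.prems by (metis length_Cons lessThan_iff nth_mem subset_iff)
    then show "v (I ! c) \<in> LambdaF" using Cons.prems by simp
    show "(- 1) ^ c \<in> LambdaF" by (induction c) (auto intro: LambdaF_uminus)
    show "minor b (drop_nth c I) \<in> LambdaF"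
      using Cons.prems c set_drop_nth_subset[of c I] by (intro Cons.IH) (auto simp: length_drop_nth)
  qed
qed simp

subsection \<open>Covolumes\<close>

text \<open>Distinctness makes the product over \<open>set I\<close> the correct weight of the
  coordinate \<open>I\<close>; lists with repetitions have vanishing minors.\<close>

definition minor_idx :: "nat \<Rightarrow> nat \<Rightarrow> nat list set" where
  "minor_idx m k = {I. length I = k \<and> distinct I \<and> set I \<subseteq> {..<m}}"

lemma finite_minor_idx [simp]: "finite (minor_idx m k)"
proof (rule finite_subset)
  show "minor_idx m k \<subseteq> {I. set I \<subseteq> {..<m} \<and> length I = k}" by (auto simp: minor_idx_def)
qed (rule finite_lists_length_eq, simp)

lemma minor_idx_length_le: "I \<in> minor_idx m k \<Longrightarrow> k \<le> m"
  unfolding minor_idx_def using card_mono[of "{..<m}" "set I"] by (auto simp: distinct_card)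

definition wt_norm :: "nat \<Rightarrow> (nat \<Rightarrow> real) \<Rightarrow> (nat \<Rightarrow> 'k::{finite,field} fls) \<Rightarrow> real" where
  "wt_norm m wt v = Max (insert 0 ((\<lambda>i. wt i * absF (v i)) ` {..<m}))"

text \<open>The sup norm of the wedge product after a diagonal matrix with entries
  \<open>wt\<close>, which multiplies the coordinate \<open>I\<close> by the product of its
  weights.\<close>

definition covol :: "nat \<Rightarrow> (nat \<Rightarrow> real) \<Rightarrow> (nat \<Rightarrow> 'k::{finite,field} fls) list \<Rightarrow> real" where
  "covol m wt b = Max (insert 0 ((\<lambda>I. (\<Prod>i\<in>set I. wt i) * absF (minor b I)) ` minor_idx m (length b)))"

lemma wt_norm_le_iff: "0 \<le> r \<Longrightarrow> wt_norm m wt v \<le> r \<longleftrightarrow> (\<forall>i<m. wt i * absF (v i) \<le> r)"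
  unfolding wt_norm_def by (subst Max_le_iff) auto

lemma covol_le_iff:
  "0 \<le> r \<Longrightarrow> covol m wt b \<le> r \<longleftrightarrow> (\<forall>I\<in>minor_idx m (length b). (\<Prod>i\<in>set I. wt i) * absF (minor b I) \<le> r)"
  unfolding covol_def by (subst Max_le_iff) auto

lemma covol_ge: "I \<in> minor_idx m (length b) \<Longrightarrow> (\<Prod>i\<in>set I. wt i) * absF (minor b I) \<le> covol m wt b"
  unfolding covol_def by (intro Max_ge) auto

lemma covol_nonneg: "0 \<le> covol m wt b"
  unfolding covol_def by (intro Max_ge) auto

lemma wt_norm_nonneg: "0 \<le> wt_norm m wt v"
  unfolding wt_norm_def by (intro Max_ge) auto

lemma covol_Nil [simp]: "covol m wt [] = 1"
proof -
  have "minor_idx m 0 = {[]}" by (auto simp: minor_idx_def)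
  then show ?thesis by (simp add: covol_def)
qed

text \<open>Hadamard's inequality, by expansion along the first row; the ultrametric inequality
  leaves no constant.\<close>

lemma covol_Cons_le:
  assumes wt: "\<And>i. 0 < wt i"
  shows "covol m wt (v # b) \<le> covol m wt b * wt_norm m wt v"
proof -
  have "(\<Prod>i\<in>set I. wt i) * absF (minor (v # b) I) \<le> covol m wt b * wt_norm m wt v"
    if I: "I \<in> minor_idx m (length (v # b))" for I
  proof -
    have I': "length I = Suc (length b)" "distinct I" "set I \<subseteq> {..<m}" using I by (auto simp: minor_idx_def)
    let ?w = "\<Prod>i\<in>set I. wt i"
    have w0: "0 < ?w" using wt by (intro prod_pos) auto
    have "absF (minor (v # b) I) \<le> covol m wt b * wt_norm m wt v / ?w"
      unfolding minor_Cons[OF I'(1)]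
    proof (rule absF_sum_le)
      fix c assume c: "c \<in> {..<Suc (length b)}"
      then have cI: "c < length I" using I' by simp
      have Im: "I ! c < m" using I' cI by (metis lessThan_iff nth_mem subset_iff)
      note dn = set_drop_nth[OF I'(2) cI]
      have mem: "drop_nth c I \<in> minor_idx m (length b)"
        using dn I' cI by (auto simp: minor_idx_def length_drop_nth)
      have "?w = wt (I ! c) * (\<Prod>i\<in>set (drop_nth c I). wt i)"
        using dn by simp
      then have "?w * absF (v (I ! c) * ((-1) ^ c * minor b (drop_nth c I)))
          = ((\<Prod>i\<in>set (drop_nth c I). wt i) * absF (minor b (drop_nth c I))) * (wt (I ! c) * absF (v (I ! c)))"
        by (simp add: absF_mult absF_power)
      also have "\<dots> \<le> covol m wt b * wt_norm m wt v"
      proof (rule mult_mono)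
        show "wt (I ! c) * absF (v (I ! c)) \<le> wt_norm m wt v"
          using wt_norm_le_iff[OF wt_norm_nonneg, of m wt v m wt v] Im by simp
        show "0 \<le> wt (I ! c) * absF (v (I ! c))" using wt[of "I ! c"] by simp
      qed (auto intro: covol_ge[OF mem] covol_nonneg)
      finally show "absF (v (I ! c) * ((-1) ^ c * minor b (drop_nth c I))) \<le> covol m wt b * wt_norm m wt v / ?w"
        using w0 by (simp add: field_simps)
    qed (use w0 in \<open>simp add: covol_nonneg wt_norm_nonneg\<close>)
    then show ?thesis using w0 by (simp add: field_simps)
  qed
  then show ?thesis
    by (subst covol_le_iff) (auto intro: mult_nonneg_nonneg covol_nonneg wt_norm_nonneg)
qed

section \<open>Integral tuples and primitive submodules\<close>

definition Lambda_vec :: "nat \<Rightarrow> (nat \<Rightarrow> 'k::{finite,field} fls) set" where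
  "Lambda_vec m = {v. \<forall>i<m. v i \<in> LambdaF}"

text \<open>For nonzero \<open>\<mu>\<close> the two tuples have the same wedge span, and
  \<open>\<mu>\<close> is the ratio of their wedge products.\<close>

definition proportional :: "nat \<Rightarrow> 'k::{finite,field} fls \<Rightarrow> (nat \<Rightarrow> 'k fls) list \<Rightarrow> (nat \<Rightarrow> 'k fls) list \<Rightarrow> bool" where
  "proportional m \<mu> b' b \<longleftrightarrow> length b' = length b \<and>
     (\<forall>I. length I = length b \<longrightarrow> set I \<subseteq> {..<m} \<longrightarrow> minor b' I = \<mu> * minor b I)"

text \<open>Tuples standing for primitive submodules of \<open>\<Lambda>\<close>-rank \<open>length b\<close>: among the integral tuples
  with the same span, the wedge product of \<open>b\<close> is smallest.\<close>

definition primitive :: "nat \<Rightarrow> (nat \<Rightarrow> 'k::{finite,field} fls) list set" where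
  "primitive m = {b. b \<noteq> [] \<and> set b \<subseteq> Lambda_vec m \<and> indep_minor m b \<and>
     (\<forall>b' \<mu>. set b' \<subseteq> Lambda_vec m \<longrightarrow> proportional m \<mu> b' b \<longrightarrow> \<mu> \<noteq> 0 \<longrightarrow> 1 \<le> absF \<mu>)}"

lemma proportional_trans:
  "proportional m \<mu> b'' b' \<Longrightarrow> proportional m \<nu> b' b \<Longrightarrow> proportional m (\<mu> * \<nu>) b'' b"
  by (simp add: proportional_def)

lemma proportional_sym:
  assumes "proportional m \<mu> b' b" "\<mu> \<noteq> 0"
  shows "proportional m (inverse \<mu>) b b'"
  unfolding proportional_def
proof (intro conjI allI impI)
  fix I assume "length I = length b'" "set I \<subseteq> {..<m}"
  then have "minor b' I = \<mu> * minor b I" using assms by (simp add: proportional_def)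
  then have "inverse \<mu> * minor b' I = (inverse \<mu> * \<mu>) * minor b I" by (simp only: mult.assoc)
  then show "minor b I = inverse \<mu> * minor b' I" using assms(2) by simp
qed (use assms in \<open>simp add: proportional_def\<close>)

lemma proportional_wedge_span:
  assumes "proportional m \<mu> b' b" "\<mu> \<noteq> 0"
  shows "wedge_span m b' = wedge_span m b"
proof (rule antisym)
  show "wedge_span m b \<subseteq> wedge_span m b'"
    using assms by (intro wedge_span_proportional[of b' b m \<mu>]) (auto simp: proportional_def)
  show "wedge_span m b' \<subseteq> wedge_span m b"
    using proportional_sym[OF assms]
    by (intro wedge_span_proportional[of b b' m "inverse \<mu>"]) (auto simp: proportional_def)
qed

lemma proportional_covol_le:
  assumes pr: "proportional m \<mu> b' b" and \<mu>: "1 \<le> absF \<mu>" and wt: "\<And>i. 0 < wt i"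
  shows "covol m wt (map (unip m \<phi>) b) \<le> covol m wt (map (unip m \<phi>) b')"
proof (subst covol_le_iff, intro covol_nonneg, intro ballI)
  have len: "length b' = length b" using pr by (simp add: proportional_def)
  fix I assume "I \<in> minor_idx m (length (map (unip m \<phi>) b))"
  then have I: "I \<in> minor_idx m (length b)" by simp
  have eq: "minor (map (unip m \<phi>) b') I = \<mu> * minor (map (unip m \<phi>) b) I"
    using pr I by (intro minor_unip_proportional) (auto simp: proportional_def minor_idx_def)
  have "(\<Prod>i\<in>set I. wt i) * absF (minor (map (unip m \<phi>) b) I) * 1 \<le>
      (\<Prod>i\<in>set I. wt i) * absF (minor (map (unip m \<phi>) b) I) * absF \<mu>"
    using wt \<mu> by (intro mult_left_mono mult_nonneg_nonneg prod_nonneg ballI) (auto intro: less_imp_le)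
  also have "\<dots> = (\<Prod>i\<in>set I. wt i) * absF (minor (map (unip m \<phi>) b') I)"
    by (simp add: eq absF_mult)
  also have "\<dots> \<le> covol m wt (map (unip m \<phi>) b')" using I len by (intro covol_ge) simp
  finally show "(\<Prod>i\<in>set I. wt i) * absF (minor (map (unip m \<phi>) b) I) \<le> covol m wt (map (unip m \<phi>) b')"
    by simp
qed

text \<open>Fix a minor that does not vanish on \<open>b\<close>. On integral tuples with the same
  span it is a nonzero polynomial, so its degree in X is a natural number, and a tuple minimising it
  is primitive.\<close>

lemma ex_primitive:
  fixes b :: "(nat \<Rightarrow> 'k::{finite,field} fls) list"
  assumes b: "b \<noteq> []" "set b \<subseteq> Lambda_vec m" "indep_minor m b"
  shows "\<exists>bs\<in>primitive m. \<exists>\<mu>. proportional m \<mu> b bs \<and> 1 \<le> absF \<mu>"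
proof -
  obtain I where I: "length I = length b" "set I \<subseteq> {..<m}" "minor b I \<noteq> 0"
    using b(3) by (auto simp: indep_minor_def)
  define X where "X = (\<lambda>b'. set b' \<subseteq> Lambda_vec m \<and> (\<exists>\<mu>. \<mu> \<noteq> 0 \<and> proportional m \<mu> b' b))"
  define g where "g b' = nat (- fls_subdegree (minor b' I))" for b' :: "(nat \<Rightarrow> 'k fls) list"
  have "X b" using b by (auto simp: X_def proportional_def intro!: exI[of _ 1])
  then obtain bs where bs: "X bs" "\<And>b'. X b' \<Longrightarrow> g bs \<le> g b'"
    using exists_least_iff[of "\<lambda>n. \<exists>b'. X b' \<and> g b' = n"] by (metis not_le)
  then obtain \<mu> where \<mu>: "\<mu> \<noteq> 0" "proportional m \<mu> bs b" by (auto simp: X_def)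
  have lens: "length bs = length b" using \<mu> by (simp add: proportional_def)
  have bsI: "minor bs I \<noteq> 0" using \<mu> I by (simp add: proportional_def)
  have deg: "fls_subdegree (minor b' I) \<le> 0" if "set b' \<subseteq> Lambda_vec m" "length b' = length b" "minor b' I \<noteq> 0" for b'
  proof -
    have "minor b' I \<in> LambdaF"
      using that I by (intro minor_in_LambdaF[of _ m]) (auto simp: Lambda_vec_def)
    then show ?thesis
      using nth_fls_subdegree_nonzero[OF that(3)] unfolding LambdaF_def mem_Collect_eq by (meson not_le)
  qed
  have min: "1 \<le> absF \<nu>" if "set b' \<subseteq> Lambda_vec m" "proportional m \<nu> b' bs" "\<nu> \<noteq> 0" for b' \<nu>
  proof -
    have "\<nu> * \<mu> \<noteq> 0" using that(3) \<mu>(1) by simp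
    then have "X b'" using that(1) proportional_trans[OF that(2) \<mu>(2)] unfolding X_def by blast
    then have "g bs \<le> g b'" by (rule bs(2))
    moreover have eq: "minor b' I = \<nu> * minor bs I" using that(2) I lens by (simp add: proportional_def)
    moreover have "fls_subdegree (minor b' I) \<le> 0"
      using that eq bsI lens by (intro deg) (auto simp: proportional_def)
    moreover have "fls_subdegree (minor bs I) \<le> 0"
      using bs(1) bsI lens by (intro deg) (auto simp: X_def)
    ultimately have "fls_subdegree \<nu> \<le> 0"
      using that(3) bsI by (simp add: g_def)
    then show ?thesis using that(3) by (simp add: absF_powi)
  qed
  have "bs \<in> primitive m"
    using bs(1) bsI min b(1) lens I by (auto simp: primitive_def X_def indep_minor_def)
  moreover have pr: "proportional m (inverse \<mu>) b bs" by (rule proportional_sym[OF \<mu>(2,1)])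
  moreover have "1 \<le> absF (inverse \<mu>)" using min[OF b(2) pr] \<mu>(1) by simp
  ultimately show ?thesis by blast
qed

text \<open>Comparing lengths makes the inclusion strict: different tuples with the same span count
  as incomparable, and comparable ones differ in rank.\<close>

definition span_cmp :: "nat \<Rightarrow> (nat \<Rightarrow> 'k::{finite,field} fls) list \<Rightarrow> (nat \<Rightarrow> 'k fls) list \<Rightarrow> bool" where
  "span_cmp m b b' \<longleftrightarrow> (length b < length b' \<and> wedge_span m b \<subseteq> wedge_span m b') \<or>
     (length b' < length b \<and> wedge_span m b' \<subseteq> wedge_span m b)"

lemma wedge_span_Nil_subset: "wedge_span m [] \<subseteq> wedge_span m (b :: (nat \<Rightarrow> 'k::{finite,field} fls) list)"
  by (rule wedge_span_Cons_subset) (auto simp: indep_minor_Nil)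

lemma wedge_span_Cons_mono:
  fixes b :: "(nat \<Rightarrow> 'k::{finite,field} fls) list"
  assumes "indep_minor m b"
  shows "wedge_span m b \<subseteq> wedge_span m (v # b)"
proof (rule wedge_span_Cons_subset[OF assms])
  show "b ! r \<in> wedge_span m (v # b)" if "r < length b" for r
    using nth_mem_wedge_span[of "Suc r" "v # b" m] that by simp
qed

text \<open>Insert \<open>v\<close> into the flag: let \<open>D\<close> be the largest member whose
  span misses \<open>v\<close>, and \<open>E = v # D\<close>. Somewhere on \<open>Q\<close> the
  covolume of \<open>E\<close> exceeds \<epsilon>, either because a member of the flag has the same
  span, or because the primitive tuple of \<open>E\<close> is comparable with the whole flag and
  thus not low. The covolume of \<open>D\<close> is at most 1, so Hadamard's inequality passes the
  bound on to \<open>v\<close>.\<close>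

lemma marked_imp_no_short_vector:
  fixes \<phi> :: "nat \<Rightarrow> 's \<Rightarrow> 'k::{finite,field} fls" and wt :: "nat \<Rightarrow> real" and Q :: "'s set" and m :: nat
  defines "\<psi> \<equiv> \<lambda>b x. covol m wt (map (unip m (\<lambda>j. \<phi> j x)) b)"
  assumes wt: "\<And>i. 0 < wt i" and \<epsilon>: "0 < \<epsilon>" "\<epsilon> < 1"
    and marked: "marked (span_cmp m) (\<lambda>b Q. \<forall>x\<in>Q. \<psi> b x < 1) (\<lambda>b Q. \<forall>x\<in>Q. \<psi> b x \<le> \<epsilon>) (primitive m) Q"
    and v: "v \<in> Lambda_vec m" "i < m" "v i \<noteq> 0"
  shows "\<exists>y\<in>Q. \<epsilon> < wt_norm m wt (unip m (\<lambda>j. \<phi> j y) v)"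
proof -
  obtain T where T: "finite T" "T \<subseteq> primitive m" "\<forall>x\<in>T. \<forall>y\<in>T. x \<noteq> y \<longrightarrow> span_cmp m x y"
    "\<forall>b\<in>T. (\<forall>x\<in>Q. \<psi> b x < 1) \<and> \<not> (\<forall>x\<in>Q. \<psi> b x \<le> \<epsilon>)"
    "\<forall>b\<in>primitive m. (\<forall>b'\<in>T. span_cmp m b b') \<longrightarrow> \<not> (\<forall>x\<in>Q. \<psi> b x < 1)"
    using marked unfolding marked_def by (elim exE conjE) (rule that; assumption)
  have prim: "b \<noteq> []" "set b \<subseteq> Lambda_vec m" "indep_minor m b" if "b \<in> T" for b
    using T(2) that by (auto simp: primitive_def)
  define T' where "T' = {b \<in> T. v \<notin> wedge_span m b}"
  have "v \<notin> wedge_span m []"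
    using v by (auto simp: wedge_span_def minor_Cons intro!: exI[of _ "[i]"])
  \<comment> \<open>If every member of the flag contains \<open>v\<close>, then \<open>D\<close> is
    the empty tuple, of covolume exactly 1; hence the bound here is not strict.\<close>
  have "\<exists>D. v \<notin> wedge_span m D \<and> indep_minor m D \<and> set D \<subseteq> Lambda_vec m \<and>
    (\<forall>b\<in>T'. b = D \<or> length b < length D \<and> wedge_span m b \<subseteq> wedge_span m D) \<and>
    (\<forall>b\<in>T - T'. length D < length b \<and> wedge_span m D \<subseteq> wedge_span m b) \<and> (\<forall>x\<in>Q. \<psi> D x \<le> 1)"
  proof (cases "T' = {}")
    case True
    have "\<forall>x\<in>Q. \<psi> [] x \<le> 1" by (simp add: \<psi>_def)
    then show ?thesis
      using \<open>v \<notin> wedge_span m []\<close> True prim(1) wedge_span_Nil_subset[of m] indep_minor_Nil[of m]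
      by (intro exI[of _ "[]"] conjI ballI) (simp_all only: ball_simps length_greater_0_conv list.set empty_subsetI list.size, auto)
  next
    case False
    then obtain D where D: "D \<in> T'" "\<And>b. b \<in> T' \<Longrightarrow> length b \<le> length D"
      using ex_maximizer[of T' length] T(1) by (auto simp: T'_def)
    have DT: "D \<in> T" "v \<notin> wedge_span m D" using D by (auto simp: T'_def)
    have 1: "b = D \<or> length b < length D \<and> wedge_span m b \<subseteq> wedge_span m D" if "b \<in> T'" for b
    proof -
      have "b = D \<or> span_cmp m b D" using T(3) that DT by (auto simp: T'_def)
      then show ?thesis using D(2)[OF that] by (auto simp: span_cmp_def)
    qed
    have 2: "length D < length b \<and> wedge_span m D \<subseteq> wedge_span m b" if "b \<in> T - T'" for b
    proof -
      have "v \<in> wedge_span m b" using that by (auto simp: T'_def)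
      moreover have "span_cmp m D b" using T(3) that DT D by auto
      ultimately show ?thesis using DT(2) by (auto simp: span_cmp_def)
    qed
    have "\<forall>x\<in>Q. \<psi> D x \<le> 1" using T(4) DT by (auto intro: less_imp_le)
    then show ?thesis using 1 2 DT prim[OF DT(1)] by blast
  qed
  then obtain D where D: "v \<notin> wedge_span m D" "indep_minor m D" "set D \<subseteq> Lambda_vec m"
    "\<And>b. b \<in> T' \<Longrightarrow> b = D \<or> length b < length D \<and> wedge_span m b \<subseteq> wedge_span m D"
    "\<And>b. b \<in> T - T' \<Longrightarrow> length D < length b \<and> wedge_span m D \<subseteq> wedge_span m b"
    "\<And>x. x \<in> Q \<Longrightarrow> \<psi> D x \<le> 1"
    by blast
  define E where "E = v # D"
  have E: "E \<noteq> []" "set E \<subseteq> Lambda_vec m" "indep_minor m E" "length E = Suc (length D)"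
    using D v indep_minor_ConsI by (auto simp: E_def)
  have nth_E: "E ! r \<in> wedge_span m b" if b: "b \<in> T - T'" and r: "r < length E" for b r
  proof (cases r)
    case 0
    then show ?thesis using b by (auto simp: E_def T'_def)
  next
    case (Suc r')
    then have "D ! r' \<in> wedge_span m D" using r E by (intro nth_mem_wedge_span) simp
    then show ?thesis using D(5)[OF b] Suc by (auto simp: E_def)
  qed
  have "\<exists>y\<in>Q. \<epsilon> < \<psi> E y"
  proof (cases "\<exists>b\<in>T - T'. length b = length E")
    case True
    then obtain b where b: "b \<in> T - T'" "length b = length E" by blast
    then have bT: "b \<in> T" by simp
    obtain \<mu> where \<mu>: "\<And>I. length I = length b \<Longrightarrow> set I \<subseteq> {..<m} \<Longrightarrow> minor E I = \<mu> * minor b I"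
      using minor_proportional[OF prim(3)[OF bT], of E] nth_E[OF b(1)] b(2) by auto
    then have pr: "proportional m \<mu> E b" using b(2) by (simp add: proportional_def)
    have "\<mu> \<noteq> 0" using E(3) \<mu> b(2) by (auto simp: indep_minor_def)
    then have "1 \<le> absF \<mu>" using T(2) bT E(2) pr by (auto simp: primitive_def)
    then have "\<psi> b x \<le> \<psi> E x" for x
      unfolding \<psi>_def by (rule proportional_covol_le[OF pr _ wt])
    moreover obtain y where "y \<in> Q" "\<epsilon> < \<psi> b y" using T(4) bT by (auto simp: not_le)
    ultimately show ?thesis by (meson less_le_trans)
  next
    case False
    \<comment> \<open>The flag has no member of this rank, so \<open>F\<close> fits into the gap
      between \<open>D\<close> and the members containing \<open>v\<close>.\<close>
    obtain F \<mu> where F: "F \<in> primitive m" "proportional m \<mu> E F" "1 \<le> absF \<mu>"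
      using ex_primitive[OF E(1-3)] by blast
    have spF: "wedge_span m F = wedge_span m E"
      using F(3) by (intro proportional_wedge_span[OF F(2), symmetric]) auto
    have lenF: "length F = length E" using F(2) by (simp add: proportional_def)
    have DE: "wedge_span m D \<subseteq> wedge_span m E"
      unfolding E_def by (rule wedge_span_Cons_mono[OF D(2)])
    have "span_cmp m F b" if b: "b \<in> T" for b
    proof (cases "b \<in> T'")
      case True
      then have "length b < length F" "wedge_span m b \<subseteq> wedge_span m F"
        using D(4)[OF True] DE spF lenF E(4) by auto
      then show ?thesis by (simp add: span_cmp_def)
    next
      case nT': False
      then have bT': "b \<in> T - T'" using b by simp
      have "wedge_span m E \<subseteq> wedge_span m b"
        by (rule wedge_span_Cons_subset[OF E(3) nth_E[OF bT']])
      moreover have "length E < length b"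
        using D(5)[OF bT'] False bT' E(4) by (metis Suc_lessI)
      ultimately show ?thesis using spF lenF by (simp add: span_cmp_def)
    qed
    then obtain y where y: "y \<in> Q" "1 \<le> \<psi> F y" using T(5) F(1) by (auto simp: not_less)
    have "\<psi> F y \<le> \<psi> E y"
      unfolding \<psi>_def by (rule proportional_covol_le[OF F(2,3) wt])
    then show ?thesis using y \<epsilon> by (intro bexI[of _ y]) auto
  qed
  then obtain y where y: "y \<in> Q" "\<epsilon> < \<psi> E y" by blast
  have "\<psi> E y \<le> \<psi> D y * wt_norm m wt (unip m (\<lambda>j. \<phi> j y) v)"
    unfolding \<psi>_def E_def list.map by (rule covol_Cons_le[OF wt])
  also have "\<dots> \<le> 1 * wt_norm m wt (unip m (\<lambda>j. \<phi> j y) v)"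
    using D(6)[OF y(1)] by (intro mult_right_mono wt_norm_nonneg) auto
  finally show ?thesis using y by (intro bexI[of _ y]) auto
qed

text \<open>Makes each coordinate of the wedge product a combination to which goodness applies. A
  coordinate that avoids index 0 is constant, hence a multiple of \<open>\<phi> 0\<close>.\<close>

lemma minor_unip_linear_form:
  fixes b :: "(nat \<Rightarrow> 'k::{finite,field} fls) list"
  assumes I: "I \<in> minor_idx m (length b)" and m: "0 < m"
  shows "\<exists>a. \<forall>\<phi>. \<phi> 0 = 1 \<longrightarrow> minor (map (unip m \<phi>) b) I = (\<Sum>j<m. a j * \<phi> j)"
proof (cases "0 \<in> set I")
  case True
  then obtain p where p: "p < length b" "I ! p = 0" using I by (auto simp: minor_idx_def in_set_conv_nth)
  show ?thesis
    using I p by (intro exI[of _ "\<lambda>j. minor b (I[p := j])"]) (auto simp: minor_unip_0 minor_idx_def mult.commute)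
next
  case False
  have "minor (map (unip m \<phi>) b) I = (\<Sum>j<m. (if j = 0 then minor b I else 0) * \<phi> j)" if "\<phi> 0 = 1" for \<phi>
  proof -
    have "(\<Sum>j<m. (if j = 0 then minor b I else 0) * \<phi> j) = (\<Sum>j<m. if j = 0 then minor b I else 0)"
      using that by (intro sum.cong) auto
    then show ?thesis using False I m by (simp add: minor_unip_not_0 minor_idx_def)
  qed
  then show ?thesis by (intro exI[of _ "\<lambda>j. if j = 0 then minor b I else 0"]) blast
qed

text \<open>Look at a coordinate containing index 0: it is a linear form in \<phi> with polynomial
  coefficients, one of them nonzero and so of size at least 1. Its weight is
  \<open>A * \<beta> ^ (length b - 1)\<close>. Below full rank this weight is large enough to absorb
  \<eta>. In full rank the form reduces to its constant coefficient, and \<eta> does not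
  enter.\<close>

lemma covol_large:
  fixes b :: "(nat \<Rightarrow> 'k::{finite,field} fls) list" and \<phi> :: "nat \<Rightarrow> 's \<Rightarrow> 'k fls" and A \<beta> \<eta> :: real
  defines "wt \<equiv> \<lambda>i::nat. if i = 0 then A else \<beta>"
  assumes b: "b \<noteq> []" "set b \<subseteq> Lambda_vec (Suc n)" "indep_minor (Suc n) b"
    and \<phi>0: "\<And>x. \<phi> 0 x = 1"
    and Q: "Q \<noteq> {}" and A: "0 < A" and \<beta>: "0 < \<beta>" "\<beta> \<le> 1" and A1: "1 \<le> A * \<beta> ^ n"
    and \<eta>: "0 < \<eta>" "\<And>a i. i < Suc n \<Longrightarrow> \<exists>x\<in>Q. \<eta> * absF (a i) \<le> absF (\<Sum>j<Suc n. a j * \<phi> j x)"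
    and large: "1 \<le> A * \<beta> ^ (n - 1) * \<eta>"
  shows "\<exists>x\<in>Q. 1 \<le> covol (Suc n) wt (map (unip (Suc n) (\<lambda>j. \<phi> j x)) b)"
proof -
  let ?m = "Suc n"
  obtain I0 where I0: "length I0 = length b" "set I0 \<subseteq> {..<?m}" "minor b I0 \<noteq> 0"
    using b(3) by (auto simp: indep_minor_def)
  have dist0: "distinct I0" using minor_not_distinct[of I0 b] I0 by blast
  have len: "0 < length b" using b(1) by simp
  \<comment> \<open>If the nonzero minor avoids index 0, its first index is replaced by 0; the old
    minor then reappears as the coefficient at the replaced index.\<close>
  have "\<exists>I p i. I \<in> minor_idx ?m (length b) \<and> p < length b \<and> I ! p = 0 \<and> i < ?m \<and> minor b (I[p := i]) \<noteq> 0"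
  proof (cases "0 \<in> set I0")
    case True
    then obtain p where p: "p < length b" "I0 ! p = 0" using I0 by (metis in_set_conv_nth)
    then have "I0[p := 0] = I0" by (metis list_update_id)
    then show ?thesis using p I0 dist0 by (intro exI[of _ I0] exI[of _ p] exI[of _ 0]) (auto simp: minor_idx_def)
  next
    case False
    have "distinct (I0[0 := 0])" using False dist0 by (intro distinct_list_update) auto
    moreover have "set (I0[0 := 0]) \<subseteq> {..<?m}" using set_update_subset_insert[of I0 0 0] I0 by auto
    moreover have "I0 ! 0 < ?m" using I0 len by (metis lessThan_iff nth_mem subset_iff)
    ultimately show ?thesis
      using I0 len by (intro exI[of _ "I0[0 := 0]"] exI[of _ 0] exI[of _ "I0 ! 0"]) (auto simp: minor_idx_def)
  qed
  then obtain I p i where I: "I \<in> minor_idx ?m (length b)" "p < length b" "I ! p = 0" "i < ?m" "minor b (I[p := i]) \<noteq> 0"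
    by blast
  then have I': "length I = length b" "distinct I" "set I \<subseteq> {..<?m}" by (auto simp: minor_idx_def)
  define a where "a j = minor b (I[p := j])" for j
  have form: "minor (map (unip ?m (\<lambda>j. \<phi> j x)) b) I = (\<Sum>j<?m. a j * \<phi> j x)" for x
    using minor_unip_0[OF I'(1,2) I(2,3), of ?m "\<lambda>j. \<phi> j x"] by (simp only: a_def mult.commute)
  have aL: "1 \<le> absF (a j)" if "j < ?m" "a j \<noteq> 0" for j
  proof -
    have "a j \<in> LambdaF"
      unfolding a_def using b(2) I' that set_update_subset_insert[of I p j]
      by (intro minor_in_LambdaF[of b ?m]) (auto simp: Lambda_vec_def)
    then show ?thesis using that by (intro LambdaF_absF_ge_1)
  qed
  have "0 \<in> set I" using I I' by (metis nth_mem)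
  then have "(\<Prod>l\<in>set I. wt l) = A * (\<Prod>l\<in>set I - {0}. wt l)"
    by (subst prod.remove[of _ 0]) (auto simp: wt_def)
  also have "(\<Prod>l\<in>set I - {0}. wt l) = \<beta> ^ (length b - 1)"
    using \<open>0 \<in> set I\<close> I' by (subst prod.cong[OF refl, of _ _ "\<lambda>_. \<beta>"]) (auto simp: wt_def distinct_card)
  finally have w: "(\<Prod>l\<in>set I. wt l) = A * \<beta> ^ (length b - 1)" .
  have lem: "length b \<le> ?m" using minor_idx_length_le[OF I(1)] .
  have "\<exists>x\<in>Q. 1 \<le> A * \<beta> ^ (length b - 1) * absF (\<Sum>j<?m. a j * \<phi> j x)"
  proof (cases "length b = ?m")
    case False
    then have "A * \<beta> ^ (n - 1) \<le> A * \<beta> ^ (length b - 1)"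
      using lem A \<beta> by (intro mult_left_mono power_decreasing) auto
    then have ge1: "1 \<le> A * \<beta> ^ (length b - 1) * \<eta>"
      using large \<eta>(1) by (meson less_imp_le mult_right_mono order_trans)
    obtain x where x: "x \<in> Q" "\<eta> * absF (a i) \<le> absF (\<Sum>j<?m. a j * \<phi> j x)" using \<eta>(2)[OF I(4), of a] by blast
    have "\<eta> * 1 \<le> \<eta> * absF (a i)" using aL[OF I(4)] I(5) \<eta>(1) by (intro mult_left_mono) (auto simp: a_def)
    then have "A * \<beta> ^ (length b - 1) * \<eta> \<le> A * \<beta> ^ (length b - 1) * absF (\<Sum>j<?m. a j * \<phi> j x)"
      using x(2) A \<beta> by (intro mult_left_mono) auto
    then show ?thesis using ge1 x(1) by (intro bexI[of _ x]) auto
  next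
    case True
    have full: "set I = {..<?m}" using I' True by (intro card_subset_eq) (auto simp: distinct_card)
    \<comment> \<open>\<open>I\<close> already contains every index, so putting \<open>j\<close> in
      place of 0 creates a repetition.\<close>
    have zero: "a j = 0" if j: "j < ?m" "j \<noteq> 0" for j
    proof -
      obtain l where l: "l < length I" "I ! l = j" using full j(1) by (metis in_set_conv_nth lessThan_iff)
      then have "l \<noteq> p" using I(3) j(2) by auto
      then have "I[p := j] ! p = I[p := j] ! l" using l I(2) I'(1) by simp
      then have "\<not> distinct (I[p := j])"
        using l(1) I(2) I'(1) \<open>l \<noteq> p\<close> nth_eq_iff_index_eq[of "I[p := j]" p l] by auto
      then show ?thesis unfolding a_def using I' by (intro minor_not_distinct) auto
    qed
    have "(\<Sum>j<?m. a j * \<phi> j x) = (\<Sum>j<?m. if j = 0 then a 0 else 0)" for x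
      using zero \<phi>0 by (intro sum.cong) auto
    then have "(\<Sum>j<?m. a j * \<phi> j x) = a 0" for x by simp
    moreover have "i = 0" using zero[OF I(4)] I(5) by (auto simp: a_def)
    then have "1 \<le> absF (a 0)" using aL[of 0] I(5) by (simp add: a_def)
    ultimately have "1 * 1 \<le> A * \<beta> ^ (length b - 1) * absF (\<Sum>j<?m. a j * \<phi> j x)" for x
      using A1 True A \<beta> by (intro mult_mono) auto
    then show ?thesis using Q by auto
  qed
  then obtain x where x: "x \<in> Q" "1 \<le> (\<Prod>l\<in>set I. wt l) * absF (minor (map (unip ?m (\<lambda>j. \<phi> j x)) b) I)"
    unfolding form w by blast
  moreover have "\<dots> \<le> covol ?m wt (map (unip ?m (\<lambda>j. \<phi> j x)) b)"
    using I(1) by (intro covol_ge) simp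
  ultimately show ?thesis by (intro bexI[of _ x]) auto
qed

subsection \<open>The measure estimate\<close>

lemma real_between_powers:
  fixes r :: real
  assumes "0 < r"
  obtains K where "real CARD('k::{finite,field}) powi K \<le> r" "r < real CARD('k) powi (K + 1)"
proof -
  let ?q = "real CARD('k)"
  define K where "K = \<lfloor>log ?q r\<rfloor>"
  have eq: "?q powr real_of_int j = ?q powi j" for j :: int by (simp add: powr_real_of_int')
  have "?q powr real_of_int K \<le> r" "r < ?q powr real_of_int (K + 1)"
    using assms CARD_gt1[where 'k='k] floor_correct[of "log ?q r"]
    by (simp_all only: K_def powr_le_iff less_powr_iff)
  then show ?thesis unfolding eq by (rule that)
qed

text \<open>Radii are arbitrary positive reals, but absolute values are powers of q, so the radius
  can be rounded down to such a power, whatever the centre.\<close>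

lemma cballF_is_bal:
  fixes c :: "nat \<Rightarrow> 'k::{finite,field} fls"
  assumes "0 < r"
  obtains k where "\<And>c. cballF d (c :: nat \<Rightarrow> 'k fls) r = bal d c k"
proof -
  obtain K where K: "real CARD('k) powi K \<le> r" "r < real CARD('k) powi (K + 1)"
    using real_between_powers[where 'k='k, OF assms] by blast
  have eq: "absF a \<le> r \<longleftrightarrow> absF a \<le> real CARD('k) powi K" for a :: "'k fls"
  proof
    assume *: "absF a \<le> r"
    show "absF a \<le> real CARD('k) powi K"
    proof (cases rule: absF_cases[of a])
      case (2 j)
      have "j < K + 1"
      proof (rule ccontr)
        assume "\<not> j < K + 1"
        then have "real CARD('k) powi (K + 1) \<le> real CARD('k) powi j" by (intro power_int_increasing) auto
        then show False using * K 2 by simp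
      qed
      then have "real CARD('k) powi j \<le> real CARD('k) powi K" by (intro power_int_increasing) auto
      then show ?thesis using 2 by simp
    qed simp
  qed (use K in simp)
  have "cballF d c r = bal d c (- K)" for c :: "nat \<Rightarrow> 'k fls"
    by (rule Set.set_eqI)
       (simp only: cballF_def bal_iff_absF vnormF_le_iff[OF less_imp_le[OF assms]] mem_Collect_eq eq minus_minus)
  then show ?thesis by (rule that)
qed

lemma openF_bal: "openF d (bal d (w :: nat \<Rightarrow> 'k::{finite,field} fls) k)"
  unfolding openF_def
proof (intro conjI ballI)
  fix x assume "x \<in> bal d w k"
  then have "cballF d x (real CARD('k) powi (- k)) \<subseteq> bal d w k"
    by (simp only: cballF_eq_bal bal_eq_if_mem)
  then show "\<exists>r>0. cballF d x r \<subseteq> bal d w k" by (intro exI[of _ "real CARD('k) powi (- k)"]) simp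
qed (rule bal_subset_vecF)

lemma exponent_le_if_bal_subset:
  fixes c :: "nat \<Rightarrow> 'k::{finite,field} fls"
  assumes "0 < d" "c \<in> vecF d" "bal d c k \<subseteq> bal d x0 \<kappa>"
  shows "\<kappa> \<le> k"
proof (rule ccontr)
  assume k: "\<not> \<kappa> \<le> k"
  define v where "v i = (if i = 0 then 1 else 0 :: 'k)" for i :: nat
  have "v \<in> digs d" using assms(1) by (auto simp: v_def digs_def)
  then have "child c k v \<in> vecF d" using assms(2) by auto
  then have "child c k v \<in> bal d c k" by (auto simp: bal_def nth_child)
  then have "child c k v \<in> bal d x0 \<kappa>" "c \<in> bal d x0 \<kappa>" using assms(2,3) by auto
  then have "fls_nth (child c k v 0) k = fls_nth (c 0) k" using k assms(1) by (auto simp: bal_def)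
  then show False by (simp add: nth_child v_def)
qed

definition with_one :: "((nat \<Rightarrow> 'k::{finite,field} fls) \<Rightarrow> nat \<Rightarrow> 'k fls) \<Rightarrow> nat \<Rightarrow> (nat \<Rightarrow> 'k fls) \<Rightarrow> 'k fls" where
  "with_one f i x = (if i = 0 then 1 else f x (i - 1))"

lemma ex_expandable_family:
  fixes U :: "(nat \<Rightarrow> 'k::{finite,field} fls) set"
  assumes U: "openF d U" "x0 \<in> U" and II: "condII d n U f" and III: "condIII d n U f"
  shows "\<exists>\<kappa> cc. bal d x0 \<kappa> \<subseteq> U \<and> expandable_family d (Suc n) x0 \<kappa> (with_one f) cc"
proof -
  have x0: "x0 \<in> vecF d" using U by (auto simp: openF_def)
  have "\<exists>\<kappa>0. k < n \<longrightarrow> (\<forall>\<kappa>\<ge>\<kappa>0. \<exists>c. expands d x0 \<kappa> c (\<lambda>x. f x k))" for k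
  proof (cases "k < n")
    case True
    then have "analyticF_on d U (\<lambda>x. f x k)" using II by (simp add: condII_def)
    then show ?thesis using analytic_expands[OF _ U(2) x0] by blast
  qed simp
  then have "\<exists>\<kappa>0. \<forall>k. k < n \<longrightarrow> (\<forall>\<kappa>\<ge>\<kappa>0 k. \<exists>c. expands d x0 \<kappa> c (\<lambda>x. f x k))"
    by (intro choice allI)
  then obtain \<kappa>0 where \<kappa>0: "\<And>k \<kappa>. k < n \<Longrightarrow> \<kappa>0 k \<le> \<kappa> \<Longrightarrow> \<exists>c. expands d x0 \<kappa> c (\<lambda>x. f x k)"
    by blast
  obtain r where r: "0 < r" "cballF d x0 r \<subseteq> U" using U by (auto simp: openF_def)
  obtain k0 where k0: "\<And>c. cballF d (c :: nat \<Rightarrow> 'k fls) r = bal d c k0" using cballF_is_bal[OF r(1)] by blast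
  define \<kappa> where "\<kappa> = Max (insert k0 (\<kappa>0 ` {..<n}))"
  have \<kappa>: "k0 \<le> \<kappa>" "\<And>k. k < n \<Longrightarrow> \<kappa>0 k \<le> \<kappa>" by (auto simp: \<kappa>_def)
  have sub: "bal d x0 \<kappa> \<subseteq> U" using bal_antimono[OF \<kappa>(1)] r(2) k0 by blast
  have "\<forall>k. \<exists>c. k < n \<longrightarrow> expands d x0 \<kappa> c (\<lambda>x. f x k)" using \<kappa>0 \<kappa> by blast
  then have "\<exists>c. \<forall>k. k < n \<longrightarrow> expands d x0 \<kappa> (c k) (\<lambda>x. f x k)" by (rule choice)
  then obtain c where c: "\<And>k. k < n \<Longrightarrow> expands d x0 \<kappa> (c k) (\<lambda>x. f x k)" by blast
  define cc where "cc i = (if i = 0 then (\<lambda>\<beta>. if \<beta> = (\<lambda>_. 0) then 1 else 0) else c (i - 1))" for i :: nat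
  have "expandable_family d (Suc n) x0 \<kappa> (with_one f) cc"
  proof
    show "x0 \<in> vecF d" by (rule x0)
    show "expands d x0 \<kappa> (cc i) (with_one f i)" if "i < Suc n" for i
    proof (cases i)
      case 0
      then show ?thesis using expands_const by (simp add: cc_def with_one_def[abs_def])
    next
      case (Suc i')
      then show ?thesis using c[of i'] that by (simp add: cc_def with_one_def[abs_def])
    qed
    fix w k and a :: "nat \<Rightarrow> 'k fls"
    assume w: "w \<in> bal d x0 \<kappa>" and k: "\<kappa> \<le> k"
      and z: "\<And>x. x \<in> bal d w k \<Longrightarrow> (\<Sum>i<Suc n. a i * with_one f i x) = 0"
    have "w \<in> bal d w k" using w bal_subset_vecF by (intro center_in_bal) blast
    moreover have "bal d w k \<subseteq> U" using bal_subset_bal[OF w k] sub by blast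
    moreover have "a 0 + (\<Sum>j<n. a (Suc j) * f x j) = 0" if "x \<in> bal d w k" for x
      using z[OF that] by (simp add: with_one_def sum.lessThan_Suc_shift del: sum.lessThan_Suc)
    ultimately have "a 0 = 0 \<and> (\<forall>j<n. a (Suc j) = 0)"
      using III[unfolded condIII_def, rule_format, of "bal d w k" "a 0" "\<lambda>j. a (Suc j)"] openF_bal[of d w k]
      by blast
    then show "\<forall>i<Suc n. a i = 0" by (auto simp: less_Suc_eq_0_disj)
  qed
  then show ?thesis using sub by blast
qed

text \<open>The weights turn an approximation counted by \<open>PhiF\<close> into a lattice vector of norm at most
  \<open>\<epsilon> = \<delta> powr (1 / (n + 1))\<close>, while keeping the lattice unimodular (\<open>A * \<beta> ^ n = 1\<close>).\<close>

lemma PhiF_imp_short_vector: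
  fixes U :: "(nat \<Rightarrow> 'k::{finite,field} fls) set" and \<epsilon> :: real and t n :: nat
  defines "q \<equiv> real CARD('k)"
  defines "\<beta> \<equiv> \<epsilon> / q ^ t" and "A \<equiv> q ^ (n * t) / \<epsilon> ^ n"
  assumes \<epsilon>: "0 < \<epsilon>" and \<delta>: "\<delta> = \<epsilon> ^ Suc n"
    and x: "x \<in> PhiF d n U f t \<delta>"
    and close: "\<And>y k. y \<in> Q \<Longrightarrow> k < n \<Longrightarrow> absF (f y k - f x k) < \<delta> / (q ^ (n * t) * q ^ t)"
  shows "\<exists>v\<in>Lambda_vec (Suc n). (\<exists>i<Suc n. v i \<noteq> 0) \<and>
    (\<forall>y\<in>Q. wt_norm (Suc n) (\<lambda>i. if i = 0 then A else \<beta>) (unip (Suc n) (\<lambda>j. with_one f j y) v) \<le> \<epsilon>)"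
proof -
  have q: "0 < q" by (simp add: q_def)
  have \<delta>0: "0 < \<delta>" using \<epsilon> \<delta> by simp
  have pq: "real CARD('k) powr (- (real n * real t)) = 1 / q ^ (n * t)"
    using q by (simp add: powr_minus divide_inverse q_def powr_realpow flip: of_nat_mult)
  obtain a a0 where a: "a \<in> vecF n" "\<forall>k<n. a k \<in> LambdaF" "\<exists>k<n. a k \<noteq> 0" "a0 \<in> LambdaF"
      "absF ((\<Sum>k<n. f x k * a k) + a0) < \<delta> * real CARD('k) powr (- (real n * real t))" "vnormF n a = q ^ t"
    using x unfolding PhiF_def mem_Collect_eq q_def by blast
  have a5: "absF ((\<Sum>k<n. f x k * a k) + a0) < \<delta> / q ^ (n * t)" using a(5) unfolding pq by simp
  define v where "v i = (if i = 0 then a0 else a (i - 1))" for i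
  have a_le: "absF (a k) \<le> q ^ t" if "k < n" for k
    using a(6) vnormF_le_iff[of "q ^ t" n a] that q by simp
  have form: "(\<Sum>j<Suc n. with_one f j y * v j) = (\<Sum>k<n. f y k * a k) + a0" for y
    by (simp add: with_one_def v_def sum.lessThan_Suc_shift del: sum.lessThan_Suc)
  have "wt_norm (Suc n) (\<lambda>i. if i = 0 then A else \<beta>) (unip (Suc n) (\<lambda>j. with_one f j y) v) \<le> \<epsilon>"
    if y: "y \<in> Q" for y
  proof (subst wt_norm_le_iff, use \<epsilon> in simp, intro allI impI)
    fix i assume i: "i < Suc n"
    show "(if i = 0 then A else \<beta>) * absF (unip (Suc n) (\<lambda>j. with_one f j y) v i) \<le> \<epsilon>"
    proof (cases "i = 0")
      case True
      \<comment> \<open>The extra factor \<open>q ^ t\<close> in the closeness hypothesis absorbs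
        the size of \<open>a\<close>.\<close>
      have "absF (\<Sum>k<n. (f y k - f x k) * a k) \<le> \<delta> / q ^ (n * t)"
      proof (rule absF_sum_le)
        fix k assume k: "k \<in> {..<n}"
        then have "absF (f y k - f x k) * absF (a k) \<le> \<delta> / (q ^ (n * t) * q ^ t) * q ^ t"
          using close[OF y, of k] a_le[of k] \<delta>0 q by (intro mult_mono) auto
        then show "absF ((f y k - f x k) * a k) \<le> \<delta> / q ^ (n * t)" using q by (simp add: absF_mult)
      qed (use \<delta>0 q in simp)
      then have "absF (((\<Sum>k<n. f x k * a k) + a0) + (\<Sum>k<n. (f y k - f x k) * a k)) \<le> \<delta> / q ^ (n * t)"
        by (rule absF_add_leI[OF less_imp_le[OF a5]])
      then have "absF ((\<Sum>k<n. f y k * a k) + a0) \<le> \<delta> / q ^ (n * t)"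
        by (simp add: left_diff_distrib sum_subtractf add.commute)
      then have "A * absF ((\<Sum>k<n. f y k * a k) + a0) \<le> A * (\<delta> / q ^ (n * t))"
        using \<epsilon> q by (intro mult_left_mono) (auto simp: A_def)
      also have "\<dots> = \<epsilon>" using \<epsilon> q by (simp add: A_def \<delta>)
      finally show ?thesis using True by (simp only: unip_def form if_True simp_thms)
    next
      case False
      then have "absF (v i) \<le> q ^ t" using a_le[of "i - 1"] i by (simp add: v_def)
      then have "\<beta> * absF (v i) \<le> \<beta> * q ^ t" using \<epsilon> q by (intro mult_left_mono) (auto simp: \<beta>_def)
      then show ?thesis using False q by (simp add: unip_def \<beta>_def)
    qed
  qed
  moreover have "v \<in> Lambda_vec (Suc n)"
    using a by (auto simp: Lambda_vec_def v_def less_Suc_eq_0_disj)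
  moreover have "\<exists>i<Suc n. v i \<noteq> 0"
  proof -
    obtain k where "k < n" "a k \<noteq> 0" using a(3) by blast
    then show ?thesis by (intro exI[of _ "Suc k"]) (simp add: v_def)
  qed
  ultimately show ?thesis by blast
qed

context expandable_family
begin

text \<open>The covolume is a maximum of weighted linear forms. Take the form that attains it at a
  point where it is at least 1: wherever the covolume is at most \<epsilon>, so is this form. The
  weight \<open>w\<close> cancels from the ratio of the two thresholds, so \<open>m\<close> depends
  neither on the weights nor on \<open>b\<close>.\<close>

lemma covol_good:
  assumes p: "p = Suc n" and \<phi>0: "\<And>x. \<phi> 0 x = 1"
  shows "\<exists>m\<ge>1. \<forall>wt \<epsilon> b c k L. (\<forall>i. 0 < wt i) \<longrightarrow> 0 < \<epsilon> \<longrightarrow> c \<in> bal d x0 \<kappa> \<longrightarrow> \<kappa> \<le> k \<longrightarrow>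
    \<not> (\<forall>x\<in>bal d c k. covol (Suc n) wt (map (unip (Suc n) (\<lambda>j. \<phi> j x)) b) < 1) \<longrightarrow>
    sumcells d L c k (\<lambda>Q. of_bool (\<forall>x\<in>Q. covol (Suc n) wt (map (unip (Suc n) (\<lambda>j. \<phi> j x)) b) \<le> \<epsilon>))
      \<le> real m * \<epsilon> powr (1 / real m) * real CARD('k) ^ (d * L)"
proof -
  obtain m where m: "m \<ge> 1" "\<And>a w k \<epsilon> \<rho> x L. w \<in> bal d x0 \<kappa> \<Longrightarrow> \<kappa> \<le> k \<Longrightarrow> 0 < \<epsilon> \<Longrightarrow> 0 < \<rho> \<Longrightarrow>
     x \<in> bal d w k \<Longrightarrow> \<rho> \<le> absF (lc a x) \<Longrightarrow>
     sumcells d L w k (\<lambda>Q. of_bool (\<forall>x\<in>Q. absF (lc a x) \<le> \<epsilon>))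
       \<le> real m * (\<epsilon> / \<rho>) powr (1 / real m) * real CARD('k) ^ (d * L)"
    using lc_good by (elim exE conjE) (rule that; blast)
  show ?thesis
  proof (intro exI[of _ m] conjI allI impI m(1))
    fix wt :: "nat \<Rightarrow> real" and \<epsilon> :: real and b and c :: "nat \<Rightarrow> 'k fls" and k L
    assume wt: "\<forall>i. 0 < wt i" and \<epsilon>: "0 < \<epsilon>" and c: "c \<in> bal d x0 \<kappa>" "\<kappa> \<le> k"
      and nl: "\<not> (\<forall>x\<in>bal d c k. covol (Suc n) wt (map (unip (Suc n) (\<lambda>j. \<phi> j x)) b) < 1)"
    define \<psi> where "\<psi> x = covol (Suc n) wt (map (unip (Suc n) (\<lambda>j. \<phi> j x)) b)" for x
    obtain x where x: "x \<in> bal d c k" "1 \<le> \<psi> x" using nl by (auto simp: \<psi>_def not_less)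
    have "\<psi> x \<in> insert 0 ((\<lambda>I. (\<Prod>i\<in>set I. wt i) * absF (minor (map (unip (Suc n) (\<lambda>j. \<phi> j x)) b) I))
        ` minor_idx (Suc n) (length b))"
      unfolding \<psi>_def covol_def length_map by (rule Max_in) auto
    then obtain I where I: "I \<in> minor_idx (Suc n) (length b)"
        "\<psi> x = (\<Prod>i\<in>set I. wt i) * absF (minor (map (unip (Suc n) (\<lambda>j. \<phi> j x)) b) I)"
      using x(2) by auto
    define w where "w = (\<Prod>i\<in>set I. wt i)"
    have w: "0 < w" unfolding w_def using wt by (intro prod_pos) auto
    obtain a where a: "\<And>\<phi>. \<phi> 0 = 1 \<Longrightarrow> minor (map (unip (Suc n) \<phi>) b) I = (\<Sum>j<Suc n. a j * \<phi> j)"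
      using minor_unip_linear_form[OF I(1)] by blast
    have lc: "minor (map (unip (Suc n) (\<lambda>j. \<phi> j y)) b) I = lc a y" for y
      unfolding lc_def unfolding p using a[of "\<lambda>j. \<phi> j y"] \<phi>0 by simp
    have "sumcells d L c k (\<lambda>Q. of_bool (\<forall>x\<in>Q. \<psi> x \<le> \<epsilon>))
        \<le> sumcells d L c k (\<lambda>Q. of_bool (\<forall>x\<in>Q. absF (lc a x) \<le> \<epsilon> / w))"
    proof (rule sumcells_mono)
      show "c \<in> vecF d" using c bal_subset_vecF by blast
      have "absF (lc a y) \<le> \<epsilon> / w" if "\<psi> y \<le> \<epsilon>" for y
      proof -
        have "w * absF (lc a y) \<le> \<psi> y"
          unfolding \<psi>_def w_def lc[symmetric] using I(1) by (intro covol_ge) simp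
        then show ?thesis using that w by (simp add: field_simps)
      qed
      then show "(of_bool (\<forall>x\<in>bal d c' (k + int L). \<psi> x \<le> \<epsilon>) :: real)
          \<le> of_bool (\<forall>x\<in>bal d c' (k + int L). absF (lc a x) \<le> \<epsilon> / w)" for c'
        by (auto simp: of_bool_def)
    qed
    also have "\<dots> \<le> real m * ((\<epsilon> / w) / (1 / w)) powr (1 / real m) * real CARD('k) ^ (d * L)"
    proof (rule m(2)[OF c _ _ x(1)])
      show "1 / w \<le> absF (lc a x)" using x(2) I(2) w by (simp add: lc w_def[symmetric] field_simps)
    qed (use \<epsilon> w in auto)
    finally show "sumcells d L c k (\<lambda>Q. of_bool (\<forall>x\<in>Q. covol (Suc n) wt (map (unip (Suc n) (\<lambda>j. \<phi> j x)) b) \<le> \<epsilon>))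
      \<le> real m * \<epsilon> powr (1 / real m) * real CARD('k) ^ (d * L)"
      using w by (simp add: \<psi>_def)
  qed
qed

end

lemma local_measure_bound:
  fixes U :: "(nat \<Rightarrow> 'k::{finite,field} fls) set"
  assumes d: "0 < d" and n: "0 < n" and U: "openF d U" "x0 \<in> U"
    and II: "condII d n U f" and III: "condIII d n U f"
  shows "\<exists>r0>0. cballF d x0 r0 \<subseteq> U \<and>
           (\<exists>C>0. \<exists>\<alpha>1>0. \<forall>B. is_ballF d B \<and> B \<subseteq> cballF d x0 r0 \<longrightarrow>
              (\<forall>\<delta>. 0 < \<delta> \<and> \<delta> < 1 \<longrightarrow>
                 (\<forall>\<^sub>F t in sequentially.
                    haarF d (PhiF d n U f t \<delta> \<inter> B) \<le> ennreal (C * \<delta> powr \<alpha>1) * haarF d B)))"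
proof -
  let ?q = "real CARD('k)"
  let ?N = "Suc n"
  obtain \<kappa> cc where sub: "bal d x0 \<kappa> \<subseteq> U" and fam: "expandable_family d ?N x0 \<kappa> (with_one f) cc"
    using ex_expandable_family[OF U II III] by blast
  interpret expandable_family d ?N x0 \<kappa> "with_one f" cc by (rule fam)
  have one: "with_one f 0 x = 1" for x by (simp add: with_one_def)
  obtain m where m: "m \<ge> 1" and good: "\<And>wt \<epsilon> b c k L. (\<forall>i. 0 < wt i) \<Longrightarrow> 0 < \<epsilon> \<Longrightarrow> c \<in> bal d x0 \<kappa> \<Longrightarrow> \<kappa> \<le> k \<Longrightarrow>
    \<not> (\<forall>x\<in>bal d c k. covol ?N wt (map (unip ?N (\<lambda>j. with_one f j x)) b) < 1) \<Longrightarrow>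
    sumcells d L c k (\<lambda>Q. of_bool (\<forall>x\<in>Q. covol ?N wt (map (unip ?N (\<lambda>j. with_one f j x)) b) \<le> \<epsilon>))
      \<le> real m * \<epsilon> powr (1 / real m) * ?q ^ (d * L)"
    using covol_good[of n, OF refl one] by (elim exE conjE) (rule that; blast)
  \<comment> \<open>There are at most \<open>n + 1\<close> ranks, and \<open>m\<close> comes from
    goodness; the summand 1 secures positivity. In \<alpha> the factor \<open>1 / m\<close> is the
    exponent of goodness, and \<open>1 / (n + 1)\<close> stems from the passage from \<delta> to
    \<epsilon>.\<close>
  define C where "C = (nondiv_const (?q ^ d) ?N + 1) * real m"
  define \<alpha> where "\<alpha> = 1 / (real ?N * real m)"
  have nc: "0 \<le> nondiv_const (?q ^ d) ?N" by (intro nondiv_const_nonneg) simp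
  have C: "0 < C" using m nc by (simp add: C_def)
  have \<alpha>: "0 < \<alpha>" using m by (simp add: \<alpha>_def)
  have r0: "cballF d x0 (?q powi (- \<kappa>)) = bal d x0 \<kappa>" by (rule cballF_eq_bal)
  have main: "\<forall>\<^sub>F t in sequentially. haarF d (PhiF d n U f t \<delta> \<inter> B) \<le> ennreal (C * \<delta> powr \<alpha>) * haarF d B"
    if B: "is_ballF d B" "B \<subseteq> bal d x0 \<kappa>" and \<delta>: "0 < \<delta>" "\<delta> < 1" for B \<delta>
  proof -
    obtain c k where ck: "c \<in> vecF d" "B = bal d c k"
    proof -
      obtain c r where cr: "c \<in> vecF d" "0 < r" "B = cballF d c r" using B(1) by (auto simp: is_ballF_def)
      obtain k where "\<And>c. cballF d (c :: nat \<Rightarrow> 'k fls) r = bal d c k" using cballF_is_bal[OF cr(2)] by blast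
      then show ?thesis using that cr by blast
    qed
    have k: "\<kappa> \<le> k" using exponent_le_if_bal_subset[OF d ck(1)] B(2) ck(2) by blast
    have c: "c \<in> bal d x0 \<kappa>" using B(2) ck center_in_bal by blast
    obtain \<eta> where \<eta>: "0 < \<eta>" "\<And>a i. i < ?N \<Longrightarrow> \<exists>x\<in>bal d c k. \<eta> * absF (a i) \<le> absF (lc a x)"
      using ball_lower_bound[OF c k] by blast
    define \<epsilon> where "\<epsilon> = \<delta> powr (1 / real ?N)"
    have \<epsilon>: "0 < \<epsilon>" "\<epsilon> < 1" using \<delta> powr_less_mono2[of "1 / real ?N" \<delta> 1] by (auto simp: \<epsilon>_def)
    have \<epsilon>\<delta>: "\<delta> = \<epsilon> ^ ?N"
      unfolding \<epsilon>_def using \<delta> by (subst powr_realpow[symmetric]) (auto simp: powr_powr)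
    \<comment> \<open>From \<open>t0\<close> on, \<beta> is at most \<eta>; as
      \<open>A * \<beta> ^ (n - 1)\<close> is the inverse of \<beta>, this is what
      \<open>covol_large\<close> asks for.\<close>
    obtain t0 where t0: "(1 / ?q) ^ t0 < \<eta>"
      using real_arch_pow_inv[OF \<eta>(1), of "1 / ?q"] CARD_gt1[where 'k='k] by (auto simp: field_simps)
    have "haarF d (PhiF d n U f t \<delta> \<inter> B) \<le> ennreal (C * \<delta> powr \<alpha>) * haarF d B" if t: "t0 \<le> t" for t
    proof -
      define \<beta> where "\<beta> = \<epsilon> / ?q ^ t"
      define A where "A = ?q ^ (n * t) / \<epsilon> ^ n"
      define wt where "wt i = (if i = 0 then A else \<beta>)" for i :: nat
      have q1: "1 \<le> ?q ^ t" using CARD_gt1[where 'k='k] by (intro one_le_power) simp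
      have pos: "0 < A" "0 < \<beta>" using \<epsilon> by (auto simp: A_def \<beta>_def)
      have "\<epsilon> \<le> ?q ^ t" using \<epsilon> q1 by linarith
      then have \<beta>1: "\<beta> \<le> 1" by (simp add: \<beta>_def)
      have A\<beta>: "A * \<beta> ^ n = 1"
        using \<epsilon> by (simp add: A_def \<beta>_def power_divide mult.commute flip: power_mult)
      have wt0: "0 < wt i" for i using pos by (simp add: wt_def)
      have large: "1 \<le> A * \<beta> ^ (n - 1) * \<eta>"
      proof -
        have "A * \<beta> ^ (n - 1) * \<beta> = 1" using A\<beta> n by (simp add: mult.assoc power_Suc2[symmetric] del: power_Suc2)
        moreover have "\<beta> \<le> \<eta>"
        proof -
          have "\<beta> \<le> (1 / ?q) ^ t" using \<epsilon> by (simp add: \<beta>_def power_one_over divide_right_mono)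
          also have "\<dots> \<le> (1 / ?q) ^ t0" using t by (intro power_decreasing) auto
          finally show ?thesis using t0 by simp
        qed
        then have "A * \<beta> ^ (n - 1) * \<beta> \<le> A * \<beta> ^ (n - 1) * \<eta>" using pos by (intro mult_left_mono) auto
        ultimately show ?thesis by simp
      qed
      define \<psi> where "\<psi> b x = covol ?N wt (map (unip ?N (\<lambda>j. with_one f j x)) b)" for b x
      define low where "low b Q \<longleftrightarrow> (\<forall>x\<in>Q. \<psi> b x < 1)" for b Q
      define tiny where "tiny b Q \<longleftrightarrow> (\<forall>x\<in>Q. \<psi> b x \<le> \<epsilon>)" for b Q
      define M where "M = real m * \<epsilon> powr (1 / real m)"
      have e0: "0 < \<delta> / (?q ^ (n * t) * ?q ^ t)" using \<delta> by simp
      have "\<exists>l0. \<forall>l\<ge>l0. \<forall>x\<in>bal d x0 \<kappa>. \<forall>y\<in>bal d x l. absF (f y i - f x i) < \<delta> / (?q ^ (n * t) * ?q ^ t)"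
        if "i < n" for i
        using expands_uniformly_continuous[OF expands[of "Suc i"] e0] that by (simp add: with_one_def)
      then have "\<exists>l0. \<forall>i. i < n \<longrightarrow> (\<forall>l\<ge>l0 i. \<forall>x\<in>bal d x0 \<kappa>. \<forall>y\<in>bal d x l. absF (f y i - f x i) < \<delta> / (?q ^ (n * t) * ?q ^ t))"
        by (intro choice allI) blast
      then obtain l0 where l0: "\<And>i l x y. i < n \<Longrightarrow> l0 i \<le> l \<Longrightarrow> x \<in> bal d x0 \<kappa> \<Longrightarrow> y \<in> bal d x l \<Longrightarrow>
          absF (f y i - f x i) < \<delta> / (?q ^ (n * t) * ?q ^ t)" by blast
      \<comment> \<open>A common depth at which all components of \<open>f\<close> vary within the
        tolerance; \<open>k\<close> is included so that the cells subdivide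
        \<open>B\<close>.\<close>
      define l where "l = Max (insert k (l0 ` {..<n}))"
      have l: "k \<le> l" "\<And>i. i < n \<Longrightarrow> l0 i \<le> l" by (auto simp: l_def)
      define L where "L = nat (l - k)"
      have kL: "k + int L = l" using l(1) by (simp add: L_def)
      have nd: "sumcells d L c k (\<lambda>Q. of_bool (\<not> marked (span_cmp ?N) low tiny (primitive ?N) Q))
          \<le> nondiv_const (?q ^ d) ?N * M * ?q ^ (d * L)"
      proof (rule quantitative_nondivergence[where P = "primitive ?N" and rk = length and ?x0.0 = x0 and \<kappa> = \<kappa>])
        show "span_cmp ?N x y \<Longrightarrow> span_cmp ?N y x" for x y :: "(nat \<Rightarrow> 'k fls) list" by (auto simp: span_cmp_def)
        show "span_cmp ?N x y \<Longrightarrow> length x \<noteq> length y" for x y :: "(nat \<Rightarrow> 'k fls) list" by (auto simp: span_cmp_def)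
        show "low x Q \<Longrightarrow> Q' \<subseteq> Q \<Longrightarrow> low x Q'" for x Q Q' by (auto simp: low_def)
        show "sumcells d L' c' k' (\<lambda>Q. of_bool (tiny x Q)) \<le> M * ?q ^ (d * L')"
          if "c' \<in> bal d x0 \<kappa>" "\<kappa> \<le> k'" "\<not> low x (bal d c' k')" for x c' k' L'
          using good[of wt \<epsilon> c' k' x L'] that wt0 \<epsilon> unfolding low_def tiny_def \<psi>_def M_def by blast
        show "0 \<le> M" by (simp add: M_def)
        have len: "length ` (primitive ?N :: (nat \<Rightarrow> 'k fls) list set) \<subseteq> {1..?N}"
        proof
          fix s assume "s \<in> length ` (primitive ?N :: (nat \<Rightarrow> 'k fls) list set)"
          then obtain b :: "(nat \<Rightarrow> 'k fls) list" where b: "b \<in> primitive ?N" "s = length b" by blast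
          obtain I where "length I = length b" "set I \<subseteq> {..<?N}" "minor b I \<noteq> 0"
            using b(1) by (auto simp: primitive_def indep_minor_def)
          then have "I \<in> minor_idx ?N (length b)" using minor_not_distinct[of I b] by (auto simp: minor_idx_def)
          then have "length b \<le> ?N" by (rule minor_idx_length_le)
          moreover have "1 \<le> length b" using b(1) by (auto simp: primitive_def Suc_le_eq)
          ultimately show "s \<in> {1..?N}" using b(2) by simp
        qed
        show "finite (length ` (primitive ?N :: (nat \<Rightarrow> 'k fls) list set))" using len finite_subset by blast
        show "card (length ` (primitive ?N :: (nat \<Rightarrow> 'k fls) list set)) \<le> ?N"
          using card_mono[OF _ len] by simp
        show "\<not> low b (bal d c k)" if "b \<in> primitive ?N" for b
        proof -
          have "\<exists>x\<in>bal d c k. 1 \<le> covol ?N (\<lambda>i. if i = 0 then A else \<beta>) (map (unip ?N (\<lambda>j. with_one f j x)) b)"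
          proof (rule covol_large[where \<phi> = "with_one f" and \<eta> = \<eta>])
            show "b \<noteq> []" "set b \<subseteq> Lambda_vec ?N" "indep_minor ?N b" using that by (auto simp: primitive_def)
            show "bal d c k \<noteq> {}" using center_in_bal[OF ck(1)] by blast
            show "\<exists>x\<in>bal d c k. \<eta> * absF (a i) \<le> absF (\<Sum>j<?N. a j * with_one f j x)" if "i < ?N" for a i
              using \<eta>(2)[OF that, of a] by (simp only: lc_def)
          qed (use A\<beta> one pos \<beta>1 \<eta>(1) large in simp_all)
          then show ?thesis by (auto simp: low_def \<psi>_def wt_def[abs_def] not_less)
        qed
      qed (use c k in auto)
      let ?S = "PhiF d n U f t \<delta> \<inter> B"
      \<comment> \<open>A point of \<open>PhiF\<close> in a cell gives a vector that is short on the
        whole cell, which a marked cell excludes. So the unmarked cells cover the set to be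
        measured.\<close>
      have S_not_marked: "of_bool (?S \<inter> bal d c' (k + int L) \<noteq> {}) \<le>
          (of_bool (\<not> marked (span_cmp ?N) low tiny (primitive ?N) (bal d c' (k + int L))) :: real)"
        if c': "c' \<in> bal d c k" for c'
      proof -
        let ?Q = "bal d c' l"
        have "\<not> marked (span_cmp ?N) low tiny (primitive ?N) ?Q" if x: "x \<in> ?S \<inter> ?Q" for x
        proof
          assume mk: "marked (span_cmp ?N) low tiny (primitive ?N) ?Q"
          have xB: "x \<in> bal d x0 \<kappa>" using x B(2) by blast
          have "?Q = bal d x l" using x bal_eq_if_mem[of x d c' l] by blast
          then have "absF (f y i - f x i) < \<delta> / (?q ^ (n * t) * ?q ^ t)" if "y \<in> ?Q" "i < n" for y i
            using l0[OF that(2) l(2)[OF that(2)] xB] that(1) by blast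
          then have "\<exists>v\<in>Lambda_vec ?N. (\<exists>i<?N. v i \<noteq> 0) \<and>
            (\<forall>y\<in>?Q. wt_norm ?N wt (unip ?N (\<lambda>j. with_one f j y) v) \<le> \<epsilon>)"
            using PhiF_imp_short_vector[OF \<epsilon>(1) \<epsilon>\<delta>, of x d U f t ?Q] x
            unfolding A_def \<beta>_def wt_def[abs_def] by blast
          then obtain v i where v: "v \<in> Lambda_vec ?N" "i < ?N" "v i \<noteq> 0"
            "\<And>y. y \<in> ?Q \<Longrightarrow> wt_norm ?N wt (unip ?N (\<lambda>j. with_one f j y) v) \<le> \<epsilon>" by blast
          have "\<exists>y\<in>?Q. \<epsilon> < wt_norm ?N wt (unip ?N (\<lambda>j. with_one f j y) v)"
            by (rule marked_imp_no_short_vector[OF wt0 \<epsilon> _ v(1-3)])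
               (use mk in \<open>simp add: low_def[abs_def] tiny_def[abs_def] \<psi>_def[abs_def]\<close>)
          then show False using v(4) by (meson not_le)
        qed
        then show ?thesis unfolding kL by (auto simp: of_bool_def)
      qed
      obtain cs where cs: "set cs \<subseteq> vecF d" "real (length cs) = sumcells d L c k (\<lambda>Q. of_bool (?S \<inter> Q \<noteq> {}))"
        "?S \<subseteq> (\<Union>c'\<in>set cs. bal d c' (k + int L))"
        using cells_cover_list[of ?S d c k L] ck by blast
      let ?v = "\<lambda>j. ?q powi (- (int d * j))"
      have vol: "?q ^ (d * L) * ?v (k + int L) = ?v k"
      proof -
        have "?q ^ (d * L) * ?v (k + int L) = ?q powi int (d * L) * ?v (k + int L)"
          by (simp only: power_int_of_nat)
        also have "\<dots> = ?q powi (int (d * L) + - (int d * (k + int L)))"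
          by (rule power_int_add[symmetric]) simp
        also have "int (d * L) + - (int d * (k + int L)) = - (int d * k)"
          by (simp add: algebra_simps)
        finally show ?thesis .
      qed
      have "real (length cs) \<le> sumcells d L c k (\<lambda>Q. of_bool (\<not> marked (span_cmp ?N) low tiny (primitive ?N) Q))"
        unfolding cs(2) by (rule sumcells_mono) (fact ck(1), fact S_not_marked)
      also have "\<dots> \<le> nondiv_const (?q ^ d) ?N * M * ?q ^ (d * L)" by (rule nd)
      also have "\<dots> \<le> (nondiv_const (?q ^ d) ?N + 1) * M * ?q ^ (d * L)"
        by (intro mult_right_mono) (auto simp: M_def)
      also have "(nondiv_const (?q ^ d) ?N + 1) * M = C * \<delta> powr \<alpha>"
        using \<delta> by (simp add: C_def M_def \<epsilon>_def \<alpha>_def powr_powr)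
      finally have len: "real (length cs) \<le> C * \<delta> powr \<alpha> * ?q ^ (d * L)" .
      have "haarF d ?S \<le> ennreal (real (length cs) * ?v (k + int L))"
        by (rule haarF_le_list[OF d cs(1,3)])
      also have "\<dots> \<le> ennreal (C * \<delta> powr \<alpha> * ?q ^ (d * L) * ?v (k + int L))"
        using len by (intro ennreal_leI mult_right_mono) auto
      also have "\<dots> = ennreal (C * \<delta> powr \<alpha>) * ennreal (?v k)"
        using C vol by (simp add: mult.assoc ennreal_mult)
      also have "\<dots> \<le> ennreal (C * \<delta> powr \<alpha>) * haarF d B"
        unfolding ck(2) by (intro mult_left_mono haarF_bal_ge d ck(1)) auto
      finally show ?thesis .
    qed
    then show ?thesis unfolding eventually_sequentially by blast
  qed
  show ?thesis
  proof (rule exI[of _ "?q powi (- \<kappa>)"], intro conjI)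
    show "cballF d x0 (?q powi (- \<kappa>)) \<subseteq> U" using sub r0 by simp
    show "\<exists>C>0. \<exists>\<alpha>1>0. \<forall>B. is_ballF d B \<and> B \<subseteq> cballF d x0 (?q powi (- \<kappa>)) \<longrightarrow>
        (\<forall>\<delta>. 0 < \<delta> \<and> \<delta> < 1 \<longrightarrow> (\<forall>\<^sub>F t in sequentially.
            haarF d (PhiF d n U f t \<delta> \<inter> B) \<le> ennreal (C * \<delta> powr \<alpha>1) * haarF d B))"
      unfolding r0 using C \<alpha> main by blast
  qed simp
qed

lemma niceF_if_measure_bound:
  fixes U :: "(nat \<Rightarrow> 'k::{finite,field} fls) set"
  assumes y: "y \<in> vecF d" and r0: "0 < r0" "cballF d y r0 \<subseteq> U" and C: "0 < C" and \<alpha>: "0 < \<alpha>"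
    and bd: "\<And>B \<delta>. is_ballF d B \<Longrightarrow> B \<subseteq> cballF d y r0 \<Longrightarrow> 0 < \<delta> \<Longrightarrow> \<delta> < 1 \<Longrightarrow>
      \<forall>\<^sub>F t in sequentially. haarF d (PhiF d n U f t \<delta> \<inter> B) \<le> ennreal (C * \<delta> powr \<alpha>) * haarF d B"
  shows "niceF d n U f y"
proof -
  \<comment> \<open>Chosen so that \<open>C * \<delta> powr \<alpha>\<close> is at most 1/2, which
    serves as \<open>w\<close>. The ball around \<open>y\<close> is itself open and is taken as the
    neighbourhood.\<close>
  define \<delta> where "\<delta> = min (1/2) ((1 / (2 * C)) powr (1 / \<alpha>))"
  have \<delta>: "0 < \<delta>" "\<delta> < 1" using C by (auto simp: \<delta>_def)
  have "\<delta> powr \<alpha> \<le> ((1 / (2 * C)) powr (1 / \<alpha>)) powr \<alpha>"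
    using \<alpha> \<delta> by (intro powr_mono2) (auto simp: \<delta>_def)
  also have "\<dots> = 1 / (2 * C)" using C \<alpha> by (simp add: powr_powr)
  finally have half: "C * \<delta> powr \<alpha> \<le> 1/2" using C by (simp add: field_simps)
  obtain k where k: "\<And>c. cballF d (c :: nat \<Rightarrow> 'k fls) r0 = bal d c k" using cballF_is_bal[OF r0(1)] by blast
  have W: "\<exists>W. openF d W \<and> y \<in> W \<and> W \<subseteq> cballF d y r0"
    unfolding k using y by (intro exI[of _ "bal d y k"]) (auto simp: openF_bal)
  have lim: "limsup (\<lambda>t. haarF d (PhiF d n U f t \<delta> \<inter> cballF d c r)) \<le> ennreal (1/2) * haarF d (cballF d c r)"
    if cr: "c \<in> vecF d \<and> 0 < r \<and> r < 1 \<and> cballF d c r \<subseteq> cballF d y r0" for c r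
  proof (rule Limsup_bounded)
    have "\<forall>\<^sub>F t in sequentially. haarF d (PhiF d n U f t \<delta> \<inter> cballF d c r) \<le> ennreal (C * \<delta> powr \<alpha>) * haarF d (cballF d c r)"
      using cr \<delta> by (intro bd) (auto simp: is_ballF_def)
    moreover have "ennreal (C * \<delta> powr \<alpha>) * haarF d (cballF d c r) \<le> ennreal (1/2) * haarF d (cballF d c r)"
      by (intro mult_right_mono ennreal_leI half) auto
    ultimately show "\<forall>\<^sub>F t in sequentially. haarF d (PhiF d n U f t \<delta> \<inter> cballF d c r) \<le> ennreal (1/2) * haarF d (cballF d c r)"
      by (auto elim!: eventually_mono intro: order_trans)
  qed
  have "\<exists>\<delta> w. 0 < \<delta> \<and> \<delta> < 1 \<and> 0 < w \<and> w < 1 \<and>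
      (\<exists>\<rho>>0. \<forall>c r. c \<in> vecF d \<and> 0 < r \<and> r < \<rho> \<and> cballF d c r \<subseteq> cballF d y r0 \<longrightarrow>
         limsup (\<lambda>t. haarF d (PhiF d n U f t \<delta> \<inter> cballF d c r)) \<le> ennreal w * haarF d (cballF d c r))"
    by (rule exI[of _ \<delta>], rule exI[of _ "1/2"], intro conjI \<delta>, simp, simp, rule exI[of _ 1], rule conjI, simp)
       (use lim in blast)
  then show ?thesis
    unfolding niceF_def using r0(2) W by blast
qed

theorem mainTheorem17:
  fixes U :: "(nat \<Rightarrow> 'k::{finite,field} fls) set"
    and f :: "(nat \<Rightarrow> 'k fls) \<Rightarrow> nat \<Rightarrow> 'k fls"
    and d n :: nat and x0 :: "nat \<Rightarrow> 'k fls"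
  assumes "0 < d" and "0 < n"
    and "openF d U" and "x0 \<in> U"
    and "condII d n U f" and "condIII d n U f" and "condIV d n U f"
  shows "(\<exists>r0>0. cballF d x0 r0 \<subseteq> U \<and>
           (\<exists>C>0. \<exists>\<alpha>1>0. \<forall>B. is_ballF d B \<and> B \<subseteq> cballF d x0 r0 \<longrightarrow>
              (\<forall>\<delta>. 0 < \<delta> \<and> \<delta> < 1 \<longrightarrow>
                 (\<forall>\<^sub>F t in sequentially.
                    haarF d (PhiF d n U f t \<delta> \<inter> B) \<le> ennreal (C * \<delta> powr \<alpha>1) * haarF d B))))
         \<and> (\<forall>y\<in>U. niceF d n U f y)"
proof (rule conjI[OF local_measure_bound[OF assms(1-6)]], rule ballI)
  fix y assume y: "y \<in> U"
  have yv: "y \<in> vecF d" using y assms(3) by (auto simp: openF_def)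
  obtain r0 C \<alpha> where r: "0 < r0" "cballF d y r0 \<subseteq> U" "0 < C" "0 < \<alpha>"
    and bd: "\<forall>B. is_ballF d B \<and> B \<subseteq> cballF d y r0 \<longrightarrow> (\<forall>\<delta>. 0 < \<delta> \<and> \<delta> < 1 \<longrightarrow>
      (\<forall>\<^sub>F t in sequentially. haarF d (PhiF d n U f t \<delta> \<inter> B) \<le> ennreal (C * \<delta> powr \<alpha>) * haarF d B))"
    using local_measure_bound[OF assms(1-3) y assms(5,6)] by (elim exE conjE) (rule that; assumption)
  show "niceF d n U f y"
    by (rule niceF_if_measure_bound[OF yv r]) (use bd in simp)
qed

end
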